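(* There is an absolute constant $L$ such that the following holds for every $n$. Let $q\in[0,1]$, let $H$ be a $q$-sparse graph on $n$ vertices, and let $p=Lq$. If $F$ is a clique $K_r$ or a cycle $C_k$ (of any size, possibly depending on $n$), then \[ N(H,F) < \mathbb{E}_pX_F. \]
   Context: All graphs are simple. A copy of a graph $J$ in a graph $G$ is an unlabeled subgraph of $G$ isomorphic to $J$, and $N(G,J)$ denotes the number of copies of $J$ in $G$. $G_{n,p}$ is the Erdős–Rényi random graph on $n$ vertices, and $\mathbb{E}_pX_J:=\mathbb{E}\,N(G_{n,p},J)=N(K_n,J)p^{e_J}$, where $e_J$ is the number of edges of $J$. A graph $H$ on $n$ vertices (i.e. a subgraph of $K_n$) is $q$-sparse if $\mathbb{E}_qX_I\ge 1$ for every subgraph $I\subseteq H$.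
   Formalization: Proved for 0 < q ≤ 1, cliques K_r with 2 ≤ r ≤ n and cycles C_k with 3 ≤ k ≤ n; in the excluded cases (q = 0, r ≤ 1, or F larger than n) both sides are equal, so the strict inequality fails. *)

theory Defs
  imports "HOL-Probability.Probability"
begin

type_synonym 'a ugraph = "'a set \<times> 'a set set"

abbreviation verts :: "'a ugraph \<Rightarrow> 'a set" where "verts G \<equiv> fst G"
abbreviation edges :: "'a ugraph \<Rightarrow> 'a set set" where "edges G \<equiv> snd G"

definition simple_graph :: "'a ugraph \<Rightarrow> bool" where
  "simple_graph G \<longleftrightarrow> finite (verts G) \<and> edges G \<subseteq> {e. e \<subseteq> verts G \<and> card e = 2}"

definition subgraph :: "'a ugraph \<Rightarrow> 'a ugraph \<Rightarrow> bool" where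
  "subgraph I G \<longleftrightarrow> simple_graph I \<and> verts I \<subseteq> verts G \<and> edges I \<subseteq> edges G"

definition graph_iso :: "'a ugraph \<Rightarrow> 'b ugraph \<Rightarrow> bool" where
  "graph_iso G H \<longleftrightarrow> (\<exists>f. bij_betw f (verts G) (verts H) \<and> (\<lambda>e. f ` e) ` edges G = edges H)"

definition copies :: "'a ugraph \<Rightarrow> 'b ugraph \<Rightarrow> 'a ugraph set" where
  "copies G J = {I. subgraph I G \<and> graph_iso I J}"

definition num_copies :: "'a ugraph \<Rightarrow> 'b ugraph \<Rightarrow> nat" where
  "num_copies G J = card (copies G J)"

definition clique_graph :: "nat \<Rightarrow> nat ugraph" where
  "clique_graph n = ({..<n}, {e. e \<subseteq> {..<n} \<and> card e = 2})"

text \<open>This is a cycle only for \<open>k \<ge> 3\<close>.\<close>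

definition cycle_graph :: "nat \<Rightarrow> nat ugraph" where
  "cycle_graph k = ({..<k}, {{i, Suc i mod k} | i. i < k})"

text \<open>
  The expected number of copies of \<open>J\<close> in \<open>G(n,p)\<close>, through its closed form, which keeps a meaning
  for \<open>p > 1\<close>. Lemma \<open>expectation_num_copies\<close> below justifies it for \<open>0 \<le> p \<le> 1\<close>.
\<close>

definition expected_copies :: "nat \<Rightarrow> real \<Rightarrow> 'b ugraph \<Rightarrow> real" where
  "expected_copies n p J = real (num_copies (clique_graph n) J) * p ^ card (edges J)"

definition q_sparse :: "nat \<Rightarrow> real \<Rightarrow> nat ugraph \<Rightarrow> bool" where
  "q_sparse n q H \<longleftrightarrow> (\<forall>I. subgraph I H \<longrightarrow> expected_copies n q I \<ge> 1)"

definition random_graph :: "nat \<Rightarrow> real \<Rightarrow> nat ugraph pmf" where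
  "random_graph n p =
     map_pmf (\<lambda>b. ({..<n}, {e \<in> edges (clique_graph n). b e}))
       (Pi_pmf (edges (clique_graph n)) False (\<lambda>_. bernoulli_pmf p))"

lemma finite_edges_complete: "finite (edges (clique_graph n))"
  by (rule finite_subset[of _ "Pow {..<n}"]) (auto simp: clique_graph_def)

lemma finite_copies_complete: "finite (copies (clique_graph n) J)"
  by (rule finite_subset[of _ "Pow {..<n} \<times> Pow (edges (clique_graph n))"])
     (auto simp: copies_def subgraph_def clique_graph_def)

lemma card_edges_copy:
  assumes "simple_graph I" "graph_iso I J"
  shows "card (edges I) = card (edges J)"
proof -
  obtain f where f: "bij_betw f (verts I) (verts J)" "(\<lambda>e. f ` e) ` edges I = edges J"
    using assms(2) unfolding graph_iso_def by blast
  have "inj_on (\<lambda>e. f ` e) (edges I)"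
  proof (rule inj_onI)
    fix x y assume "x \<in> edges I" "y \<in> edges I" "f ` x = f ` y"
    moreover from this have "x \<subseteq> verts I" "y \<subseteq> verts I"
      using assms(1) by (auto simp: simple_graph_def)
    ultimately show "x = y"
      using inj_on_image_eq_iff[OF bij_betw_imp_inj_on[OF f(1)]] by blast
  qed
  then show ?thesis
    using card_image f(2) by metis
qed

lemma expectation_num_copies:
  assumes "0 \<le> p" "p \<le> 1"
  shows "measure_pmf.expectation (random_graph n p) (\<lambda>G. real (num_copies G J)) =
           expected_copies n p J"
proof -
  let ?E = "edges (clique_graph n)" and ?C = "copies (clique_graph n) J"
  let ?P = "Pi_pmf ?E False (\<lambda>_. bernoulli_pmf p)"
  have *: "real (num_copies ({..<n}, {e \<in> ?E. b e}) J) = (\<Sum>I\<in>?C. indicator {b. \<forall>e\<in>edges I. b e} b)"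
    for b
  proof -
    have "copies ({..<n}, {e \<in> ?E. b e}) J = {I \<in> ?C. \<forall>e\<in>edges I. b e}"
      by (auto simp: copies_def subgraph_def clique_graph_def)
    then show ?thesis
      by (simp add: num_copies_def indicator_def finite_copies_complete sum.If_cases Int_def)
  qed
  have **: "measure_pmf.prob ?P {b. \<forall>e\<in>edges I. b e} = p ^ card (edges J)" if "I \<in> ?C" for I
  proof -
    have I: "edges I \<subseteq> ?E" "card (edges I) = card (edges J)"
      using that card_edges_copy[of I J] unfolding copies_def subgraph_def by blast+
    have "measure_pmf.prob ?P {b. \<forall>e\<in>edges I. b e} =
            measure_pmf.prob ?P (Pi ?E (\<lambda>e. if e \<in> edges I then {True} else UNIV))"
      using I(1) by (intro arg_cong[where f = "measure_pmf.prob ?P"]) (auto simp: Pi_def)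
    also have "\<dots> = (\<Prod>e\<in>?E. measure_pmf.prob (bernoulli_pmf p) (if e \<in> edges I then {True} else UNIV))"
      by (rule measure_Pi_pmf_Pi[OF finite_edges_complete])
    also have "\<dots> = (\<Prod>e\<in>?E. if e \<in> edges I then p else 1)"
      using assms by (intro prod.cong) (auto simp: measure_pmf_single)
    also have "\<dots> = p ^ card (edges I)"
      using I(1) finite_edges_complete by (simp add: prod.If_cases Int_absorb1)
    finally show ?thesis using I(2) by simp
  qed
  have "measure_pmf.expectation (random_graph n p) (\<lambda>G. real (num_copies G J)) =
          measure_pmf.expectation ?P (\<lambda>b. \<Sum>I\<in>?C. indicator {b. \<forall>e\<in>edges I. b e} b)"
    by (simp add: random_graph_def *)
  also have "\<dots> = (\<Sum>I\<in>?C. measure_pmf.prob ?P {b. \<forall>e\<in>edges I. b e})"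
    by (subst Bochner_Integration.integral_sum)
       (auto intro!: measure_pmf.integrable_const_bound[where B = 1] simp: indicator_def)
  also have "\<dots> = expected_copies n p J"
    using ** by (simp add: expected_copies_def num_copies_def)
  finally show ?thesis .
qed

end

theory Submission
  imports Defs "HOL-Number_Theory.Cong"
begin

text \<open>
  Write \<open>k\<close> and \<open>f\<close> for the numbers of vertices and edges of \<open>F\<close>, and \<open>M = N(K_n, F)\<close>. Only two
  consequences of sparsity are used: \<open>n^v q^e \<ge> 1\<close> for every subgraph of \<open>H\<close> with \<open>v\<close> vertices and
  \<open>e\<close> edges, and the bound \<open>exp 1 \<cdot> M q^f\<close> on the number of pairwise edge-disjoint copies of \<open>F\<close>
  in \<open>H\<close>.

  If \<open>n^(k-1) q^f \<le> 1\<close>, the first one becomes \<open>(k - 1) e \<le> f v\<close>, which forces the number of copies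
  of \<open>F\<close> through a fixed edge to be at most \<open>16^f\<close>; a maximal edge-disjoint family then controls
  all copies.

  If \<open>n^(k-1) q^f > 1\<close>, cliques are counted through the degeneracy of \<open>H\<close>. For cycles, Hall's
  theorem turns the maximal density \<open>a / b\<close> of \<open>H\<close> into a fractional orientation: each edge splits
  \<open>b\<close> tokens between its ends and each vertex receives at most \<open>a\<close>. A cycle is explored by following
  each edge out of the end with many tokens, the meaning of \<open>many\<close> being given by a threshold.
  Averaging over the threshold shows that some choice needs few enough arbitrary vertices
  and costs only a factor exponential in \<open>k\<close>.
\<close>

section \<open>Copies and sparsity\<close>

text \<open>Since \<open>F\<close> may grow with \<open>n\<close>, only losses of the form
  \<open>C ^ f\<close> can be absorbed by \<open>L ^ f\<close>. The two cases meet where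
  \<open>n^k q^f = n\<close>: above this value a count can afford one arbitrary vertex, below it not
  even that, hence the count through a fixed edge.

  For cycles, following one fixed orientation fails: it may alternate along a cycle, and every
  maximal backward run costs a factor \<open>n\<close>. Tokens prevent this. Let a densest subgraph
  have \<open>b\<close> vertices and \<open>a = b + h\<close> edges. The tokens at the tails of
  successive edges of a cycle rise by at most \<open>h\<close> per step, so when they range over
  almost all of \<open>0..b\<close>, a threshold is crossed on average at most about
  \<open>k h / (b + h)\<close> times. Sparsity of the densest subgraph reads
  \<open>h ln n <= (b + h) ln (n q)\<close>, so a factor \<open>n\<close> per crossing stays within
  the budget \<open>(n q)^k\<close>.

  The constant \<open>exp 60\<close> comes from this case: per vertex, \<open>exp 50\<close> for the
  exploration, \<open>4\<close> for the pattern and the start, and \<open>exp 1\<close> for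
  comparing \<open>n ^ k\<close> with the labelled copies in \<open>K_n\<close>.\<close>

lemma simple_graph_clique: "simple_graph (clique_graph n)"
  by (auto simp: simple_graph_def clique_graph_def)

lemma verts_clique [simp]: "verts (clique_graph n) = {..<n}"
  by (simp add: clique_graph_def)

lemma subgraph_trans: "subgraph I G \<Longrightarrow> subgraph G K \<Longrightarrow> subgraph I K"
  unfolding subgraph_def by blast

lemma finite_edges: "simple_graph G \<Longrightarrow> finite (edges G)"
  unfolding simple_graph_def by (metis (no_types, lifting) finite_Collect_subsets finite_subset mem_Collect_eq subset_eq)

lemma finite_copies:
  assumes "simple_graph G" shows "finite (copies G F)"
proof (rule finite_subset)
  show "copies G F \<subseteq> Pow (verts G) \<times> Pow (edges G)"
    unfolding copies_def subgraph_def by auto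
  show "finite (Pow (verts G) \<times> Pow (edges G))"
    using assms finite_edges simple_graph_def by blast
qed

text \<open>\<open>k ^ k / fact k\<close> is one term of the exponential series at
  \<open>k\<close>.\<close>

lemma fact_ge_exp_power: "(real k / exp 1) ^ k \<le> fact k"
proof -
  have "real k ^ k / fact k \<le> exp (real k)"
  proof -
    have s: "summable (\<lambda>i. real k ^ i /\<^sub>R fact i)" by (rule summable_exp_generic)
    have "(\<Sum>i\<in>{k}. real k ^ i /\<^sub>R fact i) \<le> (\<Sum>i. real k ^ i /\<^sub>R fact i)"
      by (rule sum_le_suminf[OF s]) auto
    then show ?thesis by (simp add: exp_def divide_inverse mult.commute)
  qed
  then have "real k ^ k \<le> fact k * exp (real k)" by (simp add: field_simps)
  moreover have "exp (real k) = exp 1 ^ k" by (simp add: exp_of_nat_mult[symmetric])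
  ultimately show ?thesis by (simp add: power_divide field_simps)
qed

text \<open>Every copy is the image of \<open>I\<close> under the inverse of its isomorphism, so
  maps from \<open>verts I\<close> to \<open>{..<n}\<close> cover all copies.\<close>

lemma num_copies_complete_le:
  assumes "simple_graph I"
  shows "num_copies (clique_graph n) I \<le> n ^ card (verts I)"
proof -
  let ?W = "verts I" and ?g = "\<lambda>g. (g ` verts I, (\<lambda>e. g ` e) ` edges I)"
  have fin: "finite ?W" using assms by (simp add: simple_graph_def)
  have "copies (clique_graph n) I \<subseteq> ?g ` (?W \<rightarrow>\<^sub>E {..<n})"
  proof
    fix J assume J: "J \<in> copies (clique_graph n) I"
    then have sJ: "simple_graph J" "verts J \<subseteq> {..<n}" by (auto simp: copies_def subgraph_def)
    obtain f where f: "bij_betw f (verts J) ?W" "(\<lambda>e. f ` e) ` edges J = edges I"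
      using J by (auto simp: copies_def graph_iso_def)
    define g where "g = restrict (the_inv_into (verts J) f) ?W"
    have g: "g (f v) = v" if "v \<in> verts J" for v
      using that f(1) by (auto simp: g_def bij_betw_def the_inv_into_f_f)
    have 1: "g ` ?W = verts J"
    proof -
      have "g ` ?W = g ` f ` verts J" using f(1) by (simp add: bij_betw_def)
      also have "\<dots> = verts J" using g by (force simp: image_iff)
      finally show ?thesis .
    qed
    have "g ` f ` e = e" if "e \<in> edges J" for e
    proof -
      have "e \<subseteq> verts J" using sJ that by (auto simp: simple_graph_def)
      then show ?thesis using g by (force simp: image_iff)
    qed
    then have 2: "(\<lambda>e. g ` e) ` edges I = edges J"
      unfolding f(2)[symmetric] by (force simp: image_image)
    have "g \<in> ?W \<rightarrow>\<^sub>E {..<n}" using 1 sJ by (auto simp: g_def)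
    with 1 2 show "J \<in> ?g ` (?W \<rightarrow>\<^sub>E {..<n})" by (metis (no_types, lifting) image_eqI prod.collapse)
  qed
  then have "card (copies (clique_graph n) I) \<le> card (?W \<rightarrow>\<^sub>E {..<n})"
    by (meson card_image_le card_mono fin finite_PiE finite_imageI finite_lessThan le_trans)
  then show ?thesis by (simp add: num_copies_def card_PiE fin)
qed

lemma q_sparse_density:
  assumes "q_sparse n q H" "subgraph I H" "0 < q"
  shows "1 \<le> real n ^ card (verts I) * q ^ card (edges I)"
proof -
  have "1 \<le> expected_copies n q I" using assms unfolding q_sparse_def by blast
  also have "\<dots> \<le> real n ^ card (verts I) * q ^ card (edges I)"
    unfolding expected_copies_def
    using num_copies_complete_le[of I n] assms
    by (intro mult_right_mono) (auto simp: subgraph_def simp flip: of_nat_power)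
  finally show ?thesis .
qed

text \<open>
  Let \<open>y\<close> be the size of the family and \<open>I\<close> its union. A copy of \<open>I\<close> in \<open>K_n\<close> is determined by a set
  of \<open>y\<close> copies of \<open>F\<close>, so with \<open>M = N(K_n, F)\<close> the expected number of copies of \<open>I\<close> is at most
  \<open>(M choose y) q^(y e_F)\<close>, which is below 1 once \<open>y\<close> exceeds \<open>e\<close> times \<open>M q^(e_F)\<close>.
\<close>

lemma edge_disjoint_copies_le:
  assumes sp: "q_sparse n q H" and H: "subgraph H (clique_graph n)" and q: "0 < q"
    and L: "A \<subseteq> copies H F" and disj: "\<And>J K. J \<in> A \<Longrightarrow> K \<in> A \<Longrightarrow> J \<noteq> K \<Longrightarrow> edges J \<inter> edges K = {}"
  shows "real (card A) \<le> exp 1 * expected_copies n q F"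
proof -
  define y where "y = card A"
  define M where "M = num_copies (clique_graph n) F"
  define f where "f = card (edges F)"
  have sH: "simple_graph H" using H by (simp add: subgraph_def)
  have finA: "finite A" using L finite_copies[OF sH] finite_subset by blast
  have A: "simple_graph J" "subgraph J H" "graph_iso J F" "card (edges J) = f" if "J \<in> A" for J
    using that L card_edges_copy[of J F] unfolding copies_def subgraph_def f_def by blast+
  define I where "I = (\<Union>(verts ` A), \<Union>(edges ` A))"
  have sI: "simple_graph I"
    unfolding simple_graph_def I_def fst_conv snd_conv
  proof
    show "finite (\<Union>(verts ` A))" using finA A(1) by (simp add: simple_graph_def)
    show "\<Union>(edges ` A) \<subseteq> {e. e \<subseteq> \<Union>(verts ` A) \<and> card e = 2}"
      using A(1) unfolding simple_graph_def by blast
  qed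
  have subI: "subgraph I H"
    using sI A(2) unfolding I_def subgraph_def fst_conv snd_conv by blast
  have "card (edges I) = (\<Sum>J\<in>A. card (edges J))"
    unfolding I_def snd_conv
    by (rule card_UN_disjoint) (use finA A(1) finite_edges disj in auto)
  then have eI: "card (edges I) = f * y" using A(4) by (simp add: y_def)
  define P where "P = {B. B \<subseteq> copies (clique_graph n) F \<and> card B = y}"
  let ?U = "\<lambda>B::nat ugraph set. (\<Union>(verts ` B), \<Union>(edges ` B))"
  have "copies (clique_graph n) I \<subseteq> ?U ` P"
  proof
    fix J assume J: "J \<in> copies (clique_graph n) I"
    then have sJ: "simple_graph J" "subgraph J (clique_graph n)" by (auto simp: copies_def subgraph_def)
    obtain h where h: "bij_betw h (verts J) (verts I)" "(\<lambda>e. h ` e) ` edges J = edges I"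
      using J by (auto simp: copies_def graph_iso_def)
    define g where "g = the_inv_into (verts J) h"
    have gh: "g (h v) = v" if "v \<in> verts J" for v
      using that h(1) by (auto simp: g_def bij_betw_def the_inv_into_f_f)
    have hg: "h (g w) = w" if "w \<in> verts I" for w
      using that h(1) by (auto simp: g_def f_the_inv_into_f_bij_betw)
    have g: "bij_betw g (verts I) (verts J)"
      unfolding g_def by (rule bij_betw_the_inv_into[OF h(1)])
    have "g ` h ` e = e" if "e \<in> edges J" for e
    proof -
      have "e \<subseteq> verts J" using sJ that by (auto simp: simple_graph_def)
      then show ?thesis using gh by (force simp: image_iff)
    qed
    then have gE: "(\<lambda>e. g ` e) ` edges I = edges J"
      unfolding h(2)[symmetric] by (force simp: image_image)
    \<comment> \<open>Transporting the family along \<open>g\<close> decomposes \<open>J\<close>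
      into \<open>y\<close> distinct copies of \<open>F\<close> in \<open>K_n\<close>. Their union
      is \<open>J\<close>, so this set of copies determines \<open>J\<close>.\<close>
    define m where "m = (\<lambda>K::nat ugraph. (g ` verts K, (\<lambda>e. g ` e) ` edges K))"
    have KI: "verts K \<subseteq> verts I" "edges K \<subseteq> edges I" if "K \<in> A" for K
      using that by (auto simp: I_def)
    have hgK: "h ` g ` S = S" if "S \<subseteq> verts I" for S
      using that hg by (force simp: image_iff)
    have eK: "e \<subseteq> verts K" if "K \<in> A" "e \<in> edges K" for K e
      using A(1)[OF that(1)] that(2) by (auto simp: simple_graph_def)
    have hgE: "(\<lambda>e. h ` e) ` (\<lambda>e. g ` e) ` edges K = edges K" if "K \<in> A" for K
    proof -
      have "h ` g ` e = e" if "e \<in> edges K" for e using hgK[of e] eK[OF \<open>K \<in> A\<close> that] KI(1)[OF \<open>K \<in> A\<close>] by blast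
      then show ?thesis by (force simp: image_image)
    qed
    have "inj_on m A"
    proof (rule inj_onI)
      fix K K' assume a: "K \<in> A" "K' \<in> A" "m K = m K'"
      have m: "g ` verts K = g ` verts K'" "(\<lambda>e. g ` e) ` edges K = (\<lambda>e. g ` e) ` edges K'"
        using a(3) unfolding m_def by (blast dest: Pair_inject)+
      have "edges K = edges K'" by (rule trans[OF hgE[OF a(1), symmetric]]) (simp only: m(2) hgE[OF a(2)])
      moreover have "verts K = verts K'"
        by (rule trans[OF hgK[OF KI(1)[OF a(1)], symmetric]]) (simp only: m(1) hgK[OF KI(1)[OF a(2)]])
      ultimately show "K = K'" by (simp add: prod_eq_iff)
    qed
    then have c: "card (m ` A) = y" by (simp add: y_def card_image)
    have "m K \<in> copies (clique_graph n) F" if K: "K \<in> A" for K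
    proof -
      have injg: "inj_on g (verts I)" using g by (simp add: bij_betw_def)
      have v: "verts (m K) \<subseteq> verts J" using g KI(1)[OF K] by (auto simp: m_def bij_betw_def)
      have e: "edges (m K) \<subseteq> edges J" using gE KI(2)[OF K] by (auto simp: m_def)
      have s: "simple_graph (m K)"
        unfolding simple_graph_def
      proof
        show "finite (verts (m K))" using v sJ by (meson finite_subset simple_graph_def)
        show "edges (m K) \<subseteq> {e. e \<subseteq> verts (m K) \<and> card e = 2}"
        proof (intro subsetI CollectI conjI)
          fix x assume x: "x \<in> edges (m K)"
          show "card x = 2" using x e sJ(1) unfolding simple_graph_def by blast
          obtain x' where "x' \<in> edges K" "x = g ` x'" using x by (auto simp: m_def)
          then show "v \<in> verts (m K)" if "v \<in> x" for v using eK[OF K] that by (auto simp: m_def)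
        qed
      qed
      obtain p where p: "bij_betw p (verts K) (verts F)" "(\<lambda>e. p ` e) ` edges K = edges F"
        using A(3)[OF K] by (auto simp: graph_iso_def)
      have "bij_betw h (verts (m K)) (verts K)"
        using hgK[OF KI(1)[OF K]] inj_on_subset[OF bij_betw_imp_inj_on[OF h(1)] v]
        unfolding bij_betw_def by (simp add: m_def)
      then have 1: "bij_betw (p \<circ> h) (verts (m K)) (verts F)" using p(1) by (rule bij_betw_trans)
      have "(\<lambda>e. (p \<circ> h) ` e) ` edges (m K) = (\<lambda>e. p ` e) ` (\<lambda>e. h ` e) ` edges (m K)"
        by (simp add: image_image image_comp[symmetric])
      also have "\<dots> = edges F" unfolding m_def snd_conv hgE[OF K] by (rule p(2))
      finally have "graph_iso (m K) F" using 1 unfolding graph_iso_def by blast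
      moreover have "subgraph (m K) (clique_graph n)" using v e s sJ(2) unfolding subgraph_def by blast
      ultimately show ?thesis by (simp add: copies_def)
    qed
    then have "m ` A \<in> P" using c by (auto simp: P_def)
    moreover have "?U (m ` A) = J"
    proof -
      have "\<Union>(verts ` m ` A) = g ` verts I" by (auto simp: m_def I_def)
      moreover have "\<Union>(edges ` m ` A) = (\<lambda>e. g ` e) ` edges I" by (auto simp: m_def I_def)
      ultimately show ?thesis using gE g by (simp add: bij_betw_def prod_eq_iff)
    qed
    ultimately show "J \<in> ?U ` P" by (metis (no_types, lifting) image_eqI)
  qed
  moreover have finP: "finite P"
    by (rule finite_subset[of _ "Pow (copies (clique_graph n) F)"]) (auto simp: P_def finite_copies_complete)
  ultimately have "num_copies (clique_graph n) I \<le> card P"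
    unfolding num_copies_def by (meson card_image_le card_mono finite_imageI le_trans)
  also have "card P = M choose y"
    unfolding P_def M_def num_copies_def by (rule n_subsets[OF finite_copies_complete])
  finally have NI: "num_copies (clique_graph n) I \<le> M choose y" .
  show ?thesis
  proof (cases "y = 0")
    case True
    then show ?thesis using q by (simp add: y_def expected_copies_def)
  next
    case False
    have "1 \<le> expected_copies n q I" using sp subI unfolding q_sparse_def by blast
    also have "\<dots> \<le> real (M choose y) * q ^ (f * y)"
      unfolding expected_copies_def eI using NI q by (intro mult_right_mono) auto
    also have "\<dots> \<le> real M ^ y / fact y * q ^ (f * y)"
    proof (intro mult_right_mono)
      have "real (fact y * (M choose y)) \<le> real (M ^ y)"
        by (metis binomial_fact_pow mult.commute of_nat_mono)
      then show "real (M choose y) \<le> real M ^ y / fact y" by (simp add: field_simps)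
    qed (use q in auto)
    finally have "fact y \<le> (real M * q ^ f) ^ y"
      by (simp add: field_simps power_mult power_mult_distrib)
    with fact_ge_exp_power[of y] have "(real y / exp 1) ^ y \<le> (real M * q ^ f) ^ y" by linarith
    then have "real y / exp 1 \<le> real M * q ^ f"
      by (rule power_le_imp_le_base[of _ "y - 1", unfolded Suc_diff_1[OF False[unfolded neq0_conv]]]) (use q in auto)
    then show ?thesis by (simp add: y_def expected_copies_def M_def f_def field_simps)
  qed
qed

text \<open>By maximality each copy shares an edge with a member of the family (a member does so
  with itself, as \<open>F\<close> has edges). The copies are thus covered by
  \<open>card A * card (edges F)\<close> sets of size at most \<open>X\<close>.\<close>

lemma num_copies_le_edge_degree:
  assumes sp: "q_sparse n q H" and H: "subgraph H (clique_graph n)" and q: "0 < q"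
    and F: "edges F \<noteq> {}"
    and X: "\<And>e. e \<in> edges H \<Longrightarrow> card {J \<in> copies H F. e \<in> edges J} \<le> X"
  shows "real (num_copies H F) \<le> exp 1 * expected_copies n q F * (card (edges F) * X)"
proof -
  have sH: "simple_graph H" using H by (simp add: subgraph_def)
  have fin: "finite (copies H F)" by (rule finite_copies[OF sH])
  define Q where "Q = (\<lambda>A. A \<subseteq> copies H F \<and> (\<forall>J\<in>A. \<forall>K\<in>A. J \<noteq> K \<longrightarrow> edges J \<inter> edges K = {}))"
  have finQ: "finite (Collect Q)" unfolding Q_def using fin by auto
  have "Q {}" by (simp add: Q_def)
  then obtain A where A: "Q A" "\<And>B. Q B \<Longrightarrow> A \<subseteq> B \<Longrightarrow> B = A"
    using finite_has_maximal2[OF finQ, of "{}"] by auto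
  have edge: "card (edges J) = card (edges F)" "edges J \<subseteq> edges H" "finite (edges J)" if "J \<in> copies H F" for J
    using that card_edges_copy[of J F] finite_edges[of J] unfolding copies_def subgraph_def by auto
  have "copies H F \<subseteq> (\<Union>J\<in>A. \<Union>e\<in>edges J. {K \<in> copies H F. e \<in> edges K})"
  proof
    fix K assume K: "K \<in> copies H F"
    have "\<exists>J\<in>A. edges J \<inter> edges K \<noteq> {}"
    proof (rule ccontr)
      assume n: "\<not> ?thesis"
      then have "Q (insert K A)" using A(1) K unfolding Q_def by blast
      then have "K \<in> A" using A(2)[of "insert K A"] by blast
      moreover have "edges K \<noteq> {}" using K F unfolding copies_def graph_iso_def by blast
      ultimately show False using n by blast
    qed
    then show "K \<in> (\<Union>J\<in>A. \<Union>e\<in>edges J. {K \<in> copies H F. e \<in> edges K})" using K by blast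
  qed
  moreover have AH: "A \<subseteq> copies H F" using A(1) by (simp add: Q_def)
  have finA: "finite A" using AH fin finite_subset by blast
  have finU: "finite (\<Union>J\<in>A. \<Union>e\<in>edges J. {K \<in> copies H F. e \<in> edges K})"
    using finA fin AH edge(3) by auto
  ultimately have "num_copies H F \<le> card (\<Union>J\<in>A. \<Union>e\<in>edges J. {K \<in> copies H F. e \<in> edges K})"
    unfolding num_copies_def using card_mono by blast
  also have "\<dots> \<le> (\<Sum>J\<in>A. card (\<Union>e\<in>edges J. {K \<in> copies H F. e \<in> edges K}))"
    by (rule card_UN_le[OF finA])
  also have "\<dots> \<le> (\<Sum>J\<in>A. card (edges F) * X)"
  proof (rule sum_mono)
    fix J assume "J \<in> A"
    then have J: "J \<in> copies H F" using AH by blast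
    have "card (\<Union>e\<in>edges J. {K \<in> copies H F. e \<in> edges K}) \<le> (\<Sum>e\<in>edges J. card {K \<in> copies H F. e \<in> edges K})"
      by (rule card_UN_le[OF edge(3)[OF J]])
    also have "\<dots> \<le> (\<Sum>e\<in>edges J. X)" using X edge(2)[OF J] by (intro sum_mono) blast
    finally show "card (\<Union>e\<in>edges J. {K \<in> copies H F. e \<in> edges K}) \<le> card (edges F) * X"
      using edge(1)[OF J] by simp
  qed
  also have "\<dots> = card A * (card (edges F) * X)" by simp
  finally have "real (num_copies H F) \<le> real (card A) * (card (edges F) * X)"
    by (metis of_nat_mono of_nat_mult)
  also have "\<dots> \<le> exp 1 * expected_copies n q F * (card (edges F) * X)"
    using edge_disjoint_copies_le[OF sp H q AH] A(1)
    by (intro mult_right_mono) (auto simp: Q_def)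
  finally show ?thesis .
qed

section \<open>Embeddings and cliques\<close>

text \<open>Extensional functions represent each labelled copy once. In \<open>H\<close> and in
  \<open>K_n\<close> they outnumber the unlabelled copies by the same factor
  \<open>card (embeddings F F)\<close>, the number of automorphisms, which cancels from the
  comparison.\<close>

definition embeddings :: "'a ugraph \<Rightarrow> 'b ugraph \<Rightarrow> ('b \<Rightarrow> 'a) set" where
  "embeddings G F = {x \<in> verts F \<rightarrow>\<^sub>E verts G. inj_on x (verts F) \<and> (\<forall>e\<in>edges F. x ` e \<in> edges G)}"

text \<open>An injection of a finite set into itself is onto. Applied to vertices and to edges, this
  makes every self-embedding an automorphism.\<close>

lemma embeddings_self:
  assumes "simple_graph F" "y \<in> embeddings F F"
  shows "y ` verts F = verts F" "(\<lambda>e. y ` e) ` edges F = edges F"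
proof -
  have y: "y ` verts F \<subseteq> verts F" "inj_on y (verts F)" "(\<lambda>e. y ` e) ` edges F \<subseteq> edges F"
    using assms(2) by (auto simp: embeddings_def)
  show "y ` verts F = verts F"
    using y assms(1) by (intro endo_inj_surj) (auto simp: simple_graph_def)
  have "inj_on (\<lambda>e. y ` e) (edges F)"
  proof (rule inj_onI)
    fix a b assume "a \<in> edges F" "b \<in> edges F" "y ` a = y ` b"
    then show "a = b"
      using assms(1) inj_on_image_eq_iff[OF y(2), of a b] unfolding simple_graph_def by blast
  qed
  then show "(\<lambda>e. y ` e) ` edges F = edges F"
    using y(3) finite_edges[OF assms(1)] by (intro endo_inj_surj) auto
qed

text \<open>Composition with a fixed isomorphism from \<open>J\<close> to \<open>F\<close> is a
  bijection from the embeddings onto \<open>J\<close> to the automorphisms of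
  \<open>F\<close>.\<close>

lemma card_embeddings_image:
  assumes sF: "simple_graph F" and J: "J \<in> copies G F"
  shows "card {x \<in> embeddings G F. x ` verts F = verts J \<and> (\<lambda>e. x ` e) ` edges F = edges J} =
    card (embeddings F F)"
proof -
  have sJ: "simple_graph J" "verts J \<subseteq> verts G" "edges J \<subseteq> edges G"
    using J by (auto simp: copies_def subgraph_def)
  obtain h where h: "bij_betw h (verts J) (verts F)" "(\<lambda>e. h ` e) ` edges J = edges F"
    using J by (auto simp: copies_def graph_iso_def)
  define g where "g = the_inv_into (verts J) h"
  have gh: "g (h v) = v" if "v \<in> verts J" for v
    using that h(1) by (auto simp: g_def bij_betw_def the_inv_into_f_f)
  have hg: "h (g w) = w" if "w \<in> verts F" for w
    using that h(1) by (auto simp: g_def f_the_inv_into_f_bij_betw)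
  have g: "bij_betw g (verts F) (verts J)"
    unfolding g_def by (rule bij_betw_the_inv_into[OF h(1)])
  have "g ` h ` e = e" if "e \<in> edges J" for e
  proof -
    have "e \<subseteq> verts J" using sJ that unfolding simple_graph_def by blast
    then show ?thesis using gh by (force simp: image_iff)
  qed
  then have gE: "(\<lambda>e. g ` e) ` edges F = edges J"
    unfolding h(2)[symmetric] by (force simp: image_image)
  let ?V = "verts F"
  let ?S = "{x \<in> embeddings G F. x ` verts F = verts J \<and> (\<lambda>e. x ` e) ` edges F = edges J}"
  have eF: "e \<subseteq> ?V" if "e \<in> edges F" for e using that sF unfolding simple_graph_def by blast
  have "bij_betw (\<lambda>x. restrict (h \<circ> x) ?V) ?S (embeddings F F)"
  proof (rule bij_betw_byWitness[where f' = "\<lambda>y. restrict (g \<circ> y) ?V"])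
    show "\<forall>x\<in>?S. restrict (g \<circ> restrict (h \<circ> x) ?V) ?V = x"
    proof
      fix x assume "x \<in> ?S"
      then have x: "x \<in> extensional ?V" "x ` ?V = verts J" by (auto simp: embeddings_def PiE_def)
      show "restrict (g \<circ> restrict (h \<circ> x) ?V) ?V = x"
        by (rule extensionalityI[OF _ x(1)]) (use x(2) gh in auto)
    qed
    show "\<forall>y\<in>embeddings F F. restrict (h \<circ> restrict (g \<circ> y) ?V) ?V = y"
    proof
      fix y assume "y \<in> embeddings F F"
      then have y: "y \<in> extensional ?V" "y ` ?V \<subseteq> ?V" by (auto simp: embeddings_def PiE_def)
      show "restrict (h \<circ> restrict (g \<circ> y) ?V) ?V = y"
        by (rule extensionalityI[OF _ y(1)]) (use y(2) hg in auto)
    qed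
    show "(\<lambda>x. restrict (h \<circ> x) ?V) ` ?S \<subseteq> embeddings F F"
    proof
      fix z assume "z \<in> (\<lambda>x. restrict (h \<circ> x) ?V) ` ?S"
      then obtain x where x: "x \<in> ?S" "z = restrict (h \<circ> x) ?V" by blast
      have xV: "x ` ?V = verts J" "inj_on x ?V" "(\<lambda>e. x ` e) ` edges F = edges J"
        using x(1) by (auto simp: embeddings_def)
      have 1: "z \<in> ?V \<rightarrow>\<^sub>E ?V" using bij_betw_imp_surj_on[OF h(1)] by (auto simp: x(2) simp flip: xV(1))
      have "inj_on (h \<circ> x) ?V" using xV h(1) by (auto simp: bij_betw_def intro: comp_inj_on)
      then have 2: "inj_on z ?V" by (simp add: x(2) inj_on_def)
      have 3: "z ` e \<in> edges F" if "e \<in> edges F" for e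
      proof -
        have "z ` e = h ` x ` e" using eF[OF that] by (force simp: x(2) image_iff)
        then show ?thesis using h(2) xV(3) that by blast
      qed
      show "z \<in> embeddings F F" using 1 2 3 by (simp add: embeddings_def)
    qed
    show "(\<lambda>y. restrict (g \<circ> y) ?V) ` embeddings F F \<subseteq> ?S"
    proof
      fix z assume "z \<in> (\<lambda>y. restrict (g \<circ> y) ?V) ` embeddings F F"
      then obtain y where y: "y \<in> embeddings F F" "z = restrict (g \<circ> y) ?V" by blast
      note yy = embeddings_self[OF sF y(1)]
      have "inj_on y ?V" using y(1) by (simp add: embeddings_def)
      then have "inj_on (g \<circ> y) ?V" using yy g by (auto simp: bij_betw_def intro: comp_inj_on)
      then have 2: "inj_on z ?V" by (simp add: y(2) inj_on_def)
      have "z ` ?V = g ` y ` ?V" by (simp add: y(2) image_comp)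
      also have "\<dots> = verts J" using g by (simp only: yy bij_betw_def)
      finally have 1: "z ` ?V = verts J" .
      have "z ` e = g ` y ` e" if "e \<in> edges F" for e
        using eF[OF that] by (force simp: y(2) image_iff)
      then have "(\<lambda>e. z ` e) ` edges F = (\<lambda>e. g ` e) ` (\<lambda>e. y ` e) ` edges F"
        by (auto simp: image_image)
      also have "\<dots> = edges J" by (simp only: yy gE)
      finally have 3: "(\<lambda>e. z ` e) ` edges F = edges J" .
      have 4: "z \<in> ?V \<rightarrow>\<^sub>E verts G" using 1 sJ(2) by (auto simp: y(2))
      have 5: "\<forall>e\<in>edges F. z ` e \<in> edges G" using 3 sJ(3) by blast
      show "z \<in> ?S" using 1 2 3 4 5 by (simp add: embeddings_def)
    qed
  qed
  then show ?thesis by (rule bij_betw_same_card)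
qed

text \<open>Embeddings are partitioned by their image, which is a copy of \<open>F\<close>.\<close>

lemma card_embeddings:
  assumes sG: "simple_graph G" and sF: "simple_graph F"
  shows "card (embeddings G F) = num_copies G F * card (embeddings F F)"
proof -
  define S where "S = (\<lambda>J. {x \<in> embeddings G F. x ` verts F = verts J \<and> (\<lambda>e. x ` e) ` edges F = edges J})"
  have fin: "finite (embeddings G F)"
    unfolding embeddings_def using sG sF by (auto simp: simple_graph_def intro!: finite_PiE)
  have "embeddings G F = (\<Union>J\<in>copies G F. S J)"
  proof
    show "embeddings G F \<subseteq> (\<Union>J\<in>copies G F. S J)"
    proof
      fix x assume x: "x \<in> embeddings G F"
      define J where "J = (x ` verts F, (\<lambda>e. x ` e) ` edges F)"
      have inj: "inj_on x (verts F)" using x by (simp add: embeddings_def)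
      have "simple_graph J"
        unfolding simple_graph_def
      proof
        show "finite (verts J)" using sF by (simp add: J_def simple_graph_def)
        show "edges J \<subseteq> {e. e \<subseteq> verts J \<and> card e = 2}"
        proof
          fix e assume "e \<in> edges J"
          then obtain e' where e': "e' \<in> edges F" "e = x ` e'" by (auto simp: J_def)
          then have "e' \<subseteq> verts F" "card e' = 2" using sF unfolding simple_graph_def by blast+
          moreover from this have "card e = 2" using inj e'(2) by (metis card_image inj_on_subset)
          ultimately show "e \<in> {e. e \<subseteq> verts J \<and> card e = 2}" by (auto simp: e'(2) J_def)
        qed
      qed
      moreover have "verts J \<subseteq> verts G" "edges J \<subseteq> edges G"
        using x by (auto simp: J_def embeddings_def)
      moreover have "graph_iso J F"
      proof -
        define h where "h = the_inv_into (verts F) x"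
        have b: "bij_betw x (verts F) (verts J)" using inj by (simp add: bij_betw_def J_def)
        have hx: "h (x v) = v" if "v \<in> verts F" for v
          using that inj by (simp add: h_def the_inv_into_f_f)
        have "h ` x ` e = e" if "e \<in> edges F" for e
        proof -
          have "e \<subseteq> verts F" using sF that unfolding simple_graph_def by blast
          then show ?thesis using hx by (force simp: image_iff)
        qed
        then have "(\<lambda>e. h ` e) ` edges J = edges F" by (force simp: J_def image_image)
        moreover have "bij_betw h (verts J) (verts F)"
          unfolding h_def by (rule bij_betw_the_inv_into[OF b])
        ultimately show ?thesis unfolding graph_iso_def by blast
      qed
      ultimately have "J \<in> copies G F" by (simp add: copies_def subgraph_def)
      moreover have "x \<in> S J" using x by (simp add: S_def J_def)
      ultimately show "x \<in> (\<Union>J\<in>copies G F. S J)" by blast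
    qed
  qed (auto simp: S_def)
  moreover have "card (\<Union>J\<in>copies G F. S J) = (\<Sum>J\<in>copies G F. card (S J))"
  proof (rule card_UN_disjoint)
    show "finite (copies G F)" by (rule finite_copies[OF sG])
    show "\<forall>J\<in>copies G F. finite (S J)" using fin by (auto simp: S_def)
    show "\<forall>J\<in>copies G F. \<forall>K\<in>copies G F. J \<noteq> K \<longrightarrow> S J \<inter> S K = {}"
      unfolding S_def by (auto simp: prod_eq_iff)
  qed
  moreover have "(\<Sum>J\<in>copies G F. card (S J)) = (\<Sum>J\<in>copies G F. card (embeddings F F))"
    unfolding S_def by (rule sum.cong[OF refl], erule card_embeddings_image[OF sF])
  ultimately show ?thesis by (simp add: num_copies_def)
qed

lemma card_embeddings_self_pos:
  assumes "simple_graph F" shows "0 < card (embeddings F F)"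
proof -
  have "restrict id (verts F) \<in> embeddings F F"
  proof -
    have "restrict id (verts F) ` e = e" if "e \<in> edges F" for e
    proof -
      have "e \<subseteq> verts F" using assms that unfolding simple_graph_def by blast
      then show ?thesis by (force simp: image_iff)
    qed
    then show ?thesis by (auto simp: embeddings_def inj_on_def)
  qed
  moreover have "finite (embeddings F F)"
    unfolding embeddings_def using assms by (auto simp: simple_graph_def intro!: finite_PiE)
  ultimately show ?thesis by (auto simp: card_gt_0_iff)
qed

text \<open>Every injection into a complete graph is an embedding, so the count is the falling
  factorial \<open>fact k * (n choose k)\<close>, which is at least
  \<open>(k / exp 1) ^ k * (n / k) ^ k\<close>.\<close>

lemma card_embeddings_complete_ge:
  assumes sF: "simple_graph F" and V: "verts F = {..<k}" and k: "k \<le> n"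
  shows "(real n / exp 1) ^ k \<le> card (embeddings (clique_graph n) F)"
proof -
  have "embeddings (clique_graph n) F = {x \<in> {..<k} \<rightarrow>\<^sub>E {..<n}. inj_on x {..<k}}"
  proof -
    have "x ` e \<in> edges (clique_graph n)"
      if "x \<in> {..<k} \<rightarrow>\<^sub>E {..<n}" "inj_on x {..<k}" "e \<in> edges F" for x :: "nat \<Rightarrow> nat" and e
    proof -
      have e: "e \<subseteq> {..<k}" "card e = 2" using that(3) sF V unfolding simple_graph_def by blast+
      then have "card (x ` e) = 2" using that(2) by (metis card_image inj_on_subset)
      moreover have "x ` e \<subseteq> {..<n}" using that(1) e(1) by auto
      ultimately show ?thesis by (simp add: clique_graph_def)
    qed
    then show ?thesis by (auto simp: embeddings_def V)
  qed
  moreover have "card {x \<in> {..<k} \<rightarrow>\<^sub>E {..<n}. inj_on x {..<k}} = (\<Prod>i\<in>{0..<k}. n - i)"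
    using card_inj_on_subset_funcset[of "{..<k}" "{..<n}" "{..<k}"] by simp
  moreover have "real (\<Prod>i\<in>{0..<k}. n - i) = (\<Prod>i=0..<k. real n - real i)"
    unfolding of_nat_prod by (rule prod.cong) (use k in \<open>auto simp: of_nat_diff\<close>)
  ultimately have "real (card (embeddings (clique_graph n) F)) = fact k * real (n choose k)"
    using gbinomial_mult_fact[of k "real n"] by (simp add: binomial_gbinomial)
  moreover have "(real n / exp 1) ^ k \<le> fact k * real (n choose k)"
  proof (cases "k = 0")
    case False
    have "(real n / exp 1) ^ k = (real k / exp 1) ^ k * (real n / real k) ^ k"
      using False by (simp add: power_divide)
    also have "\<dots> \<le> fact k * real (n choose k)"
      by (intro mult_mono fact_ge_exp_power binomial_ge_n_over_k_pow_k k) auto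
    finally show ?thesis .
  qed simp
  ultimately show ?thesis by simp
qed

lemma num_copies_complete_pos:
  assumes "simple_graph F" "verts F = {..<k}" "k \<le> n" "0 < n"
  shows "0 < num_copies (clique_graph n) F"
proof -
  have "0 < (real n / exp 1) ^ k" using assms by simp
  also have "\<dots> \<le> card (embeddings (clique_graph n) F)" by (rule card_embeddings_complete_ge[OF assms(1-3)])
  finally show ?thesis by (auto simp: card_embeddings[OF simple_graph_clique assms(1)] intro: Nat.gr0I)
qed

lemma num_copies_mono:
  assumes "subgraph H G" "simple_graph G"
  shows "num_copies H F \<le> num_copies G F"
  unfolding num_copies_def
proof (rule card_mono[OF finite_copies[OF assms(2)]])
  show "copies H F \<subseteq> copies G F"
    unfolding copies_def using subgraph_trans[OF _ assms(1)] by blast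
qed

section \<open>Degrees, cliques and degeneracy\<close>

lemma sum_card_incident:
  assumes "finite V" "finite E" "\<And>e. e \<in> E \<Longrightarrow> e \<subseteq> V \<and> card e = 2"
  shows "(\<Sum>v\<in>V. card {e \<in> E. v \<in> e}) = 2 * card E"
proof (rule sum_multicount[OF assms(1,2)])
  have "{v \<in> V. v \<in> e} = e" if "e \<in> E" for e using assms(3)[OF that] by blast
  then show "\<forall>e\<in>E. card {v \<in> V. v \<in> e} = 2" using assms(3) by simp
qed

lemma card_neighbours:
  assumes "\<And>e. e \<in> E \<Longrightarrow> card e = 2"
  shows "card {w. {u, w} \<in> E} = card {e \<in> E. u \<in> e}"
proof -
  have "bij_betw (\<lambda>w. {u, w}) {w. {u, w} \<in> E} {e \<in> E. u \<in> e}"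
  proof (rule bij_betwI')
    fix e assume e: "e \<in> {e \<in> E. u \<in> e}"
    then obtain a b where ab: "e = {a, b}" using assms[of e] by (auto simp: card_2_iff)
    show "\<exists>w\<in>{w. {u, w} \<in> E}. e = {u, w}"
    proof (cases "u = a")
      case True
      then show ?thesis using e ab by blast
    next
      case False
      then have "e = {u, a}" using e ab by blast
      then show ?thesis using e by blast
    qed
  qed (auto simp: doubleton_eq_iff)
  then show ?thesis by (rule bij_betw_same_card)
qed

text \<open>With the vertex set kept apart from the edge set, the degeneracy induction can delete a
  vertex and leave \<open>E\<close> as it is.\<close>

definition cliques :: "'a set \<Rightarrow> 'a set set \<Rightarrow> nat \<Rightarrow> 'a set set" where
  "cliques V E r = {S. S \<subseteq> V \<and> finite S \<and> card S = r \<and> (\<forall>e. e \<subseteq> S \<and> card e = 2 \<longrightarrow> e \<in> E)}"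

lemma copies_clique_graph:
  assumes "simple_graph H"
  shows "copies H (clique_graph r) = (\<lambda>S. (S, {e. e \<subseteq> S \<and> card e = 2})) ` cliques (verts H) (edges H) r"
proof (intro equalityI subsetI)
  fix J assume "J \<in> copies H (clique_graph r)"
  then have J: "simple_graph J" "verts J \<subseteq> verts H" "edges J \<subseteq> edges H" "graph_iso J (clique_graph r)"
    by (auto simp: copies_def subgraph_def)
  then obtain f where f: "bij_betw f (verts J) {..<r}"
    "(\<lambda>e. f ` e) ` edges J = {e. e \<subseteq> {..<r} \<and> card e = 2}"
    by (auto simp: graph_iso_def clique_graph_def)
  have "e \<in> edges J" if e: "e \<subseteq> verts J" "card e = 2" for e
  proof -
    have "card (f ` e) = 2" using e f(1) by (metis bij_betw_def card_image inj_on_subset)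
    moreover have "f ` e \<subseteq> {..<r}" using e(1) f(1) by (auto simp: bij_betw_def)
    ultimately have "f ` e \<in> (\<lambda>e. f ` e) ` edges J" unfolding f(2) by blast
    then obtain e' where "e' \<in> edges J" "f ` e = f ` e'" by blast
    moreover have "e' \<subseteq> verts J" using calculation J(1) unfolding simple_graph_def by blast
    ultimately show ?thesis
      using inj_on_image_eq_iff[OF bij_betw_imp_inj_on[OF f(1)]] e(1) by metis
  qed
  moreover have "card (verts J) = r" using bij_betw_same_card[OF f(1)] by simp
  moreover have "edges J \<subseteq> {e. e \<subseteq> verts J \<and> card e = 2}" "finite (verts J)"
    using J(1) by (auto simp: simple_graph_def)
  ultimately have "J = (verts J, {e. e \<subseteq> verts J \<and> card e = 2})"
    "verts J \<in> cliques (verts H) (edges H) r"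
    using J(2,3) by (auto simp: cliques_def prod_eq_iff)
  then show "J \<in> (\<lambda>S. (S, {e. e \<subseteq> S \<and> card e = 2})) ` cliques (verts H) (edges H) r" by (rule image_eqI)
next
  fix J assume "J \<in> (\<lambda>S. (S, {e. e \<subseteq> S \<and> card e = 2})) ` cliques (verts H) (edges H) r"
  then obtain S where J: "J = (S, {e. e \<subseteq> S \<and> card e = 2})" and S: "S \<in> cliques (verts H) (edges H) r" by blast
  then have fin: "finite S" "card S = r" "S \<subseteq> verts H" by (auto simp: cliques_def)
  have "simple_graph J" using fin by (simp add: J simple_graph_def)
  then have "subgraph J H" using S by (auto simp: J subgraph_def cliques_def)
  moreover obtain f where f: "bij_betw f S {..<r}"
    using ex_bij_betw_finite_nat[OF fin(1)] fin(2) by (auto simp: atLeast0LessThan)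
  have "(\<lambda>e. f ` e) ` {e. e \<subseteq> S \<and> card e = 2} = {e. e \<subseteq> {..<r} \<and> card e = 2}"
  proof (intro equalityI subsetI)
    fix x assume "x \<in> (\<lambda>e. f ` e) ` {e. e \<subseteq> S \<and> card e = 2}"
    then obtain e where e: "e \<subseteq> S" "card e = 2" "x = f ` e" by blast
    have "card x = 2" using e f by (metis bij_betw_def card_image inj_on_subset)
    moreover have "x \<subseteq> {..<r}" using e f by (auto simp: bij_betw_def)
    ultimately show "x \<in> {e. e \<subseteq> {..<r} \<and> card e = 2}" by blast
  next
    fix x assume "x \<in> {e. e \<subseteq> {..<r} \<and> card e = 2}"
    then have x: "x \<subseteq> f ` S" "card x = 2" using f by (auto simp: bij_betw_def)
    then obtain e where e: "e \<subseteq> S" "x = f ` e" by (auto simp: subset_image_iff)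
    have "card e = 2" using e x f by (metis bij_betw_def card_image inj_on_subset)
    then show "x \<in> (\<lambda>e. f ` e) ` {e. e \<subseteq> S \<and> card e = 2}" using e by blast
  qed
  then have "graph_iso J (clique_graph r)"
    using f unfolding graph_iso_def J clique_graph_def by auto
  ultimately show "J \<in> copies H (clique_graph r)" by (simp add: copies_def)
qed

lemma num_copies_clique_graph:
  assumes "simple_graph H"
  shows "num_copies H (clique_graph r) = card (cliques (verts H) (edges H) r)"
  unfolding num_copies_def copies_clique_graph[OF assms] by (rule card_image) (simp add: inj_on_def)

lemma num_copies_complete_clique: "num_copies (clique_graph n) (clique_graph r) = n choose r"
proof -
  have "cliques {..<n} {e. e \<subseteq> {..<n} \<and> card e = 2} r = {S. S \<subseteq> {..<n} \<and> card S = r}"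
    by (auto simp: cliques_def finite_subset)
  then show ?thesis
    using num_copies_clique_graph[OF simple_graph_clique, of n r]
    by (simp add: clique_graph_def n_subsets)
qed

lemma card_edges_clique_graph: "card (edges (clique_graph r)) = r choose 2"
  by (simp add: clique_graph_def n_subsets)

lemma twice_choose_two: "2 * (m choose 2) = m * (m - 1)"
proof -
  have "even (m * (m - 1))" by (cases m) auto
  then show ?thesis by (simp add: choose_two)
qed

text \<open>Some vertex \<open>u\<close> has at most the average degree inside \<open>V\<close>,
  hence at most \<open>2 * \<gamma>\<close>. A clique through \<open>u\<close> picks its other
  \<open>m\<close> vertices among these neighbours; the remaining cliques live on
  \<open>V - {u}\<close>, where the density bound persists.\<close>

lemma card_cliques_le_degenerate:
  fixes \<gamma> :: real
  assumes "finite V" and "\<And>e. e \<in> E \<Longrightarrow> card e = 2"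
    and "\<And>W. W \<subseteq> V \<Longrightarrow> card {e \<in> E. e \<subseteq> W} \<le> \<gamma> * card W"
  shows "card (cliques V E (Suc m)) \<le> card V * (2 * \<gamma>) ^ m"
  using assms(1,3)
proof (induction "card V" arbitrary: V)
  case 0
  then have "cliques V E (Suc m) = {}" by (auto simp: cliques_def)
  then show ?case using 0 by simp
next
  case (Suc t)
  define E' where "E' = {e \<in> E. e \<subseteq> V}"
  have V0: "V \<noteq> {}" using Suc.hyps(2) by auto
  have finE: "finite E'" by (rule finite_subset[of _ "Pow V"]) (auto simp: E'_def Suc.prems(1))
  have "\<exists>u\<in>V. card {e \<in> E'. u \<in> e} \<le> 2 * \<gamma>"
  proof (rule ccontr)
    assume "\<not> ?thesis"
    then have "2 * \<gamma> < card {e \<in> E'. u \<in> e}" if "u \<in> V" for u using that by force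
    then have "(\<Sum>u\<in>V. 2 * \<gamma>) < (\<Sum>u\<in>V. real (card {e \<in> E'. u \<in> e}))"
      using Suc.prems(1) V0 by (intro sum_strict_mono) auto
    also have "\<dots> = real (\<Sum>u\<in>V. card {e \<in> E'. u \<in> e})" by simp
    also have "(\<Sum>u\<in>V. card {e \<in> E'. u \<in> e}) = 2 * card E'"
      by (rule sum_card_incident[OF Suc.prems(1) finE]) (auto simp: E'_def assms(2))
    finally show False using Suc.prems(2)[of V] by (simp add: E'_def mult.commute)
  qed
  then obtain u where u: "u \<in> V" "card {e \<in> E'. u \<in> e} \<le> 2 * \<gamma>" by blast
  define N where "N = {w. {u, w} \<in> E'}"
  have finN: "finite N"
  proof -
    have "N \<subseteq> V" by (auto simp: N_def E'_def)
    then show ?thesis using Suc.prems(1) finite_subset by blast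
  qed
  have cN: "card N \<le> 2 * \<gamma>"
    unfolding N_def using u(2) by (subst card_neighbours) (auto simp: E'_def assms(2))
  have g0: "0 \<le> 2 * \<gamma>" using cN by linarith
  let ?C = "{S \<in> cliques V E (Suc m). u \<in> S}"
  have fin: "finite (cliques V E (Suc m))"
    by (rule finite_subset[of _ "Pow V"]) (auto simp: cliques_def Suc.prems(1))
  have "cliques V E (Suc m) \<subseteq> cliques (V - {u}) E (Suc m) \<union> ?C" by (auto simp: cliques_def)
  then have "card (cliques V E (Suc m)) \<le> card (cliques (V - {u}) E (Suc m) \<union> ?C)"
    using fin by (intro card_mono) (auto simp: cliques_def Suc.prems(1) intro!: finite_subset[of _ "Pow V"])
  also have "\<dots> \<le> card (cliques (V - {u}) E (Suc m)) + card ?C" by (rule card_Un_le)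
  finally have 1: "real (card (cliques V E (Suc m))) \<le> card (cliques (V - {u}) E (Suc m)) + card ?C" by linarith
  have "card ?C \<le> card {T. T \<subseteq> N \<and> card T = m}"
  proof (rule card_inj_on_le[where f = "\<lambda>S. S - {u}"])
    show "inj_on (\<lambda>S. S - {u}) ?C" by (rule inj_onI) blast
    show "finite {T. T \<subseteq> N \<and> card T = m}" using finN by simp
    show "(\<lambda>S. S - {u}) ` ?C \<subseteq> {T. T \<subseteq> N \<and> card T = m}"
    proof
      fix T assume "T \<in> (\<lambda>S. S - {u}) ` ?C"
      then obtain S where S: "S \<in> cliques V E (Suc m)" "u \<in> S" "T = S - {u}" by blast
      have "w \<in> N" if "w \<in> T" for w
      proof -
        have "{u, w} \<subseteq> S" "card {u, w} = 2" using that S by (auto simp: card_2_iff)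
        then show ?thesis using S(1) by (auto simp: cliques_def N_def E'_def)
      qed
      then show "T \<in> {T. T \<subseteq> N \<and> card T = m}" using S by (auto simp: cliques_def)
    qed
  qed
  also have "\<dots> = card N choose m" by (rule n_subsets[OF finN])
  also have "\<dots> \<le> card N ^ m"
    by (cases "m \<le> card N") (simp_all add: binomial_le_pow binomial_eq_0)
  finally have "real (card ?C) \<le> real (card N) ^ m" by (simp flip: of_nat_power)
  also have "\<dots> \<le> (2 * \<gamma>) ^ m" using cN by (intro power_mono) auto
  finally have 2: "real (card ?C) \<le> (2 * \<gamma>) ^ m" .
  have "card (cliques (V - {u}) E (Suc m)) \<le> card (V - {u}) * (2 * \<gamma>) ^ m"
  proof (rule Suc.hyps(1))
    show "t = card (V - {u})" using Suc.hyps(2) Suc.prems(1) u(1) by simp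
    show "card {e \<in> E. e \<subseteq> W} \<le> \<gamma> * card W" if "W \<subseteq> V - {u}" for W
      using Suc.prems(2)[of W] that by blast
  qed (use Suc.prems(1) in simp)
  also have "card (V - {u}) = t" using Suc u by simp
  finally have "real (card (cliques V E (Suc m))) \<le> t * (2 * \<gamma>) ^ m + (2 * \<gamma>) ^ m" using 1 2 by linarith
  also have "\<dots> = real (card V) * (2 * \<gamma>) ^ m" by (simp add: algebra_simps flip: Suc.hyps(2))
  finally show ?case .
qed

text \<open>
  Adding to a vertex set a clique through \<open>e\<close> that it does not contain increases
  \<open>2 e(S) - r |S|\<close>, which is never positive, by at least the number of new vertices. Hence all
  \<open>r\<close>-cliques through \<open>e\<close> live on a set of at most \<open>2 r\<close> vertices.
\<close>

lemma card_cliques_edge_le: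
  assumes V: "finite V" and E: "\<And>e. e \<in> E \<Longrightarrow> e \<subseteq> V \<and> card e = 2"
    and dens: "\<And>W. W \<subseteq> V \<Longrightarrow> 2 * card {e \<in> E. e \<subseteq> W} \<le> r * card W"
    and e: "e \<in> E"
  shows "card {S \<in> cliques V E r. e \<subseteq> S} \<le> 4 ^ r"
proof -
  define ed where "ed = (\<lambda>W. {e \<in> E. e \<subseteq> W})"
  \<comment> \<open>The potential \<open>2 e(S) - r |S|\<close> must be at least
    \<open>|S| - 2 r\<close>, with equality for \<open>S = e\<close>. As \<open>dens\<close> makes
    the potential nonpositive, such a set has at most \<open>2 r\<close> vertices.\<close>
  define P where "P = (\<lambda>S. e \<subseteq> S \<and> S \<subseteq> V \<and> card S + r * card S \<le> 2 * card (ed S) + 2 * r)"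
  have finE: "finite E" by (rule finite_subset[of _ "Pow V"]) (use E V in auto)
  have e2: "e \<subseteq> V" "card e = 2" using E[OF e] by auto
  have "e \<in> ed e" using e by (simp add: ed_def)
  then have "1 \<le> card (ed e)" using finE by (auto simp: ed_def Suc_le_eq card_gt_0_iff)
  then have Pe: "P e" using e2 by (auto simp: P_def)
  have finP: "finite (Collect P)" by (rule finite_subset[of _ "Pow V"]) (auto simp: P_def V)
  obtain S where S: "P S" "\<And>T. P T \<Longrightarrow> S \<subseteq> T \<Longrightarrow> T = S"
    using finite_has_maximal2[OF finP, of e] Pe by auto
  have "Q \<subseteq> S" if Q: "Q \<in> cliques V E r" "e \<subseteq> Q" for Q
  proof (rule ccontr)
    assume nQ: "\<not> Q \<subseteq> S"
    have Qf: "finite Q" "card Q = r" "Q \<subseteq> V" using Q by (auto simp: cliques_def)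
    have SV: "S \<subseteq> V" "finite S" using S(1) V finite_subset by (auto simp: P_def)
    define j i where "j = card (Q - S)" and "i = card (Q \<inter> S)"
    have ij: "i + j = r" using card_Int_Diff[OF Qf(1), of S] Qf(2) by (simp add: i_def j_def)
    have j1: "1 \<le> j" using nQ Qf by (simp add: j_def Suc_le_eq card_gt_0_iff)
    have "card e \<le> i" unfolding i_def using Q(2) S(1) Qf by (intro card_mono) (auto simp: P_def)
    then have i2: "2 \<le> i" using e2 by simp
    let ?A = "{x. x \<subseteq> Q \<and> card x = 2}" and ?B = "{x. x \<subseteq> Q \<inter> S \<and> card x = 2}"
    have cA: "card ?A = r choose 2" "card ?B = i choose 2" using Qf by (simp_all only: n_subsets finite_Int i_def simp_thms)
    have AE: "?A \<subseteq> E" using Q by (auto simp: cliques_def)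
    have "ed S \<union> (?A - ?B) \<subseteq> ed (S \<union> Q)" using AE by (auto simp: ed_def)
    then have "card (ed S \<union> (?A - ?B)) \<le> card (ed (S \<union> Q))"
      using finE by (intro card_mono) (auto simp: ed_def)
    moreover have "card (ed S \<union> (?A - ?B)) = card (ed S) + card (?A - ?B)"
      using finE Qf by (intro card_Un_disjoint) (auto simp: ed_def)
    moreover have "card (?A - ?B) = card ?A - card ?B" using Qf by (intro card_Diff_subset) auto
    ultimately have ed1: "card (ed S) + ((r choose 2) - (i choose 2)) \<le> card (ed (S \<union> Q))" using cA by simp
    have "card (S \<union> Q) = card S + j"
      using card_Un_disjoint[of S "Q - S"] SV Qf by (simp add: j_def)
    \<comment> \<open>With \<open>r = i + j\<close> the right side equals
      \<open>j * (r + i - 1)\<close>, and \<open>i\<close> is at least 2 because \<open>e\<close>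
      lies in both \<open>Q\<close> and \<open>S\<close>.\<close>
    moreover have "j + r * j \<le> 2 * (r choose 2) - 2 * (i choose 2)"
    proof -
      obtain i' where i': "i = i' + 2" using i2 by (metis add.commute le_Suc_ex)
      have "j + r * j + i * (i - 1) \<le> r * (r - 1)"
        using j1 by (auto simp: i' algebra_simps simp flip: ij)
      then show ?thesis by (simp add: twice_choose_two)
    qed
    ultimately have "P (S \<union> Q)"
      using S(1) Q(2) Qf(3) ed1 by (auto simp: P_def algebra_simps)
    then show False using S(2)[of "S \<union> Q"] nQ by blast
  qed
  then have "{S \<in> cliques V E r. e \<subseteq> S} \<subseteq> Pow S" by blast
  moreover have finS: "finite S" using S(1) V finite_subset by (auto simp: P_def)
  ultimately have "card {S \<in> cliques V E r. e \<subseteq> S} \<le> 2 ^ card S"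
    by (metis card_Pow card_mono finite_Pow_iff)
  also have "card S \<le> 2 * r" using S(1) dens[of S] by (simp add: P_def ed_def)
  then have "(2::nat) ^ card S \<le> 2 ^ (2 * r)" by simp
  finally show ?thesis by (simp add: power_mult)
qed

section \<open>Comparison with the random graph, and the two regimes for cliques\<close>

text \<open>\<open>K_n\<close> has at least as many copies as \<open>H\<close>, and its count is
  multiplied by \<open>p ^ card (edges F) > 1\<close>. This settles \<open>L * q > 1\<close>, so
  that \<open>q\<close> is small in the dense regime.\<close>

lemma num_copies_less_trivial:
  assumes "subgraph H (clique_graph n)" "simple_graph F" "verts F = {..<k}" "k \<le> n" "0 < n"
    and "edges F \<noteq> {}" "1 < p"
  shows "real (num_copies H F) < expected_copies n p F"
proof -
  define M where "M = num_copies (clique_graph n) F"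
  have "real (num_copies H F) \<le> M"
    unfolding M_def using num_copies_mono[OF assms(1) simple_graph_clique] by simp
  also have "real M < M * p ^ card (edges F)"
  proof -
    have "0 < M" unfolding M_def by (rule num_copies_complete_pos[OF assms(2-5)])
    moreover have "1 < p ^ card (edges F)"
      using assms(6,7) finite_edges[OF assms(2)] by (intro one_less_power) (auto simp: card_gt_0_iff)
    ultimately show ?thesis by simp
  qed
  finally show ?thesis by (simp add: expected_copies_def M_def)
qed

text \<open>The losses \<open>exp 1\<close>, \<open>f\<close> and \<open>X\<close> are at most
  \<open>3 ^ f\<close>, \<open>2 ^ f\<close> and \<open>16 ^ f\<close>; their product
  \<open>96 ^ f\<close> explains the bound 100 on \<open>L\<close>.\<close>

lemma num_copies_less_edge_degree:
  assumes sp: "q_sparse n q H" and H: "subgraph H (clique_graph n)" and q: "0 < q"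
    and F: "simple_graph F" "verts F = {..<k}" "k \<le> n" "0 < n" "edges F \<noteq> {}"
    and X: "\<And>e. e \<in> edges H \<Longrightarrow> card {J \<in> copies H F. e \<in> edges J} \<le> X"
    and X2: "X \<le> 16 ^ card (edges F)" and L: "100 \<le> L"
  shows "real (num_copies H F) < expected_copies n (L * q) F"
proof -
  define f where "f = card (edges F)"
  have f: "0 < f" unfolding f_def using F(5) finite_edges[OF F(1)] by (simp add: card_gt_0_iff)
  define M where "M = num_copies (clique_graph n) F"
  have M: "0 < M" unfolding M_def by (rule num_copies_complete_pos[OF F(1-4)])
  have "f < 2 ^ f" by simp
  then have f2: "f \<le> 2 ^ f" by simp
  have "real (num_copies H F) \<le> exp 1 * expected_copies n q F * (f * X)"
    unfolding f_def by (rule num_copies_le_edge_degree[OF sp H q F(5) X])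
  also have "\<dots> \<le> 3 ^ f * expected_copies n q F * (2 ^ f * 16 ^ f)"
  proof (intro mult_mono)
    have "exp (1::real) \<le> 3" by (rule exp_le)
    also have "3 \<le> (3::real) ^ f" using f by (cases f) auto
    finally show "exp 1 \<le> (3::real) ^ f" .
    have "real (f * X) \<le> real (2 ^ f * 16 ^ f)"
      using mult_le_mono[OF f2 X2] unfolding f_def by (rule of_nat_mono)
    then show "real (f * X) \<le> 2 ^ f * 16 ^ f" by simp
  qed (use q in \<open>auto simp: expected_copies_def\<close>)
  also have "\<dots> = 96 ^ f * (M * q ^ f)"
  proof -
    have "(96::real) ^ f = 3 ^ f * (2 ^ f * 16 ^ f)" by (simp flip: power_mult_distrib)
    then show ?thesis unfolding expected_copies_def M_def f_def by (simp only: mult_ac)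
  qed
  also have "\<dots> < L ^ f * (M * q ^ f)"
  proof (rule mult_strict_right_mono)
    show "96 ^ f < L ^ f" using L f by (intro power_strict_mono) auto
  qed (use M q in auto)
  also have "\<dots> = expected_copies n (L * q) F"
    by (simp add: expected_copies_def M_def f_def power_mult_distrib)
  finally show ?thesis .
qed

lemma q_sparse_induced:
  assumes "q_sparse n q H" "subgraph H (clique_graph n)" "0 < q" "W \<subseteq> verts H" "E \<subseteq> edges H" "\<And>e. e \<in> E \<Longrightarrow> e \<subseteq> W"
  shows "1 \<le> real n ^ card W * q ^ card E"
proof -
  have sH: "simple_graph H" using assms(2) by (simp add: subgraph_def)
  then have "subgraph (W, E) H"
    using assms(4-6) unfolding subgraph_def simple_graph_def fst_conv snd_conv
    by (blast intro: finite_subset)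
  from q_sparse_density[OF assms(1) this assms(3)] show ?thesis by simp
qed

text \<open>The first hypothesis raised to the power \<open>f\<close> and the last one raised to the
  power \<open>e\<close> contain the same power of \<open>q\<close>; eliminating it leaves a
  comparison of powers of \<open>n\<close>.\<close>

lemma edge_vertex_ratio_le:
  assumes "1 \<le> real n ^ v * q ^ e" and q: "0 < q" and n: "2 \<le> n"
    and \<eta>: "real n ^ m * q ^ f \<le> 1"
  shows "m * e \<le> f * v"
proof -
  have "1 \<le> (real n ^ v * q ^ e) ^ f" using assms(1) by (rule one_le_power)
  also have "\<dots> = real n ^ (f * v) * (q ^ f) ^ e"
    by (simp add: power_mult_distrib mult.commute flip: power_mult)
  finally have 1: "1 \<le> real n ^ (f * v) * (q ^ f) ^ e" .
  have "real n ^ (m * e) \<le> real n ^ (m * e) * (real n ^ (f * v) * (q ^ f) ^ e)"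
    using 1 by (simp add: mult_le_cancel_left1)
  also have "\<dots> = (real n ^ m * q ^ f) ^ e * real n ^ (f * v)"
    by (simp add: power_mult_distrib mult_ac flip: power_mult)
  also have "\<dots> \<le> 1 * real n ^ (f * v)"
    using \<eta> q by (intro mult_right_mono power_le_one) auto
  finally have "real n ^ (m * e) \<le> real n ^ (f * v)" by simp
  then show ?thesis using n by simp
qed

text \<open>For \<open>m = r - 1\<close> and \<open>f = r choose 2\<close> the inequality of
  \<open>edge_vertex_ratio_le\<close> becomes \<open>2 e(W) <= r |W|\<close>, the hypothesis of
  \<open>card_cliques_edge_le\<close>. The resulting \<open>4 ^ r\<close> fits below
  \<open>16 ^ (r choose 2)\<close> because \<open>r <= 2 * (r choose 2)\<close>.\<close>

lemma clique_copies_less_sparse: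
  assumes sp: "q_sparse n q H" and H: "subgraph H (clique_graph n)" and q: "0 < q"
    and r: "2 \<le> r" "r \<le> n" and \<eta>: "real n ^ (r - 1) * q ^ (r choose 2) \<le> 1" and L: "100 \<le> L"
  shows "real (num_copies H (clique_graph r)) < expected_copies n (L * q) (clique_graph r)"
proof -
  have sH: "simple_graph H" using H by (simp add: subgraph_def)
  have finV: "finite (verts H)" using sH by (simp add: simple_graph_def)
  have c2: "0 < r choose 2" using r by simp
  have dens: "2 * card {e \<in> edges H. e \<subseteq> W} \<le> r * card W" if "W \<subseteq> verts H" for W
  proof -
    have "(r - 1) * card {e \<in> edges H. e \<subseteq> W} \<le> (r choose 2) * card W"
      by (rule edge_vertex_ratio_le[OF q_sparse_induced[OF sp H q that] q _ \<eta>]) (use r in auto)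
    then have "(r - 1) * (2 * card {e \<in> edges H. e \<subseteq> W}) \<le> (2 * (r choose 2)) * card W" by simp
    also have "\<dots> = (r - 1) * (r * card W)" by (simp add: twice_choose_two)
    finally show ?thesis using r by simp
  qed
  have X: "card {J \<in> copies H (clique_graph r). e \<in> edges J} \<le> 4 ^ r" if e: "e \<in> edges H" for e
  proof -
    let ?g = "\<lambda>S. (S, {e. e \<subseteq> S \<and> card e = 2})"
    have "{J \<in> copies H (clique_graph r). e \<in> edges J} \<subseteq> ?g ` {S \<in> cliques (verts H) (edges H) r. e \<subseteq> S}"
      unfolding copies_clique_graph[OF sH] by auto
    moreover have "finite {S \<in> cliques (verts H) (edges H) r. e \<subseteq> S}"
      by (rule finite_subset[of _ "Pow (verts H)"]) (auto simp: cliques_def finV)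
    ultimately have "card {J \<in> copies H (clique_graph r). e \<in> edges J} \<le> card {S \<in> cliques (verts H) (edges H) r. e \<subseteq> S}"
      by (meson card_image_le card_mono finite_imageI le_trans)
    also have "\<dots> \<le> 4 ^ r"
      by (rule card_cliques_edge_le[OF finV _ dens e]) (use sH in \<open>auto simp: simple_graph_def\<close>)
    finally show ?thesis .
  qed
  show ?thesis
  proof (rule num_copies_less_edge_degree[OF sp H q simple_graph_clique verts_clique r(2) _ _ X _ L])
    show "0 < n" using r by simp
    show "edges (clique_graph r) \<noteq> {}" using card_edges_clique_graph[of r] c2 by force
    have "r * 1 \<le> r * (r - 1)" using r by (intro mult_le_mono) auto
    then have "r \<le> 2 * (r choose 2)" by (simp add: twice_choose_two)
    then have "(4::nat) ^ r \<le> 4 ^ (2 * (r choose 2))" by (rule power_increasing) simp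
    then show "4 ^ r \<le> (16::nat) ^ card (edges (clique_graph r))"
      by (simp add: card_edges_clique_graph power_mult)
  qed
qed

text \<open>Cube of \<open>2 * x < exp (2 * x)\<close>. It is applied with
  \<open>x = \<gamma>\<close> below and is the origin of \<open>exp 6\<close> for cliques.\<close>

lemma cube_less_exp: "8 * x ^ 3 < exp (6 * x)" if "1 \<le> x" for x :: real
proof -
  have "2 * x < exp (2 * x)" using exp_ge_add_one_self[of "2 * x"] by linarith
  then have "(2 * x) ^ 3 < exp (2 * x) ^ 3" using that by (intro power_strict_mono) auto
  also have "exp (2 * x) ^ 3 = exp (6 * x)" by (simp flip: exp_of_nat_mult)
  finally show ?thesis by (simp add: power_mult_distrib)
qed

text \<open>\<open>\<gamma>\<close> is the largest density that \<open>n^v q^e >= 1\<close> allows,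
  so degeneracy leaves at most \<open>n * (2 * \<gamma>) ^ (r - 1)\<close> cliques, to be compared
  with \<open>(n / r) ^ r * (L * q) ^ (r choose 2)\<close>. The dense regime enters as
  \<open>r / 2 < \<gamma>\<close>.\<close>

lemma clique_copies_less_dense:
  assumes sp: "q_sparse n q H" and H: "subgraph H (clique_graph n)" and q: "0 < q"
    and r: "2 \<le> r" "r \<le> n" and \<eta>: "1 < real n ^ (r - 1) * q ^ (r choose 2)"
    and L: "exp 6 \<le> L" and Lq: "L * q \<le> 1"
  shows "real (num_copies H (clique_graph r)) < expected_copies n (L * q) (clique_graph r)"
proof -
  have sH: "simple_graph H" using H by (simp add: subgraph_def)
  have VH: "verts H \<subseteq> {..<n}" using H by (simp add: subgraph_def)
  have finV: "finite (verts H)" using sH by (simp add: simple_graph_def)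
  have "1 < exp (6::real)" by simp
  then have L1: "1 < L" using L by linarith
  have L0: "0 < L" using L1 by simp
  have q1: "q < 1"
  proof -
    have "1 * q < L * q" using L1 q by (intro mult_strict_right_mono) auto
    then show ?thesis using Lq by simp
  qed
  have lnL: "6 \<le> ln L" using L L0 by (simp add: ln_ge_iff)
  have lnq: "ln L \<le> - ln q" "ln q < 0"
  proof -
    have "ln (L * q) \<le> 0" using Lq L0 q by (subst ln_le_zero_iff) auto
    then show "ln L \<le> - ln q" using L0 q by (simp add: ln_mult)
    show "ln q < 0" using q q1 by simp
  qed
  have n0: "0 < real n" using r by simp
  define \<gamma> where "\<gamma> = ln n / (- ln q)"
  have \<gamma>: "ln n = \<gamma> * (- ln q)" using lnq by (simp add: \<gamma>_def)
  have dens: "card {e \<in> edges H. e \<subseteq> W} \<le> \<gamma> * card W" if "W \<subseteq> verts H" for W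
  proof -
    have "1 \<le> real n ^ card W * q ^ card {e \<in> edges H. e \<subseteq> W}"
      by (rule q_sparse_induced[OF sp H q that]) auto
    then have "0 \<le> ln (real n ^ card W * q ^ card {e \<in> edges H. e \<subseteq> W})" by simp
    then have "0 \<le> card W * ln n + card {e \<in> edges H. e \<subseteq> W} * ln q"
      using n0 q by (simp add: ln_mult ln_realpow)
    then show ?thesis using lnq by (simp add: \<gamma>_def field_simps)
  qed
  define R where "R = real (r - 1)"
  have R0: "0 < R" using r by (simp add: R_def)
  have rc: "real (r choose 2) = R * (r / 2)"
  proof -
    have "real (2 * (r choose 2)) = real (r * (r - 1))" by (simp only: twice_choose_two)
    then show ?thesis unfolding R_def of_nat_mult by (simp add: mult.commute)
  qed
  have "0 < ln (real n ^ (r - 1) * q ^ (r choose 2))" using \<eta> by simp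
  moreover have "ln (real n ^ (r - 1) * q ^ (r choose 2)) = R * ln n + real (r choose 2) * ln q"
    using n0 q by (simp add: ln_mult ln_realpow R_def)
  ultimately have "0 < R * (ln n + (r / 2) * ln q)" unfolding rc by (simp add: algebra_simps)
  then have "0 < ln n + (r / 2) * ln q" using R0 by (rule zero_less_mult_pos)
  then have "(r / 2) * (- ln q) < \<gamma> * (- ln q)" by (simp add: \<gamma>)
  then have \<gamma>r: "r / 2 < \<gamma>" using lnq by (simp add: mult_less_cancel_right)
  have \<gamma>1: "1 \<le> \<gamma>" using \<gamma>r r by simp
  \<comment> \<open>\<open>A ^ (r - 1)\<close> is
    \<open>n ^ (r - 1) * (L * q) ^ (r choose 2)\<close>, so \<open>A\<close> is the share of one of
    the \<open>r - 1\<close> steps. The extra \<open>r ^ 2\<close> in the next claim pays for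
    \<open>r ^ r\<close>, which is at most \<open>r ^ (2 * (r - 1))\<close>.\<close>
  define A where "A = n * exp ((r / 2) * ln (L * q))"
  have A: "(real r)\<^sup>2 * (2 * \<gamma>) < A"
  proof -
    have "(real r)\<^sup>2 \<le> (2 * \<gamma>)\<^sup>2" using \<gamma>r by (intro power_mono) auto
    then have "(real r)\<^sup>2 * (2 * \<gamma>) \<le> (2 * \<gamma>)\<^sup>2 * (2 * \<gamma>)"
      using \<gamma>1 by (intro mult_right_mono) auto
    also have "\<dots> = 8 * \<gamma> ^ 3" by (simp add: power2_eq_square power3_eq_cube)
    also have "\<dots> < exp (6 * \<gamma>)" by (rule cube_less_exp[OF \<gamma>1])
    also have "\<dots> \<le> exp (\<gamma> * ln L)" using lnL \<gamma>1 by simp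
    also have "\<dots> \<le> exp (ln n + (r / 2) * ln (L * q))"
    proof -
      \<comment> \<open>\<open>ln A\<close> equals
        \<open>(\<gamma> - r / 2) * (- ln q) + (r / 2) * ln L\<close>, and \<open>- ln q\<close> is
        at least \<open>ln L\<close>.\<close>
      have "(\<gamma> - r / 2) * ln L \<le> (\<gamma> - r / 2) * (- ln q)"
        using \<gamma>r lnq by (intro mult_left_mono) auto
      then show ?thesis using L0 q by (simp add: ln_mult \<gamma> algebra_simps)
    qed
    also have "\<dots> = A" using n0 by (simp add: exp_add A_def)
    finally show ?thesis .
  qed
  define m where "m = r - 1"
  have rm: "r = Suc m" "1 \<le> m" using r by (auto simp: m_def)
  have Am: "A ^ m = real n ^ m * (L * q) ^ (r choose 2)"
  proof -
    have "exp ((r / 2) * ln (L * q)) ^ m = exp (real m * ((r / 2) * ln (L * q)))"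
      by (rule exp_of_nat_mult[symmetric])
    also have "real m * ((r / 2) * ln (L * q)) = real (r choose 2) * ln (L * q)"
      unfolding rc m_def R_def by (simp only: mult.assoc)
    also have "exp \<dots> = exp (ln (L * q)) ^ (r choose 2)" by (rule exp_of_nat_mult)
    also have "\<dots> = (L * q) ^ (r choose 2)" using L0 q by simp
    finally show ?thesis unfolding A_def power_mult_distrib by simp
  qed
  have "real (num_copies H (clique_graph r)) = card (cliques (verts H) (edges H) (Suc m))"
    by (simp add: num_copies_clique_graph[OF sH] rm)
  also have "\<dots> \<le> card (verts H) * (2 * \<gamma>) ^ m"
    by (rule card_cliques_le_degenerate[OF finV _ dens]) (use sH in \<open>auto simp: simple_graph_def\<close>)
  also have "\<dots> \<le> n * (2 * \<gamma>) ^ m"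
    using card_mono[OF _ VH] \<gamma>1 by (intro mult_right_mono) auto
  also have "\<dots> < n * (A / r\<^sup>2) ^ m"
  proof -
    have "2 * \<gamma> < A / r\<^sup>2" using A r by (simp add: field_simps)
    then have "(2 * \<gamma>) ^ m < (A / r\<^sup>2) ^ m" using \<gamma>1 rm by (intro power_strict_mono) auto
    then show ?thesis using n0 by simp
  qed
  also have "\<dots> = n * A ^ m / real r ^ (2 * m)" by (simp add: power_divide flip: power_mult)
  also have "\<dots> \<le> n * A ^ m / real r ^ r"
  proof -
    have "real r ^ r \<le> real r ^ (2 * m)" using rm by (intro power_increasing) auto
    moreover have "0 \<le> n * A ^ m" by (simp add: A_def)
    ultimately show ?thesis using r by (intro divide_left_mono) auto
  qed
  also have "\<dots> = (real n / r) ^ r * (L * q) ^ (r choose 2)"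
    by (simp add: Am power_divide rm)
  also have "\<dots> \<le> real (n choose r) * (L * q) ^ (r choose 2)"
    using binomial_ge_n_over_k_pow_k[OF r(2), where 'a = real] L0 q by (intro mult_right_mono) auto
  also have "\<dots> = expected_copies n (L * q) (clique_graph r)"
    by (simp add: expected_copies_def num_copies_complete_clique card_edges_clique_graph)
  finally show ?thesis .
qed

lemma clique_copies_less:
  assumes sp: "q_sparse n q H" and H: "subgraph H (clique_graph n)" and q: "0 < q"
    and r: "2 \<le> r" "r \<le> n" and L: "exp 6 \<le> L"
  shows "real (num_copies H (clique_graph r)) < expected_copies n (L * q) (clique_graph r)"
proof -
  have L100: "100 \<le> L"
  proof -
    \<comment> \<open>Three Taylor terms give \<open>exp (1/2) >= 13/8\<close>, whose twelfth power
      already exceeds 100.\<close>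
    have "1 + (1/2) + (1/2)\<^sup>2 / 2 \<le> exp (1/2::real)" by (rule exp_lower_Taylor_quadratic) simp
    then have "13/8 \<le> exp (1/2::real)" by (simp add: power2_eq_square)
    then have "(13/8) ^ 12 \<le> exp (1/2::real) ^ 12" by (intro power_mono) auto
    also have "\<dots> = exp 6" by (simp flip: exp_of_nat_mult)
    finally show ?thesis using L by (simp add: power_numeral_reduce)
  qed
  have c2: "0 < r choose 2" using r by simp
  consider "1 < L * q" | "L * q \<le> 1" "real n ^ (r - 1) * q ^ (r choose 2) \<le> 1"
    | "L * q \<le> 1" "1 < real n ^ (r - 1) * q ^ (r choose 2)" by linarith
  then show ?thesis
  proof cases
    case 1
    show ?thesis
      by (rule num_copies_less_trivial[OF H simple_graph_clique verts_clique r(2) _ _ 1])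
         (use r c2 card_edges_clique_graph[of r] in force)+
  next
    case 2
    then show ?thesis by (intro clique_copies_less_sparse[OF sp H q r _ L100])
  next
    case 3
    then show ?thesis by (intro clique_copies_less_dense[OF sp H q r _ L])
  qed
qed

section \<open>Fractional orientations and weighted walks\<close>

text \<open>The Halmos-Vaughan induction. If a nonempty proper subset \<open>X\<close> is tight,
  match \<open>X\<close> first and the rest outside the neighbourhood of \<open>X\<close>. If none
  is tight, every such subset has a spare neighbour, so an arbitrary pair \<open>a\<close>,
  \<open>b\<close> can be matched and removed.\<close>

lemma hall:
  assumes "finite A" "\<And>a. a \<in> A \<Longrightarrow> finite (N a)"
    and "\<And>X. X \<subseteq> A \<Longrightarrow> card X \<le> card (\<Union>(N ` X))"
  shows "\<exists>f. inj_on f A \<and> (\<forall>a\<in>A. f a \<in> N a)"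
  using assms
proof (induction "card A" arbitrary: A N rule: less_induct)
  case less
  note fin = less.prems(1) and finN = less.prems(2) and hallc = less.prems(3)
  have finU: "finite (\<Union>(N ` X))" if "X \<subseteq> A" for X
    using that fin finN finite_subset[OF that fin] by auto
  show ?case
  proof (cases "\<exists>X. X \<subset> A \<and> X \<noteq> {} \<and> card (\<Union>(N ` X)) \<le> card X")
    case True
    then obtain X where X: "X \<subset> A" "X \<noteq> {}" "card (\<Union>(N ` X)) \<le> card X" by blast
    define U where "U = \<Union>(N ` X)"
    have XA: "X \<subseteq> A" using X(1) by blast
    have finX: "finite X" by (rule finite_subset[OF XA fin])
    have "\<exists>f. inj_on f X \<and> (\<forall>a\<in>X. f a \<in> N a)"
    proof (rule less.hyps)
      show "card X < card A" by (rule psubset_card_mono[OF fin X(1)])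
    qed (use finX finN XA hallc in \<open>auto intro: order_trans\<close>)
    then obtain f where f: "inj_on f X" "\<And>a. a \<in> X \<Longrightarrow> f a \<in> N a" by blast
    have "\<exists>g. inj_on g (A - X) \<and> (\<forall>a\<in>A - X. g a \<in> N a - U)"
    proof (rule less.hyps)
      show "card (A - X) < card A" using X fin by (intro psubset_card_mono) auto
      show "card Y \<le> card (\<Union>((\<lambda>a. N a - U) ` Y))" if Y: "Y \<subseteq> A - X" for Y
      proof -
        have finY: "finite Y" using Y fin finite_subset by blast
        have YA: "Y \<subseteq> A" using Y by blast
        \<comment> \<open>Hall's condition for \<open>Y\<close> outside \<open>U\<close> is the one
          for \<open>Y \<union> X\<close> minus the tight one for \<open>X\<close>.\<close>
        have "card Y + card X = card (Y \<union> X)" using Y finX finY by (subst card_Un_disjoint) auto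
        also have "\<dots> \<le> card (\<Union>(N ` (Y \<union> X)))" using Y XA by (intro hallc) auto
        also have "\<Union>(N ` (Y \<union> X)) = \<Union>((\<lambda>a. N a - U) ` Y) \<union> U" by (auto simp: U_def)
        also have "card \<dots> \<le> card (\<Union>((\<lambda>a. N a - U) ` Y)) + card U" by (rule card_Un_le)
        finally show ?thesis using X(3) by (simp add: U_def)
      qed
    qed (use fin finN in auto)
    then obtain g where g: "inj_on g (A - X)" "\<And>a. a \<in> A - X \<Longrightarrow> g a \<in> N a - U" by blast
    define h where "h = (\<lambda>a. if a \<in> X then f a else g a)"
    have "inj_on h A"
    proof (rule inj_onI)
      fix x y assume xy: "x \<in> A" "y \<in> A" "h x = h y"
      have "f a \<in> U" if "a \<in> X" for a using f(2)[OF that] that by (auto simp: U_def)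
      then have "x \<in> X \<longleftrightarrow> y \<in> X" using xy g(2) unfolding h_def by (metis DiffD2 DiffI)
      then show "x = y" using xy f(1) g(1) unfolding h_def inj_on_def by (metis DiffI)
    qed
    moreover have "\<forall>a\<in>A. h a \<in> N a" using f(2) g(2) by (auto simp: h_def)
    ultimately show ?thesis by blast
  next
    case False
    then have strict: "card X < card (\<Union>(N ` X))" if "X \<subset> A" "X \<noteq> {}" for X
      using that by (meson not_le)
    show ?thesis
    proof (cases "A = {}")
      case False
      then obtain a where a: "a \<in> A" by blast
      have "card {a} \<le> card (\<Union>(N ` {a}))" by (rule hallc) (use a in blast)
      then obtain b where b: "b \<in> N a" by (cases "N a = {}") auto
      have "\<exists>g. inj_on g (A - {a}) \<and> (\<forall>x\<in>A - {a}. g x \<in> N x - {b})"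
      proof (rule less.hyps)
        show "card (A - {a}) < card A" by (rule card_Diff1_less[OF fin a])
        show "card Y \<le> card (\<Union>((\<lambda>x. N x - {b}) ` Y))" if Y: "Y \<subseteq> A - {a}" for Y
        proof (cases "Y = {}")
          case False
          have "Y \<subset> A" using Y a by blast
          then have "card Y < card (\<Union>(N ` Y))" by (rule strict[OF _ False])
          also have "\<Union>(N ` Y) \<subseteq> insert b (\<Union>((\<lambda>x. N x - {b}) ` Y))" by auto
          then have "card (\<Union>(N ` Y)) \<le> card (insert b (\<Union>((\<lambda>x. N x - {b}) ` Y)))"
            using finU[of Y] Y by (intro card_mono) (auto intro: finite_subset[of _ "\<Union>(N ` Y)"])
          also have "\<dots> \<le> Suc (card (\<Union>((\<lambda>x. N x - {b}) ` Y)))" by (rule card_insert_le_m1) auto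
          finally show ?thesis by simp
        qed simp
      qed (use fin finN in auto)
      then obtain g where g: "inj_on g (A - {a})" "\<And>x. x \<in> A - {a} \<Longrightarrow> g x \<in> N x - {b}" by blast
      have "inj_on (g(a := b)) A"
      proof (rule inj_onI)
        fix x y assume "x \<in> A" "y \<in> A" "(g(a := b)) x = (g(a := b)) y"
        then show "x = y" using g unfolding inj_on_def by (cases "x = a"; cases "y = a") auto
      qed
      moreover have "\<forall>x\<in>A. (g(a := b)) x \<in> N x" using g(2) b by auto
      ultimately show ?thesis by blast
    qed simp
  qed
qed

text \<open>
  Each edge carries \<open>b\<close> tokens, to be distributed among its two ends so that no vertex receives
  more than \<open>a\<close> of them; \<open>\<alpha> u w\<close> is the number of tokens of the edge \<open>{u, w}\<close> received by \<open>u\<close>.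
\<close>

lemma fractional_orientation:
  assumes V: "finite V" and E: "\<And>e. e \<in> E \<Longrightarrow> e \<subseteq> V \<and> card e = 2"
    and dens: "\<And>W. W \<subseteq> V \<Longrightarrow> b * card {e \<in> E. e \<subseteq> W} \<le> a * card W"
  obtains \<alpha> :: "'a \<Rightarrow> 'a \<Rightarrow> nat"
  where "\<And>u w. {u, w} \<in> E \<Longrightarrow> \<alpha> u w + \<alpha> w u = b" "\<And>u. u \<in> V \<Longrightarrow> (\<Sum>w | {u, w} \<in> E. \<alpha> u w) \<le> a"
proof -
  have finE: "finite E" by (rule finite_subset[of _ "Pow V"]) (use E V in auto)
  \<comment> \<open>Hall is applied to tokens \<open>(e, j)\<close> and slots \<open>(v, i)\<close>:
    every vertex offers \<open>a\<close> slots, and a token may take any slot at an end of its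
    edge.\<close>
  have "\<exists>f. inj_on f (E \<times> {..<b}) \<and> (\<forall>x\<in>E \<times> {..<b}. f x \<in> fst x \<times> {..<a})"
  proof (rule hall)
    fix X assume X: "X \<subseteq> E \<times> {..<b}"
    define S where "S = fst ` X"
    have S: "S \<subseteq> E" using X by (auto simp: S_def)
    have SV: "\<Union>S \<subseteq> V" using S E by blast
    have finS: "finite S" using S finE finite_subset by blast
    have "X \<subseteq> S \<times> {..<b}" using X by (force simp: S_def)
    then have "card X \<le> card (S \<times> {..<b})" using finS by (intro card_mono) auto
    also have "\<dots> = b * card S" by (simp add: card_cartesian_product)
    also have "\<dots> \<le> b * card {e \<in> E. e \<subseteq> \<Union>S}"
      using S finE by (intro mult_le_mono card_mono) auto
    also have "\<dots> \<le> a * card (\<Union>S)" by (rule dens[OF SV])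
    also have "\<dots> = card (\<Union>S \<times> {..<a})" by (simp add: card_cartesian_product)
    also have "\<Union>S \<times> {..<a} = (\<Union>x\<in>X. fst x \<times> {..<a})" by (auto simp: S_def)
    finally show "card X \<le> card (\<Union>x\<in>X. fst x \<times> {..<a})" .
  next
    fix x assume "x \<in> E \<times> {..<b}"
    then have "fst x \<subseteq> V" using E[of "fst x"] by auto
    then show "finite (fst x \<times> {..<a})" using V finite_subset by blast
  qed (use finE in auto)
  then obtain f where f: "inj_on f (E \<times> {..<b})" "\<And>e j. e \<in> E \<Longrightarrow> j < b \<Longrightarrow> f (e, j) \<in> e \<times> {..<a}"
    by force
  define \<alpha> where "\<alpha> = (\<lambda>u w. card {j. j < b \<and> fst (f ({u, w}, j)) = u})"
  show ?thesis
  proof (rule that[of \<alpha>])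
    fix u w assume uw: "{u, w} \<in> E"
    then have ne: "u \<noteq> w" using E[OF uw] by (auto simp: card_2_iff)
    have "{j. j < b \<and> fst (f ({u, w}, j)) = u} \<union> {j. j < b \<and> fst (f ({u, w}, j)) = w} = {..<b}"
      using f(2)[OF uw] by (auto simp: mem_Times_iff)
    moreover have "card ({j. j < b \<and> fst (f ({u, w}, j)) = u} \<union> {j. j < b \<and> fst (f ({u, w}, j)) = w}) =
        card {j. j < b \<and> fst (f ({u, w}, j)) = u} + card {j. j < b \<and> fst (f ({u, w}, j)) = w}"
      using ne by (intro card_Un_disjoint) auto
    ultimately show "\<alpha> u w + \<alpha> w u = b" by (simp add: \<alpha>_def insert_commute)
  next
    fix u assume u: "u \<in> V"
    have finN: "finite {w. {u, w} \<in> E}"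
      by (rule finite_subset[OF _ V]) (use E in blast)
    let ?T = "SIGMA w:{w. {u, w} \<in> E}. {j. j < b \<and> fst (f ({u, w}, j)) = u}"
    have "(\<Sum>w | {u, w} \<in> E. \<alpha> u w) = card ?T"
      unfolding \<alpha>_def using finN by simp
    also have "\<dots> \<le> card {..<a}"
    proof (rule card_inj_on_le[where f = "\<lambda>(w, j). snd (f ({u, w}, j))"])
      show "inj_on (\<lambda>(w, j). snd (f ({u, w}, j))) ?T"
      proof (rule inj_onI, clarify)
        fix w j w' j'
        assume *: "{u, w} \<in> E" "{u, w'} \<in> E" "j < b" "j' < b" "snd (f ({u, w}, j)) = snd (f ({u, w'}, j'))"
          "fst (f ({u, w}, j)) = u" "fst (f ({u, w'}, j')) = u"
        then have "f ({u, w}, j) = f ({u, w'}, j')" by (simp add: prod_eq_iff)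
        then have "({u, w}, j) = ({u, w'}, j')" using * by (intro inj_onD[OF f(1)]) auto
        then show "w = w' \<and> j = j'" by (auto simp: doubleton_eq_iff)
      qed
      show "(\<lambda>(w, j). snd (f ({u, w}, j))) ` ?T \<subseteq> {..<a}" using f(2) by (force simp: mem_Times_iff)
    qed simp
    finally show "(\<Sum>w | {u, w} \<in> E. \<alpha> u w) \<le> a" by simp
  qed
qed

text \<open>
  \<open>True\<close> marks a step along the weights and \<open>False\<close> a step against them. When the weights out of
  each vertex sum to at most 1, only the far end of a maximal run of backward steps is a free
  choice among the vertices; \<open>back_runs\<close> counts these runs.
\<close>

fun walk_weight :: "('a \<Rightarrow> 'a \<Rightarrow> real) \<Rightarrow> bool list \<Rightarrow> 'a \<Rightarrow> 'a list \<Rightarrow> real" where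
  "walk_weight w (True # p) x (y # ys) = w x y * walk_weight w p y ys"
| "walk_weight w (False # p) x (y # ys) = w y x * walk_weight w p y ys"
| "walk_weight w _ _ _ = 1"

fun back_runs :: "bool list \<Rightarrow> nat" where
  "back_runs [] = 0"
| "back_runs (True # p) = back_runs p"
| "back_runs (False # p) = (if p = [] \<or> hd p then Suc (back_runs p) else back_runs p)"

lemma lists_length_Suc: "{xs. set xs \<subseteq> V \<and> length xs = Suc m} = (\<lambda>(y, ys). y # ys) ` (V \<times> {ys. set ys \<subseteq> V \<and> length ys = m})"
  by (auto simp: length_Suc_conv image_iff)

lemma sum_lists_Suc:
  fixes g :: "'a list \<Rightarrow> real"
  assumes "finite V"
  shows "(\<Sum>xs | set xs \<subseteq> V \<and> length xs = Suc m. g xs) = (\<Sum>y\<in>V. \<Sum>ys | set ys \<subseteq> V \<and> length ys = m. g (y # ys))"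
proof -
  have "inj_on (\<lambda>(y, ys). y # ys) (V \<times> {ys. set ys \<subseteq> V \<and> length ys = m})" by (auto simp: inj_on_def)
  then show ?thesis
    unfolding lists_length_Suc by (simp add: sum.reindex sum.cartesian_product case_prod_unfold)
qed

lemma walk_weight_nonneg: "(\<And>x y. 0 \<le> w x y) \<Longrightarrow> 0 \<le> walk_weight w p x ys"
  by (induction w p x ys rule: walk_weight.induct) auto

text \<open>The two bounds need each other. From a fixed start, a backward step has weight at most 1
  and leaves the next vertex free, as in the second sum. There a free start acts like a preceding
  backward step, hence \<open>False # p\<close>: a further backward step is absorbed by the weights
  out of its far end, while a forward step leaves one factor \<open>card V\<close> for the
  start.\<close>

lemma sum_walk_weight_le:
  assumes V: "finite V" and w: "\<And>x y. 0 \<le> w x y" "\<And>x. x \<in> V \<Longrightarrow> (\<Sum>y\<in>V. w x y) \<le> 1"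
  shows "x \<in> V \<Longrightarrow> (\<Sum>ys | set ys \<subseteq> V \<and> length ys = length p. walk_weight w p x ys) \<le> real (card V) ^ back_runs p"
    and "(\<Sum>x\<in>V. \<Sum>ys | set ys \<subseteq> V \<and> length ys = length p. walk_weight w p x ys) \<le>
      real (card V) ^ back_runs (False # p)"
proof (induction p arbitrary: x)
  case Nil
  { case 1 show ?case by (simp add: conj_commute cong: conj_cong) }
  { case 2 show ?case by (simp add: conj_commute cong: conj_cong) }
next
  case (Cons b p)
  define S where "S = (\<lambda>x. \<Sum>ys | set ys \<subseteq> V \<and> length ys = length p. walk_weight w p x ys)"
  have S0: "0 \<le> S x" for x unfolding S_def by (intro sum_nonneg walk_weight_nonneg w)
  have IH: "S x \<le> real (card V) ^ back_runs p" if "x \<in> V" for x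
    unfolding S_def by (rule Cons.IH(1)[OF that])
  have IH2: "(\<Sum>x\<in>V. S x) \<le> real (card V) ^ back_runs (False # p)"
    unfolding S_def by (rule Cons.IH(2))
  have w1: "w x y \<le> 1" if "x \<in> V" "y \<in> V" for x y
    using member_le_sum[of y V "w x"] w V that by (meson order_trans DiffD1)
  have T: "(\<Sum>ys | set ys \<subseteq> V \<and> length ys = length (True # p). walk_weight w (True # p) x ys) = (\<Sum>y\<in>V. w x y * S y)"
    and F: "(\<Sum>ys | set ys \<subseteq> V \<and> length ys = length (False # p). walk_weight w (False # p) x ys) = (\<Sum>y\<in>V. w y x * S y)" for x
    by (simp_all add: sum_lists_Suc[OF V] S_def sum_distrib_left)
  have T1: "(\<Sum>y\<in>V. w x y * S y) \<le> real (card V) ^ back_runs p" if "x \<in> V" for x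
  proof -
    have "(\<Sum>y\<in>V. w x y * S y) \<le> (\<Sum>y\<in>V. w x y * real (card V) ^ back_runs p)"
      using IH w by (intro sum_mono mult_left_mono) auto
    also have "\<dots> = (\<Sum>y\<in>V. w x y) * real (card V) ^ back_runs p" by (simp add: sum_distrib_right)
    also have "\<dots> \<le> 1 * real (card V) ^ back_runs p" using w that by (intro mult_right_mono) auto
    finally show ?thesis by simp
  qed
  { case 1
    show ?case
    proof (cases b)
      case True
      then show ?thesis using T1[OF 1] T by simp
    next
      case False
      have "(\<Sum>y\<in>V. w y x * S y) \<le> (\<Sum>y\<in>V. 1 * S y)"
        using w1 1 S0 by (intro sum_mono mult_right_mono) auto
      then show ?thesis using False F IH2 by simp
    qed }
  { case 2
    show ?case
    proof (cases b)
      case True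
      have "(\<Sum>x\<in>V. \<Sum>y\<in>V. w x y * S y) \<le> (\<Sum>x\<in>V. real (card V) ^ back_runs p)"
        by (intro sum_mono T1)
      then show ?thesis using True T by simp
    next
      case False
      have "(\<Sum>x\<in>V. \<Sum>y\<in>V. w y x * S y) = (\<Sum>y\<in>V. (\<Sum>x\<in>V. w y x) * S y)"
        by (subst sum.swap) (simp add: sum_distrib_right)
      also have "\<dots> \<le> (\<Sum>y\<in>V. 1 * S y)" using w S0 by (intro sum_mono mult_right_mono) auto
      finally show ?thesis using False F IH2 by simp
    qed }
qed

text \<open>Markov's inequality for the total weight of all walks.\<close>

lemma card_walks_le:
  fixes d :: real
  assumes V: "finite V" and w: "\<And>x y. 0 \<le> w x y" "\<And>x. x \<in> V \<Longrightarrow> (\<Sum>y\<in>V. w x y) \<le> 1"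
    and X: "X \<subseteq> V \<times> {ys. set ys \<subseteq> V \<and> length ys = length p}"
    and d: "\<And>x ys. (x, ys) \<in> X \<Longrightarrow> d \<le> walk_weight w p x ys"
  shows "card X * d \<le> real (card V) ^ back_runs (False # p)"
proof -
  let ?Y = "V \<times> {ys. set ys \<subseteq> V \<and> length ys = length p}"
  have finY: "finite ?Y" using V by (simp add: finite_lists_length_eq)
  have "card X * d = (\<Sum>x\<in>X. d)" by simp
  also have "\<dots> \<le> (\<Sum>(x, ys)\<in>X. walk_weight w p x ys)" using d by (intro sum_mono) auto
  also have "\<dots> \<le> (\<Sum>(x, ys)\<in>?Y. walk_weight w p x ys)"
    using walk_weight_nonneg[OF w(1)] by (intro sum_mono2 finY X) auto
  also have "\<dots> = (\<Sum>x\<in>V. \<Sum>ys | set ys \<subseteq> V \<and> length ys = length p. walk_weight w p x ys)"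
    by (simp add: sum.cartesian_product)
  also have "\<dots> \<le> real (card V) ^ back_runs (False # p)" by (rule sum_walk_weight_le(2)[OF V w])
  finally show ?thesis .
qed

lemma card_walks_from_le:
  fixes d :: real
  assumes V: "finite V" and w: "\<And>x y. 0 \<le> w x y" "\<And>x. x \<in> V \<Longrightarrow> (\<Sum>y\<in>V. w x y) \<le> 1"
    and X: "X \<subseteq> {ys. set ys \<subseteq> V \<and> length ys = length p}" and x: "x \<in> V"
    and d: "\<And>ys. ys \<in> X \<Longrightarrow> d \<le> walk_weight w p x ys"
  shows "card X * d \<le> real (card V) ^ back_runs p"
proof -
  let ?Y = "{ys. set ys \<subseteq> V \<and> length ys = length p}"
  have finY: "finite ?Y" using V by (simp add: finite_lists_length_eq)
  have "card X * d = (\<Sum>x\<in>X. d)" by simp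
  also have "\<dots> \<le> (\<Sum>ys\<in>X. walk_weight w p x ys)" using d by (intro sum_mono) auto
  also have "\<dots> \<le> (\<Sum>ys\<in>?Y. walk_weight w p x ys)"
    using walk_weight_nonneg[OF w(1)] by (intro sum_mono2 finY X) auto
  also have "\<dots> \<le> real (card V) ^ back_runs p" by (rule sum_walk_weight_le(1)[OF V w x])
  finally show ?thesis .
qed

lemma walk_weight_map:
  "walk_weight w (map P [m..<m + l]) (x m) (map x [Suc m..<Suc m + l]) =
    (\<Prod>i\<in>{m..<m + l}. if P i then w (x i) (x (Suc i)) else w (x (Suc i)) (x i))"
proof (induction l arbitrary: m)
  case (Suc l)
  have 1: "[m..<m + Suc l] = m # [Suc m..<Suc m + l]" "[Suc m..<Suc m + Suc l] = Suc m # [Suc (Suc m)..<Suc (Suc m) + l]"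
    by (simp_all add: upt_conv_Cons del: upt_Suc)
  have 2: "{m..<m + Suc l} = insert m {Suc m..<Suc m + l}" by auto
  show ?case
    unfolding 1 2 list.map using Suc.IH[of "Suc m"] by (cases "P m") simp_all
qed simp

text \<open>A backward run is counted at its last step: either the list ends there or the next step
  is forward.\<close>

lemma back_runs_map:
  "back_runs (map P [m..<m + l]) = card {i \<in> {m..<m + l}. \<not> P i \<and> (Suc i = m + l \<or> P (Suc i))}"
proof (induction l arbitrary: m)
  case (Suc l)
  have 1: "[m..<m + Suc l] = m # [Suc m..<Suc m + l]"
    by (simp add: upt_conv_Cons del: upt_Suc)
  let ?S = "{i \<in> {Suc m..<Suc m + l}. \<not> P i \<and> (Suc i = Suc m + l \<or> P (Suc i))}"
  have 2: "{i \<in> {m..<m + Suc l}. \<not> P i \<and> (Suc i = m + Suc l \<or> P (Suc i))} =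
    (if \<not> P m \<and> (l = 0 \<or> P (Suc m)) then insert m ?S else ?S)"
    by (auto simp: not_less_eq_eq le_less_Suc_eq less_Suc_eq_le dest: le_antisym Suc_leI elim: le_neq_implies_less)
  have 3: "map P [Suc m..<Suc m + l] = [] \<longleftrightarrow> l = 0" "l \<noteq> 0 \<Longrightarrow> hd (map P [Suc m..<Suc m + l]) = P (Suc m)"
    by (simp_all add: upt_conv_Cons hd_map del: upt_Suc)
  show ?case
    unfolding 1 2 list.map using Suc.IH[of "Suc m"] 3 by (cases "P m") (auto simp del: upt_Suc map_is_Nil_conv)
qed simp

section \<open>Cycles\<close>

lemma verts_cycle [simp]: "verts (cycle_graph k) = {..<k}"
  by (simp add: cycle_graph_def)

lemma edges_cycle: "edges (cycle_graph k) = (\<lambda>i. {i, Suc i mod k}) ` {..<k}"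
  by (auto simp: cycle_graph_def)

lemma Suc_mod_if: "i < k \<Longrightarrow> Suc i mod k = (if Suc i = k then 0 else Suc i)"
  by auto

lemma inj_on_cycle_edge: "3 \<le> k \<Longrightarrow> inj_on (\<lambda>i. {i, Suc i mod k}) {..<k}"
  by (rule inj_onI) (auto simp: Suc_mod_if doubleton_eq_iff split: if_splits)

lemma simple_graph_cycle:
  assumes "3 \<le> k" shows "simple_graph (cycle_graph k)"
proof -
  have "card {i, Suc i mod k} = 2" if "i < k" for i
    using assms that by (auto simp: card_2_iff Suc_mod_if split: if_splits)
  then show ?thesis using assms by (auto simp: simple_graph_def edges_cycle)
qed

lemma card_edges_cycle: "3 \<le> k \<Longrightarrow> card (edges (cycle_graph k)) = k"
  by (simp add: edges_cycle card_image inj_on_cycle_edge)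

lemma embeddings_cycle:
  "embeddings G (cycle_graph k) = {x \<in> {..<k} \<rightarrow>\<^sub>E verts G. inj_on x {..<k} \<and> (\<forall>i<k. {x i, x (Suc i mod k)} \<in> edges G)}"
  by (auto simp: embeddings_def edges_cycle)

lemma bij_rotate:
  fixes j k :: nat assumes "0 < k"
  shows "bij_betw (\<lambda>i. (i + j) mod k) {..<k} {..<k}"
proof -
  have inj: "inj_on (\<lambda>i. (i + j) mod k) {..<k}"
  proof (rule inj_onI)
    fix a b assume "a \<in> {..<k}" "b \<in> {..<k}" "(a + j) mod k = (b + j) mod k"
    then have "[a + j = b + j] (mod k)" by (simp add: cong_def)
    then have "a mod k = b mod k" by (simp add: cong_add_rcancel_nat flip: cong_def)
    then show "a = b" using \<open>a \<in> {..<k}\<close> \<open>b \<in> {..<k}\<close> by simp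
  qed
  then show ?thesis
    unfolding bij_betw_def using assms by (intro conjI endo_inj_surj) auto
qed

lemma rotate_embedding:
  fixes j :: nat
  assumes x: "x \<in> embeddings G (cycle_graph k)" and k: "3 \<le> k"
  defines "y \<equiv> restrict (\<lambda>i. x ((i + j) mod k)) {..<k}"
  shows "y \<in> embeddings G (cycle_graph k)" "y ` {..<k} = x ` {..<k}"
    "(\<lambda>e. y ` e) ` edges (cycle_graph k) = (\<lambda>e. x ` e) ` edges (cycle_graph k)"
proof -
  have k0: "0 < k" using k by simp
  have inj: "inj_on (\<lambda>i. (i + j) mod k) {..<k}" and surj: "(\<lambda>i. (i + j) mod k) ` {..<k} = {..<k}"
    using bij_rotate[OF k0, of j] by (simp_all add: bij_betw_def)
  have y: "y i = x ((i + j) mod k)" if "i < k" for i using that by (simp add: y_def)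
  show im: "y ` {..<k} = x ` {..<k}"
    using y surj by (metis (no_types, lifting) image_cong image_image lessThan_iff)
  have suc: "y (Suc i mod k) = x (Suc ((i + j) mod k) mod k)" if "i < k" for i
    using y[of "Suc i mod k"] k0 by (simp add: mod_Suc_eq mod_add_left_eq)
  have "inj_on (x \<circ> (\<lambda>i. (i + j) mod k)) {..<k}"
    using inj surj x by (intro comp_inj_on) (auto simp: embeddings_def)
  then have "inj_on y {..<k}" using y by (simp add: inj_on_def)
  moreover have "{y i, y (Suc i mod k)} \<in> edges G" if "i < k" for i
    using x k0 unfolding y[OF that] suc[OF that] by (simp add: embeddings_cycle)
  moreover have "y \<in> {..<k} \<rightarrow>\<^sub>E verts G"
    using im x by (auto simp: embeddings_def y_def)
  ultimately show "y \<in> embeddings G (cycle_graph k)" by (simp add: embeddings_cycle)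
  have "(\<lambda>e. y ` e) ` edges (cycle_graph k) = (\<lambda>i. {y i, y (Suc i mod k)}) ` {..<k}"
    by (simp add: edges_cycle image_image)
  also have "\<dots> = (\<lambda>i. {x ((i + j) mod k), x (Suc ((i + j) mod k) mod k)}) ` {..<k}"
    using y suc by (intro image_cong) auto
  also have "\<dots> = (\<lambda>i. {x i, x (Suc i mod k)}) ` (\<lambda>i. (i + j) mod k) ` {..<k}"
    by (simp add: image_image)
  also have "\<dots> = (\<lambda>e. x ` e) ` edges (cycle_graph k)"
    unfolding surj by (simp add: edges_cycle image_image)
  finally show "(\<lambda>e. y ` e) ` edges (cycle_graph k) = (\<lambda>e. x ` e) ` edges (cycle_graph k)" .
qed

text \<open>Rotating a labelling moves any prescribed vertex to position 0, so the copies through an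
  edge can be read as walks from one fixed end of it.\<close>

lemma cycle_copy_embedding:
  assumes J: "J \<in> copies H (cycle_graph k)" and k: "3 \<le> k" and u: "u \<in> verts J"
  obtains x where "x \<in> embeddings H (cycle_graph k)" "x 0 = u" "x ` {..<k} = verts J"
    "(\<lambda>i. {x i, x (Suc i mod k)}) ` {..<k} = edges J"
proof -
  let ?F = "cycle_graph k"
  have "0 < card {x \<in> embeddings H ?F. x ` verts ?F = verts J \<and> (\<lambda>e. x ` e) ` edges ?F = edges J}"
    unfolding card_embeddings_image[OF simple_graph_cycle[OF k] J]
    by (rule card_embeddings_self_pos[OF simple_graph_cycle[OF k]])
  then obtain x where x: "x \<in> embeddings H ?F" "x ` {..<k} = verts J" "(\<lambda>e. x ` e) ` edges ?F = edges J"
    unfolding card_gt_0_iff by auto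
  from u obtain j where j: "j < k" "u = x j" using x(2) by auto
  define y where "y = restrict (\<lambda>i. x ((i + j) mod k)) {..<k}"
  note r = rotate_embedding[OF x(1) k, of j, folded y_def]
  have "(\<lambda>i. {y i, y (Suc i mod k)}) ` {..<k} = (\<lambda>e. y ` e) ` edges ?F"
    by (simp add: edges_cycle image_image)
  with r x j k show ?thesis by (intro that[of y]) (auto simp: y_def)
qed

text \<open>
  As for cliques, a maximality argument with the potential \<open>(k - 1) |E| - k |S|\<close> puts all
  \<open>k\<close>-cycles through an edge into a subgraph with at most \<open>k\<close> more edges than vertices. Its degrees
  exceed 2 by at most \<open>2 k + 2\<close> in total, so it contains few walks.
\<close>

lemma card_cycles_edge_le:
  assumes sH: "simple_graph H" and k: "3 \<le> k" and uw: "{u, w} \<in> edges H"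
    and dens: "\<And>S E. S \<subseteq> verts H \<Longrightarrow> E \<subseteq> edges H \<Longrightarrow> \<Union>E \<subseteq> S \<Longrightarrow> (k - 1) * card E \<le> k * card S"
  shows "card {J \<in> copies H (cycle_graph k). {u, w} \<in> edges J} \<le> 2 ^ (3 * k + 2)"
proof -
  let ?C = "{J \<in> copies H (cycle_graph k). {u, w} \<in> edges J}"
  have finH: "finite (verts H)" "finite (edges H)" using finite_edges[OF sH] sH by (auto simp: simple_graph_def)
  have uw2: "u \<noteq> w" "u \<in> verts H" "w \<in> verts H"
    using sH uw unfolding simple_graph_def by (auto simp: card_2_iff doubleton_eq_iff)
  \<comment> \<open>The potential \<open>(k - 1) |E| - k |S|\<close> must be at least
    \<open>|E| - |S| - k\<close>, with equality for the single edge \<open>{u, w}\<close>; together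
    with \<open>dens\<close> this gives \<open>|E| <= |S| + k\<close>. The degree condition ensures
    that a bound on the total degree bounds the excess over 2.\<close>
  define P where "P = (\<lambda>E. \<exists>S \<subseteq> verts H. E \<subseteq> edges H \<and> \<Union>E \<subseteq> S \<and> {u, w} \<in> E \<and>
    (\<forall>v\<in>S - {u, w}. 2 \<le> card {e \<in> E. v \<in> e}) \<and> card E + k * card S \<le> (k - 1) * card E + k + card S)"
  have "P {{u, w}}"
    unfolding P_def using uw uw2 k by (intro exI[of _ "{u, w}"]) auto
  moreover have finP: "finite (Collect P)"
    by (rule finite_subset[of _ "Pow (edges H)"]) (auto simp: P_def finH)
  ultimately obtain E where PE: "P E" and max: "\<And>E'. P E' \<Longrightarrow> E \<subseteq> E' \<Longrightarrow> E' = E"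
    using finite_has_maximal2[OF finP, of "{{u, w}}"] by auto
  from PE obtain S where S0: "S \<subseteq> verts H \<and> E \<subseteq> edges H \<and> \<Union>E \<subseteq> S \<and> {u, w} \<in> E \<and>
    (\<forall>v\<in>S - {u, w}. 2 \<le> card {e \<in> E. v \<in> e}) \<and> card E + k * card S \<le> (k - 1) * card E + k + card S"
    unfolding P_def by (elim exE) (rule that)
  then have S: "S \<subseteq> verts H" "E \<subseteq> edges H" "\<Union>E \<subseteq> S" "{u, w} \<in> E"
    and deg2: "\<And>v. v \<in> S - {u, w} \<Longrightarrow> 2 \<le> card {e \<in> E. v \<in> e}"
    and pot: "card E + k * card S \<le> (k - 1) * card E + k + card S"
    by simp_all
  have finE: "finite E" and finS: "finite S" using S finH finite_subset by blast+
  have uwS: "u \<in> S" "w \<in> S" using S(3,4) by blast+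
  have inE: "edges J \<subseteq> E" if J: "J \<in> ?C" for J
  proof (rule ccontr)
    assume nE: "\<not> edges J \<subseteq> E"
    have sJ: "simple_graph J" "verts J \<subseteq> verts H" "edges J \<subseteq> edges H" "{u, w} \<in> edges J"
      using J by (auto simp: copies_def subgraph_def)
    then have uwJ: "u \<in> verts J" "w \<in> verts J" unfolding simple_graph_def by blast+
    obtain x where x: "x \<in> embeddings H (cycle_graph k)" "x 0 = u" "x ` {..<k} = verts J"
      "(\<lambda>i. {x i, x (Suc i mod k)}) ` {..<k} = edges J"
      by (rule cycle_copy_embedding[of J H k u]) (use J k uwJ in auto)
    define ed where "ed = (\<lambda>i. {x i, x (Suc i mod k)})"
    have edJ: "edges J = ed ` {..<k}" using x(4) by (simp add: ed_def)
    have injx: "inj_on x {..<k}" using x(1) by (simp add: embeddings_def)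
    have injed: "inj_on ed {..<k}"
    proof (rule inj_onI)
      fix i j assume ij: "i \<in> {..<k}" "j \<in> {..<k}" "ed i = ed j"
      then have "x ` {i, Suc i mod k} = x ` {j, Suc j mod k}" by (simp add: ed_def)
      then have "{i, Suc i mod k} = {j, Suc j mod k}"
        using ij k by (subst (asm) inj_on_image_eq_iff[OF injx]) auto
      then show "i = j" using inj_onD[OF inj_on_cycle_edge[OF k]] ij by blast
    qed
    define Z where "Z = {i. i < k \<and> x i \<notin> S}"
    have finZ: "finite Z" "Z \<subseteq> {..<k}" by (auto simp: Z_def)
    have "verts J - S = x ` Z" unfolding x(3)[symmetric] Z_def by auto
    then have cZ: "card (verts J - S) = card Z"
      using injx finZ(2) by (simp add: card_image inj_on_subset)
    have ZE: "ed i \<notin> E" if "i \<in> Z" for i using that S(3) by (auto simp: Z_def ed_def)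
    \<comment> \<open>Each new vertex \<open>x i\<close> brings the new edge \<open>ed i\<close>.
      One more new edge enters the first new vertex or, if no vertex is new, is any edge outside
      \<open>E\<close>.\<close>
    have "\<exists>i<k. i \<notin> Z \<and> ed i \<notin> E"
    proof (rule ccontr)
      assume n: "\<not> ?thesis"
      have "i < k \<Longrightarrow> x i \<in> S" for i
      proof (induction i)
        case 0 then show ?case using x(2) uwS by simp
      next
        case (Suc i)
        then have "i \<notin> Z" by (simp add: Z_def)
        then have "ed i \<in> E" using n Suc.prems Suc_lessD by blast
        then show ?case using S(3) Suc.prems by (auto simp: ed_def)
      qed
      then have "Z = {}" by (auto simp: Z_def)
      then show False using n nE by (auto simp: edJ)
    qed
    then obtain i0 where i0: "i0 < k" "i0 \<notin> Z" "ed i0 \<notin> E" by blast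
    have "card (ed ` insert i0 Z) = card (insert i0 Z)"
      using finZ(2) i0(1) by (intro card_image inj_on_subset[OF injed]) auto
    then have "Suc (card Z) = card (ed ` insert i0 Z)" using finZ i0 by simp
    also have "\<dots> \<le> card (edges J - E)"
      using ZE i0 finZ(2) finH(2) finite_subset[OF sJ(3)] by (intro card_mono) (auto simp: edJ)
    finally have new: "Suc (card Z) \<le> card (edges J - E)" .
    have "card (verts J) = k" using x(3) injx card_image by fastforce
    moreover have finJ: "finite (verts J)" using sJ(1) by (simp add: simple_graph_def)
    moreover have "card (verts J - S) \<le> card (verts J - {u, w})"
      using finJ uwS by (intro card_mono) auto
    \<comment> \<open>For \<open>z\<close> new vertices and \<open>e'\<close> new edges,
      \<open>P\<close> persists if \<open>(k - 1) * z <= (k - 2) * e'\<close>. As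
      \<open>e' >= z + 1\<close>, it is enough that \<open>z <= k - 2\<close>, which holds because
      \<open>u\<close> and \<open>w\<close> are old.\<close>
    ultimately have z2: "card Z \<le> k - 2"
      using uwJ uw2(1) cZ by (simp add: card_Diff_subset)
    have "P (E \<union> edges J)"
      unfolding P_def
    proof (intro exI[of _ "S \<union> verts J"] conjI ballI)
      show "S \<union> verts J \<subseteq> verts H" "E \<union> edges J \<subseteq> edges H" using S sJ by auto
      show "\<Union>(E \<union> edges J) \<subseteq> S \<union> verts J" using S(3) sJ(1) unfolding simple_graph_def by blast
      show "{u, w} \<in> E \<union> edges J" using S by simp
      fix v assume v: "v \<in> S \<union> verts J - {u, w}"
      have finEJ: "finite (E \<union> edges J)" using finE finite_subset[OF sJ(3) finH(2)] by simp
      show "2 \<le> card {e \<in> E \<union> edges J. v \<in> e}"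
      proof (cases "v \<in> S")
        case True
        then have "2 \<le> card {e \<in> E. v \<in> e}" using v by (intro deg2) auto
        also have "\<dots> \<le> card {e \<in> E \<union> edges J. v \<in> e}" using finEJ by (intro card_mono) auto
        finally show ?thesis .
      next
        case False
        then obtain i where i: "i < k" "v = x i" using v x(3) by auto
        define i' where "i' = (if i = 0 then k - 1 else i - 1)"
        have i': "i' < k" "Suc i' mod k = i" "i' \<noteq> i" using i k by (auto simp: i'_def)
        have "ed i \<noteq> ed i'" using inj_onD[OF injed, of i i'] i i' by auto
        then have "2 = card {ed i, ed i'}" by simp
        also have "\<dots> \<le> card {e \<in> E \<union> edges J. v \<in> e}"
          using finEJ i i' by (intro card_mono) (auto simp: edJ ed_def)
        finally show ?thesis .
      qed
    next
      have "card (E \<union> edges J) = card E + card (edges J - E)"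
        using card_Un_disjoint[of E "edges J - E"] finE finite_subset[OF sJ(3) finH(2)] by simp
      moreover have "card (S \<union> verts J) = card S + card Z"
        using card_Un_disjoint[of S "verts J - S"] finS finJ cZ by simp
      moreover obtain k' where k': "k = k' + 3" using k by (metis add.commute le_Suc_ex)
      obtain c where c: "card (edges J - E) = Suc (card Z) + c" using new by (metis le_Suc_ex)
      have "card Z \<le> k' + 1" using z2 k' by simp
      ultimately show "card (E \<union> edges J) + k * card (S \<union> verts J) \<le> (k - 1) * card (E \<union> edges J) + k + card (S \<union> verts J)"
        using pot c by (simp add: k' algebra_simps)
    qed
    then have "E \<union> edges J = E" by (rule max) auto
    then show False using nE by blast
  qed
  define d where "d = (\<lambda>v. card {e \<in> E. v \<in> e})"
  \<comment> \<open>The excess degree over 2. The maximum is there because \<open>u\<close> and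
    \<open>w\<close> may have degree 1, which accounts for the 2 in the bound
    \<open>2 * k + 2\<close>.\<close>
  define T where "T = (\<lambda>v. max (d v) 2 - 2)"
  have dpos: "1 \<le> d v" if "v \<in> {u, w}" for v
    unfolding d_def using that S(4) finE by (auto simp: Suc_le_eq card_gt_0_iff)
  have E2: "\<And>e. e \<in> E \<Longrightarrow> e \<subseteq> S \<and> card e = 2"
    using S sH unfolding simple_graph_def by blast
  have "(\<Sum>v\<in>S. d v) = 2 * card E"
    unfolding d_def by (rule sum_card_incident[OF finS finE E2])
  moreover have "card E \<le> k + card S"
    using pot dens[OF S(1-3)] by linarith
  moreover have "(\<Sum>v\<in>S. T v + 2) \<le> (\<Sum>v\<in>S. d v + (if v \<in> {u, w} then 1 else 0))"
  proof (rule sum_mono)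
    fix v assume v: "v \<in> S"
    have "2 \<le> d v" if "v \<notin> {u, w}" using deg2[of v] v that by (simp add: d_def)
    then show "T v + 2 \<le> d v + (if v \<in> {u, w} then 1 else 0)"
      using dpos[of v] by (cases "v \<in> {u, w}") (auto simp: T_def)
  qed
  moreover have "(\<Sum>v\<in>S. if v \<in> {u, w} then 1 else (0::nat)) = 2"
    using finS uwS uw2(1) by (subst sum.inter_restrict[symmetric]) (auto simp: Int_absorb1)
  ultimately have T: "(\<Sum>v\<in>S. T v) \<le> 2 * k + 2"
    by (simp only: sum.distrib) (simp add: sum_constant)
  \<comment> \<open>Transition probabilities of the simple random walk on \<open>E\<close>. The
    trajectories from \<open>u\<close> have total probability at most 1, and each cycle through the
    edge will have probability at least \<open>1 / 2 ^ (3 * k + 2)\<close>.\<close>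
  define wt where "wt = (\<lambda>x y. if {x, y} \<in> E then 1 / real (d x) else 0)"
  have wt: "0 \<le> wt x y" for x y by (simp add: wt_def)
  have wt1: "(\<Sum>y\<in>S. wt x y) \<le> 1" if "x \<in> S" for x
  proof -
    have "(\<Sum>y\<in>S. wt x y) = (\<Sum>y\<in>{y \<in> S. {x, y} \<in> E}. 1 / real (d x))"
      unfolding wt_def using finS by (simp only: sum.inter_filter)
    also have "\<dots> = card {y \<in> S. {x, y} \<in> E} / d x" by simp
    also have "{y \<in> S. {x, y} \<in> E} = {y. {x, y} \<in> E}" using S(3) by blast
    also have "card \<dots> = d x" unfolding d_def by (rule card_neighbours) (use E2 in blast)
    finally show ?thesis by simp
  qed
  let ?F = "cycle_graph k"
  define l where "l = k - 1"
  have kl: "k = Suc l" using k by (simp add: l_def)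
  define X where "X = (\<lambda>x. map x [1..<k]) ` {x \<in> embeddings H ?F. x 0 = u \<and> (\<forall>i<k. {x i, x (Suc i mod k)} \<in> E)}"
  have XS: "X \<subseteq> {ys. set ys \<subseteq> S \<and> length ys = length (map (\<lambda>i. True) [0..<l])}"
  proof
    fix ys assume "ys \<in> X"
    then obtain x where x: "\<And>i. i < k \<Longrightarrow> {x i, x (Suc i mod k)} \<in> E" "ys = map x [1..<k]"
      by (auto simp: X_def)
    have "x i \<in> S" if "i < k" for i using x(1)[OF that] S(3) by blast
    then show "ys \<in> {ys. set ys \<subseteq> S \<and> length ys = length (map (\<lambda>i. True) [0..<l])}"
      by (auto simp: x(2) kl simp del: upt_Suc)
  qed
  have "card X * (1 / 2 ^ (3 * k + 2)) \<le> real (card S) ^ back_runs (map (\<lambda>i. True) [0..<l])"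
  proof (rule card_walks_from_le[OF finS wt wt1 XS uwS(1)])
    fix ys assume "ys \<in> X"
    then obtain x where x: "x \<in> embeddings H ?F" "x 0 = u" "\<And>i. i < k \<Longrightarrow> {x i, x (Suc i mod k)} \<in> E"
      "ys = map x [1..<k]" by (auto simp: X_def)
    have injx: "inj_on x {..<k}" using x(1) by (simp add: embeddings_def)
    have "walk_weight wt (map (\<lambda>i. True) [0..<l]) u ys = (\<Prod>i\<in>{0..<l}. wt (x i) (x (Suc i)))"
      using walk_weight_map[of wt "\<lambda>i. True" 0 l x] by (simp add: x(2,4) kl del: upt_Suc)
    also have "\<dots> = (\<Prod>i\<in>{0..<l}. 1 / d (x i))"
    proof (rule prod.cong)
      fix i assume "i \<in> {0..<l}"
      then show "wt (x i) (x (Suc i)) = 1 / d (x i)" using x(3)[of i] by (simp add: wt_def kl)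
    qed simp
    also have "\<dots> = 1 / (\<Prod>i\<in>{0..<l}. real (d (x i)))" by (simp add: prod_dividef)
    finally have ww: "walk_weight wt (map (\<lambda>i. True) [0..<l]) u ys = 1 / (\<Prod>i\<in>{0..<l}. real (d (x i)))" .
    have xS: "x i \<in> S" if "i < k" for i using x(3)[OF that] S(3) by blast
    have dx: "1 \<le> d (x i)" if "i < k" for i
      unfolding d_def using x(3)[OF that] finE by (auto simp: Suc_le_eq card_gt_0_iff)
    have "(\<Prod>i\<in>{0..<l}. d (x i)) \<le> (\<Prod>i\<in>{0..<l}. 2 * 2 ^ T (x i))"
    proof (rule prod_mono, safe)
      fix i
      have "m \<le> 2 * 2 ^ (max m 2 - 2)" for m :: nat
      proof (cases "2 \<le> m")
        case True
        then obtain m' where "m = m' + 2" by (metis add.commute le_Suc_ex)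
        moreover have "Suc m' \<le> 2 ^ m'" by (simp add: Suc_leI)
        ultimately show ?thesis by simp
      qed auto
      then show "d (x i) \<le> 2 * 2 ^ T (x i)" by (simp add: T_def)
    qed
    also have "\<dots> = 2 ^ l * 2 ^ (\<Sum>i\<in>{0..<l}. T (x i))" by (simp add: prod.distrib power_sum)
    \<comment> \<open>The vertices of a cycle are distinct, so each excess is paid only
      once.\<close>
    also have "(\<Sum>i\<in>{0..<l}. T (x i)) = (\<Sum>v\<in>x ` {0..<l}. T v)"
    proof -
      have "inj_on x {0..<l}" by (rule inj_on_subset[OF injx]) (auto simp: kl)
      then show ?thesis by (simp add: sum.reindex)
    qed
    also have "\<dots> \<le> (\<Sum>v\<in>S. T v)" using finS xS by (intro sum_mono2) (auto simp: kl)
    also have "\<dots> \<le> 2 * k + 2" by (rule T)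
    finally have "(\<Prod>i\<in>{0..<l}. d (x i)) \<le> 2 ^ l * 2 ^ (2 * k + 2)" by simp
    also have "\<dots> \<le> 2 ^ (3 * k + 2)" unfolding power_add[symmetric] by (intro power_increasing) (auto simp: kl)
    finally have "real (\<Prod>i\<in>{0..<l}. d (x i)) \<le> real (2 ^ (3 * k + 2))" by (rule of_nat_mono)
    then have 1: "(\<Prod>i\<in>{0..<l}. real (d (x i))) \<le> 2 ^ (3 * k + 2)" by simp
    have "0 < (\<Prod>i\<in>{0..<l}. real (d (x i)))"
    proof (rule prod_pos)
      fix i assume "i \<in> {0..<l}"
      then show "0 < real (d (x i))" using dx[of i] by (simp add: kl)
    qed
    then show "1 / 2 ^ (3 * k + 2) \<le> walk_weight wt (map (\<lambda>i. True) [0..<l]) u ys"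
      unfolding ww using 1 by (intro divide_left_mono) auto
  qed
  also have "back_runs (map (\<lambda>i. True) [0..<l]) = 0"
    using back_runs_map[of "\<lambda>i. True" 0 l] by simp
  finally have cX: "real (card X) \<le> 2 ^ (3 * k + 2)" by simp
  have finX: "finite X"
    by (rule finite_subset[OF XS]) (use finS in \<open>simp add: finite_lists_length_eq\<close>)
  define g where "g = (\<lambda>ys. ((\<lambda>i. (u # ys) ! i) ` {..<k}, (\<lambda>i. {(u # ys) ! i, (u # ys) ! (Suc i mod k)}) ` {..<k}))"
  have "?C \<subseteq> g ` X"
  proof
    fix J assume J: "J \<in> ?C"
    then have "u \<in> verts J" unfolding copies_def subgraph_def simple_graph_def by blast
    then obtain x where x: "x \<in> embeddings H ?F" "x 0 = u" "x ` {..<k} = verts J"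
      "(\<lambda>i. {x i, x (Suc i mod k)}) ` {..<k} = edges J"
      using cycle_copy_embedding[of J H k u] J k by auto
    have "u # map x [1..<k] = map x [0..<k]" using k x(2) by (simp add: upt_conv_Cons)
    then have nth: "(u # map x [1..<k]) ! i = x i" if "i < k" for i using that by simp
    have "x ` {..<k} = fst (g (map x [1..<k]))"
      unfolding g_def fst_conv using nth by (intro image_cong) auto
    moreover have "(\<lambda>i. {x i, x (Suc i mod k)}) ` {..<k} = snd (g (map x [1..<k]))"
      unfolding g_def snd_conv using nth k by (intro image_cong) auto
    ultimately have "J = g (map x [1..<k])" using x(3,4) by (simp add: prod_eq_iff)
    moreover have "{x i, x (Suc i mod k)} \<in> E" if "i < k" for i
      using inE[OF J] x(4) that by blast
    then have "map x [1..<k] \<in> X" unfolding X_def using x(1,2) by (intro imageI) auto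
    ultimately show "J \<in> g ` X" by blast
  qed
  then have "card ?C \<le> card X" using finX by (meson card_image_le card_mono finite_imageI le_trans)
  then have "real (card ?C) \<le> 2 ^ (3 * k + 2)" using cX by linarith
  then show ?thesis by (metis (mono_tags, lifting) of_nat_le_iff of_nat_numeral of_nat_power)
qed

lemma cycle_copies_less_sparse:
  assumes sp: "q_sparse n q H" and H: "subgraph H (clique_graph n)" and q: "0 < q"
    and k: "3 \<le> k" "k \<le> n" and \<eta>: "real n ^ (k - 1) * q ^ k \<le> 1" and L: "100 \<le> L"
  shows "real (num_copies H (cycle_graph k)) < expected_copies n (L * q) (cycle_graph k)"
proof -
  have sH: "simple_graph H" using H by (simp add: subgraph_def)
  show ?thesis
  proof (rule num_copies_less_edge_degree[OF sp H q simple_graph_cycle[OF k(1)] verts_cycle k(2) _ _ _ _ L])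
    fix e assume e: "e \<in> edges H"
    then obtain u w where uw: "e = {u, w}" using sH unfolding simple_graph_def by (auto simp: card_2_iff)
    show "card {J \<in> copies H (cycle_graph k). e \<in> edges J} \<le> 2 ^ (3 * k + 2)"
      unfolding uw
    proof (rule card_cycles_edge_le[OF sH k(1) e[unfolded uw]])
      fix S E assume "S \<subseteq> verts H" "E \<subseteq> edges H" "\<Union>E \<subseteq> S"
      then have "1 \<le> real n ^ card S * q ^ card E" by (intro q_sparse_induced[OF sp H q]) auto
      then show "(k - 1) * card E \<le> k * card S" by (rule edge_vertex_ratio_le[OF _ q _ \<eta>]) (use k in simp)
    qed
  next
    have "(2::nat) ^ (3 * k + 2) \<le> 2 ^ (4 * k)" using k by (intro power_increasing) auto
    then show "2 ^ (3 * k + 2) \<le> (16::nat) ^ card (edges (cycle_graph k))"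
      by (simp add: card_edges_cycle[OF k(1)] power_mult)
    show "0 < n" using k by simp
    show "edges (cycle_graph k) \<noteq> {}" using card_edges_cycle[OF k(1)] k(1) by auto
  qed
qed

section \<open>Cheap patterns for exploring a closed walk\<close>

lemma sum_cyclic_shift:
  fixes g :: "nat \<Rightarrow> 'a::comm_monoid_add"
  assumes "0 < k"
  shows "(\<Sum>i<k. g (Suc i mod k)) = (\<Sum>i<k. g i)"
proof -
  obtain l where k: "k = Suc l" using assms by (cases k) auto
  have "(\<Sum>i<k. g (Suc i mod k)) = (\<Sum>i<l. g (Suc i)) + g 0" by (simp add: k)
  also have "\<dots> = (\<Sum>i<k. g i)" unfolding k sum.lessThan_Suc_shift by (simp add: add.commute)
  finally show ?thesis .
qed

lemma exists_le_average:
  fixes g :: "'a \<Rightarrow> real" and c B :: real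
  assumes "finite T" "0 < c" "c \<le> card T" "\<And>t. t \<in> T \<Longrightarrow> 0 \<le> g t" "(\<Sum>t\<in>T. g t) \<le> B"
  obtains t where "t \<in> T" "g t \<le> B / c"
proof (rule ccontr)
  assume n: "\<not> thesis"
  have T: "T \<noteq> {}" using assms(2,3) by auto
  have B: "0 \<le> B" using sum_nonneg[of T g] assms(4,5) by simp
  have "B / c * c \<le> B / c * card T" using assms(2,3) B by (intro mult_left_mono) auto
  then have "B \<le> (\<Sum>t\<in>T. B / c)" using assms(2) by (simp add: mult.commute)
  also have "\<dots> < (\<Sum>t\<in>T. g t)" using n that assms(1) T by (intro sum_strict_mono) force+
  finally show False using assms(5) by simp
qed

text \<open>
  The number of backward runs of a pattern \<open>P\<close> on a closed walk; it is 0 for both constant patterns.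
\<close>

definition crossings :: "nat \<Rightarrow> (nat \<Rightarrow> bool) \<Rightarrow> nat" where
  "crossings k P = card {i. i < k \<and> \<not> P i \<and> P (Suc i mod k)}"

text \<open>
  The \<open>i\<close>-th edge of a closed walk has \<open>b\<close> tokens, \<open>f i\<close> of them at its tail and \<open>b - f i\<close> at its
  head. Since a vertex holds at most \<open>b + h\<close> tokens, \<open>f\<close> rises slowly along the walk, but it may
  drop at once.
\<close>

locale cyclic_profile =
  fixes k b h :: nat and f :: "nat \<Rightarrow> nat"
  assumes k: "0 < k" and b: "0 < b" and fb: "i < k \<Longrightarrow> f i \<le> b"
    and step: "i < k \<Longrightarrow> f (Suc i mod k) \<le> f i + h"
begin

definition "mn = Min (f ` {..<k})"
definition "mx = Max (f ` {..<k})"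
text \<open>Truncated subtraction keeps only the rises; around a closed walk their total equals that
  of the drops.\<close>

definition "up = (\<Sum>i<k. f (Suc i mod k) - f i)"

text \<open>Minus the logarithm of the product of the step weights, \<open>f i / (b + h)\<close>
  forward and \<open>(b - f i) / (b + h)\<close> backward. A step of weight 0 would divide by 0 and
  get a meaningless value; \<open>good\<close> excludes it.\<close>

definition cost :: "(nat \<Rightarrow> bool) \<Rightarrow> real" where
  "cost P = (\<Sum>i<k. if P i then ln (real (b + h) / real (f i)) else ln (real (b + h) / real (b - f i)))"

lemma bounds: "i < k \<Longrightarrow> mn \<le> f i" "i < k \<Longrightarrow> f i \<le> mx" "mn \<le> mx" "mx \<le> b"
proof -
  show 1: "i < k \<Longrightarrow> mn \<le> f i" "i < k \<Longrightarrow> f i \<le> mx" for i by (auto simp: mn_def mx_def)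
  show "mn \<le> mx" using 1[of 0] k by linarith
  show "mx \<le> b" unfolding mx_def using k fb by (subst Max_le_iff) auto
qed

text \<open>A rise is at most \<open>h\<close> and a drop at most \<open>mx - mn\<close>, so there
  are at least \<open>up / h\<close> rising and \<open>up / (mx - mn)\<close> falling steps,
  together at most \<open>k\<close>. The statement is this sum with denominators cleared.\<close>

lemma up_mult_le: "up * (h + (mx - mn)) \<le> h * (mx - mn) * k"
proof -
  let ?U = "{i. i < k \<and> f i < f (Suc i mod k)}" and ?D = "{i. i < k \<and> f (Suc i mod k) < f i}"
  have n: "Suc i mod k < k" for i using k by simp
  have "up = (\<Sum>i\<in>?U. f (Suc i mod k) - f i)"
    unfolding up_def by (rule sum.mono_neutral_right) auto
  also have "\<dots> \<le> (\<Sum>i\<in>?U. h)" using step by (intro sum_mono) fastforce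
  finally have U: "up \<le> card ?U * h" by simp
  have "up + (\<Sum>i<k. f i) = (\<Sum>i<k. f (Suc i mod k)) + (\<Sum>i<k. f i - f (Suc i mod k))"
    unfolding up_def sum.distrib[symmetric] by (rule sum.cong) auto
  then have "up = (\<Sum>i<k. f i - f (Suc i mod k))" using sum_cyclic_shift[OF k, of f] by simp
  also have "\<dots> = (\<Sum>i\<in>?D. f i - f (Suc i mod k))"
    by (rule sum.mono_neutral_right) auto
  also have "\<dots> \<le> (\<Sum>i\<in>?D. mx - mn)"
    using bounds(1,2) n by (intro sum_mono diff_le_mono2 order_trans[OF diff_le_mono diff_le_mono2]) auto
  finally have D: "up \<le> card ?D * (mx - mn)" by simp
  have "card ?U + card ?D = card (?U \<union> ?D)" by (subst card_Un_disjoint) auto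
  also have "\<dots> \<le> card {..<k}" by (rule card_mono) auto
  finally have UD: "card ?U + card ?D \<le> k" by simp
  have "up * (h + (mx - mn)) = up * h + up * (mx - mn)" by (rule distrib_left)
  also have "\<dots> \<le> (card ?D * (mx - mn)) * h + (card ?U * h) * (mx - mn)"
    using U D by (intro add_mono mult_right_mono) auto
  also have "\<dots> = h * (mx - mn) * (card ?U + card ?D)" by (simp add: algebra_simps)
  also have "\<dots> \<le> h * (mx - mn) * k" using UD by (rule mult_le_mono2)
  finally show ?thesis .
qed

text \<open>Double counting: the thresholds crossed by the rise at step \<open>i\<close> are exactly
  those in \<open>{f i<..f (Suc i mod k)}\<close>.\<close>

lemma sum_crossings: "(\<Sum>t\<in>{mn<..mx}. crossings k (\<lambda>i. t \<le> f i)) = up"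
proof -
  have "(\<Sum>t\<in>{mn<..mx}. crossings k (\<lambda>i. t \<le> f i)) =
      (\<Sum>t\<in>{mn<..mx}. card {i \<in> {..<k}. f i < t \<and> t \<le> f (Suc i mod k)})"
    unfolding crossings_def by (intro sum.cong arg_cong[where f = card]) (auto simp: not_le)
  also have "\<dots> = (\<Sum>t\<in>{mn<..mx}. \<Sum>i<k. if f i < t \<and> t \<le> f (Suc i mod k) then 1 else 0)"
    by (simp add: sum.inter_filter[symmetric] card_eq_sum del: sum_constant)
  also have "\<dots> = (\<Sum>i<k. \<Sum>t\<in>{mn<..mx}. if f i < t \<and> t \<le> f (Suc i mod k) then 1 else 0)"
    by (rule sum.swap)
  also have "\<dots> = (\<Sum>i<k. card {t \<in> {mn<..mx}. f i < t \<and> t \<le> f (Suc i mod k)})"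
    by (simp add: sum.inter_filter[symmetric] card_eq_sum del: sum_constant)
  also have "\<dots> = up"
    unfolding up_def
  proof (rule sum.cong[OF refl])
    fix i assume i: "i \<in> {..<k}"
    then have "{t \<in> {mn<..mx}. f i < t \<and> t \<le> f (Suc i mod k)} = {f i<..f (Suc i mod k)}"
      using bounds(1)[of i] bounds(2)[of "Suc i mod k"] k by auto
    then show "card {t \<in> {mn<..mx}. f i < t \<and> t \<le> f (Suc i mod k)} = f (Suc i mod k) - f i" by simp
  qed
  finally show ?thesis .
qed

text \<open>Walking from a minimum of \<open>f\<close> to a maximum has to pass \<open>t\<close>
  upwards.\<close>

lemma crossings_pos:
  assumes "t \<in> {mn<..mx}"
  shows "1 \<le> crossings k (\<lambda>i. t \<le> f i)"
proof -
  have "\<exists>i<k. f i < t \<and> t \<le> f (Suc i mod k)"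
  proof (rule ccontr)
    assume n: "\<not> ?thesis"
    have ne: "f ` {..<k} \<noteq> {}" using k by auto
    obtain i where i: "i < k" "f i = mn" using Min_in[OF _ ne] unfolding mn_def by auto
    obtain j where j: "j < k" "f j = mx" using Max_in[OF _ ne] unfolding mx_def by auto
    have *: "f ((i + m) mod k) < t" for m
    proof (induction m)
      case 0 then show ?case using i assms by simp
    next
      case (Suc m)
      then have "f (Suc ((i + m) mod k) mod k) < t" using n k by (metis mod_less_divisor not_le)
      then show ?case by (simp add: mod_Suc_eq)
    qed
    have "(i + (k - i + j)) mod k = j" using i j by simp
    then show False using *[of "k - i + j"] j assms by simp
  qed
  then have "{i. i < k \<and> \<not> t \<le> f i \<and> t \<le> f (Suc i mod k)} \<noteq> {}" by (auto simp: not_le)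
  then show ?thesis unfolding crossings_def by (simp add: Suc_le_eq card_gt_0_iff)
qed

lemma cost_nonneg:
  assumes "t \<in> {1..b}" shows "0 \<le> cost (\<lambda>i. t \<le> f i)"
  unfolding cost_def
proof (intro sum_nonneg)
  fix i assume "i \<in> {..<k}"
  then have "f i \<le> b" using fb by simp
  then show "0 \<le> (if t \<le> f i then ln (real (b + h) / real (f i)) else ln (real (b + h) / real (b - f i)))"
    using assms by auto
qed

lemma entropy_term: "y \<le> b \<Longrightarrow> real y * ln (real (b + h) / real y) \<le> y * ln (real (b + h) / real b) + real (b - y)"
proof (cases "y = 0")
  case False
  assume "y \<le> b"
  have "real (b + h) / real y = (real (b + h) / real b) * (b / y)" using b by simp
  also have "ln \<dots> = ln (real (b + h) / real b) + ln (b / y)" using b False by (subst ln_mult) auto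
  also have "ln (b / y) \<le> b / y - 1" using b False by (intro ln_le_minus_one) auto
  finally have "real y * ln (real (b + h) / real y) \<le> y * (ln (real (b + h) / real b) + (b / y - 1))" by (intro mult_left_mono) auto
  then show ?thesis using False \<open>y \<le> b\<close> by (simp add: algebra_simps of_nat_diff)
qed simp

text \<open>
  Averaged over the threshold \<open>t\<close>, each edge contributes the binary entropy of \<open>f i / b\<close>.
\<close>

lemma sum_cost_le: "(\<Sum>t\<in>{1..b}. cost (\<lambda>i. t \<le> f i)) \<le> k * (b * (1 + ln (real (b + h) / real b)))"
proof -
  have "(\<Sum>t\<in>{1..b}. cost (\<lambda>i. t \<le> f i)) =
      (\<Sum>i<k. \<Sum>t\<in>{1..b}. if t \<le> f i then ln (real (b + h) / real (f i)) else ln (real (b + h) / real (b - f i)))"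
    unfolding cost_def by (rule sum.swap)
  also have "\<dots> \<le> (\<Sum>i<k. b * (1 + ln (real (b + h) / real b)))"
  proof (rule sum_mono)
    fix i assume "i \<in> {..<k}"
    then have fi: "f i \<le> b" using fb by simp
    have "(\<Sum>t\<in>{1..b}. if t \<le> f i then ln (real (b + h) / real (f i)) else ln (real (b + h) / real (b - f i))) =
        (\<Sum>t\<in>{1..f i}. ln (real (b + h) / real (f i))) + (\<Sum>t\<in>{f i<..b}. ln (real (b + h) / real (b - f i)))"
    proof -
      have "{1..b} \<inter> {t. t \<le> f i} = {1..f i}" "{1..b} \<inter> - {t. t \<le> f i} = {f i<..b}" using fi by auto
      then show ?thesis by (subst sum.If_cases) auto
    qed
    also have "\<dots> = f i * ln (real (b + h) / real (f i)) + real (b - f i) * ln (real (b + h) / real (b - f i))"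
      using fi by (simp add: of_nat_diff)
    also have "\<dots> \<le> (f i * ln (real (b + h) / real b) + real (b - f i)) + (real (b - f i) * ln (real (b + h) / real b) + real (b - (b - f i)))"
      using entropy_term[OF fi] entropy_term[of "b - f i"] by (intro add_mono) simp_all
    also have "\<dots> = b * (1 + ln (real (b + h) / real b))" using fi by (simp add: of_nat_diff algebra_simps)
    finally show "(\<Sum>t\<in>{1..b}. if t \<le> f i then ln (real (b + h) / real (f i)) else ln (real (b + h) / real (b - f i))) \<le>
      b * (1 + ln (real (b + h) / real b))" .
  qed
  finally show ?thesis by simp
qed

text \<open>Here \<open>N\<close> stands for \<open>ln n\<close> and \<open>B\<close> for the
  logarithm of the allowed count. Each free vertex costs \<open>N\<close>; the \<open>max 1\<close>
  charges for the starting vertex, which constant patterns need too.\<close>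

definition good :: "real \<Rightarrow> real \<Rightarrow> bool" where
  "good N B \<longleftrightarrow> (\<exists>P. (\<forall>i<k. (P i \<longrightarrow> 0 < f i) \<and> (\<not> P i \<longrightarrow> f i < b)) \<and>
    real (max 1 (crossings k P)) * N + cost P \<le> B)"

lemma good_threshold:
  fixes N B :: real
  assumes "t \<in> {mn<..mx}" "crossings k (\<lambda>i. t \<le> f i) * N + cost (\<lambda>i. t \<le> f i) \<le> B"
  shows "good N B"
  unfolding good_def
proof (intro exI[of _ "\<lambda>i. t \<le> f i"] conjI allI impI)
  show "real (max 1 (crossings k (\<lambda>i. t \<le> f i))) * N + cost (\<lambda>i. t \<le> f i) \<le> B"
    using crossings_pos[OF assms(1)] assms(2) by (simp add: max_def)
qed (use assms(1) bounds(4) in auto)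

text \<open>\<open>mn\<close> and \<open>b - mx\<close> add up to \<open>b - (mx - mn)\<close>, so
  one of them is at least half of it, and then all forward or all backward steps are cheap. The 5 is
  this half together with \<open>5 / 2\<close>.\<close>

lemma good_constant:
  assumes "mx - mn < b" "real (b + h) / real b \<le> 5 / 2"
  shows "good N (N + k * ln (5 * real b / real (b - (mx - mn))))"
proof -
  define r where "r = b - (mx - mn)"
  have r: "0 < r" using assms(1) by (simp add: r_def)
  have key: "ln (real (b + h) / real y) \<le> ln (5 * real b / real r)" if "r \<le> 2 * y" for y
  proof -
    have "2 * real (b + h) \<le> 5 * b" using assms(2) b by (simp add: field_simps)
    moreover have "real r \<le> 2 * y" using that by linarith
    ultimately have "(2 * real (b + h)) / (2 * real y) \<le> (5 * real b) / real r" using r b by (intro frac_le) auto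
    then have "real (b + h) / real y \<le> 5 * real b / real r"
      by (simp only: mult_divide_mult_cancel_left_if) simp
    moreover have "0 < real (b + h) / real y" using b r that by (simp add: field_simps)
    ultimately show ?thesis by simp
  qed
  have "r \<le> 2 * mn \<or> r \<le> 2 * (b - mx)" using bounds(3,4) unfolding r_def by arith
  then consider "r \<le> 2 * mn" | "r \<le> 2 * (b - mx)" by blast
  then show ?thesis
  proof cases
    case 1
    have "cost (\<lambda>_. True) \<le> (\<Sum>i<k. ln (5 * real b / real r))"
      unfolding cost_def
    proof (rule sum_mono)
      fix i assume "i \<in> {..<k}"
      then have "r \<le> 2 * f i" using bounds(1)[of i] 1 by simp
      from key[OF this] show "(if True then ln (real (b + h) / real (f i)) else ln (real (b + h) / real (b - f i))) \<le>
        ln (5 * real b / real r)" by simp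
    qed
    moreover have "crossings k (\<lambda>_. True) = 0" by (simp add: crossings_def)
    moreover have "0 < f i" if "i < k" for i using bounds(1)[OF that] 1 r by linarith
    ultimately show ?thesis
      unfolding good_def r_def[symmetric] by (intro exI[of _ "\<lambda>_. True"]) auto
  next
    case 2
    have *: "b - mx \<le> b - f i" if "i < k" for i using bounds(2)[OF that] by simp
    have "cost (\<lambda>_. False) \<le> (\<Sum>i<k. ln (5 * real b / real r))"
      unfolding cost_def
    proof (rule sum_mono)
      fix i assume "i \<in> {..<k}"
      then have "r \<le> 2 * (b - f i)" using *[of i] 2 by simp
      from key[OF this] show "(if False then ln (real (b + h) / real (f i)) else ln (real (b + h) / real (b - f i))) \<le>
        ln (5 * real b / real r)" by simp
    qed
    moreover have "crossings k (\<lambda>_. False) = 0" by (simp add: crossings_def)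
    moreover have "f i < b" if "i < k" for i using *[OF that] 2 r by linarith
    ultimately show ?thesis
      unfolding good_def r_def[symmetric] by (intro exI[of _ "\<lambda>_. False"]) auto
  qed
qed

lemma good_mono: "good N B \<Longrightarrow> B \<le> B' \<Longrightarrow> good N B'"
proof -
  assume "good N B" "B \<le> B'"
  then obtain P where P: "\<forall>i<k. (P i \<longrightarrow> 0 < f i) \<and> (\<not> P i \<longrightarrow> f i < b)"
    "real (max 1 (crossings k P)) * N + cost P \<le> B"
    unfolding good_def by blast
  from P(2) \<open>B \<le> B'\<close> have "real (max 1 (crossings k P)) * N + cost P \<le> B'" by (rule order_trans)
  with P(1) show "good N B'" unfolding good_def by blast
qed

text \<open>
  Unless \<open>f\<close> takes values very close to both 0 and \<open>b\<close>, a constant pattern is cheap enough.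
  Otherwise some threshold pattern is: its expected number of crossings is at most
  \<open>up / (mx - mn)\<close>, and when the allowed number of free choices is not well above 1, a
  threshold with a single crossing is used.
\<close>

lemma good_exists:
  fixes N D :: real
  assumes ab: "real (b + h) / real b \<le> 5 / 2" and N: "0 \<le> N" "N \<le> k * D" and hN: "real h * N \<le> real (b + h) * D"
  shows "good N (k * D + 50 * k)"
proof -
  define R where "R = mx - mn"
  have Rb: "R \<le> b" using bounds(4) by (simp add: R_def)
  have "0 \<le> k * D" using N by linarith
  then have D0: "0 \<le> D" using k by (simp add: zero_le_mult_iff)
  have cardT: "card {mn<..mx} = R" by (simp add: R_def)
  have sub: "{mn<..mx} \<subseteq> {1..b}" using bounds(4) by auto
  have ln25: "1 + ln (real (b + h) / real b) \<le> 5 / 2"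
  proof -
    have "ln (real (b + h) / real b) \<le> real (b + h) / real b - 1"
      by (rule ln_le_minus_one) (use b in simp)
    then show ?thesis using ab by linarith
  qed
  have sumc: "(\<Sum>t\<in>T. cost (\<lambda>i. t \<le> f i)) \<le> 5 / 2 * k * b" if "T \<subseteq> {mn<..mx}" for T
  proof -
    have "(\<Sum>t\<in>T. cost (\<lambda>i. t \<le> f i)) \<le> (\<Sum>t\<in>{1..b}. cost (\<lambda>i. t \<le> f i))"
      using that sub cost_nonneg by (intro sum_mono2) auto
    also have "\<dots> \<le> k * (b * (1 + ln (real (b + h) / real b)))" by (rule sum_cost_le)
    also have "\<dots> \<le> k * (b * (5 / 2))" using ln25 by (intro mult_left_mono) auto
    finally show ?thesis by (simp add: mult_ac)
  qed
  have upR: "real up * (h + R) \<le> h * R * k"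
    using up_mult_le by (simp add: R_def flip: of_nat_add of_nat_mult)
  show ?thesis
  proof (cases "10 * R \<le> 9 * b")
    case True
    have Rlt: "R < b" using True b by linarith
    have "5 * real b / real (b - R) \<le> 50" using True Rlt b by (simp add: field_simps of_nat_diff)
    moreover have "0 < 5 * real b / real (b - R)" using Rlt b by simp
    ultimately have "ln (5 * real b / real (b - R)) \<le> 49"
      using ln_le_minus_one by fastforce
    then have "N + k * ln (5 * real b / real (b - R)) \<le> k * D + real k * 49"
      using N by (intro add_mono mult_left_mono) auto
    also have "\<dots> \<le> k * D + 50 * k" by simp
    finally have "N + k * ln (5 * real b / real (b - R)) \<le> k * D + 50 * k" .
    then show ?thesis
      using good_mono[OF good_constant[OF Rlt[unfolded R_def] ab]] unfolding R_def by blast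
  next
    case big: False
    then have big': "9 * real b < 10 * R" by linarith
    have R0: "0 < R" using big by simp
    show ?thesis
    \<comment> \<open>By \<open>hN\<close> the budget \<open>k * D\<close> pays for
      \<open>k * h / (b + h)\<close> free choices. Below 5/4 only the single choice granted by
      \<open>N <= k * D\<close> can be relied on, so a threshold with one crossing is
      sought.\<close>
    proof (cases "4 * (k * h) < 5 * (b + h)")
      case True
      have up54: "4 * up \<le> 5 * b"
      proof (rule ccontr)
        assume "\<not> ?thesis"
        then have "5 * b * (h + R) < 4 * up * (h + R)"
          using R0 by (intro mult_less_mono1) auto
        also have "\<dots> \<le> 4 * (h * R * k)" using up_mult_le by (simp add: R_def)
        also have "\<dots> = R * (4 * (k * h))" by simp
        also have "\<dots> \<le> R * (5 * (b + h))" using True by (intro mult_le_mono2) simp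
        also have "\<dots> = 5 * b * R + 5 * (R * h)" by (simp add: algebra_simps)
        also have "\<dots> \<le> 5 * b * R + 5 * (b * h)" using Rb by (intro add_left_mono mult_le_mono) auto
        finally show False by (simp add: algebra_simps)
      qed
      \<comment> \<open>The \<open>R\<close> crossing numbers are at least 1 and add up to
        \<open>up\<close>, so at least \<open>2 * R - up\<close> of them equal 1. With
        \<open>R > 9/10 b\<close> and \<open>up <= 5/4 b\<close> this is at least
        \<open>b / 2\<close>, enough to average the cost over \<open>G\<close>.\<close>
      define G where "G = {t \<in> {mn<..mx}. crossings k (\<lambda>i. t \<le> f i) = 1}"
      have "(\<Sum>t\<in>{mn<..mx}. 2) \<le> (\<Sum>t\<in>{mn<..mx}. crossings k (\<lambda>i. t \<le> f i) + (if t \<in> G then 1 else 0))"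
      proof (rule sum_mono)
        fix t assume t: "t \<in> {mn<..mx}"
        then show "2 \<le> crossings k (\<lambda>i. t \<le> f i) + (if t \<in> G then 1 else 0)"
          using crossings_pos[OF t] unfolding G_def by (auto simp del: greaterThanAtMost_iff)
      qed
      moreover have "(\<Sum>t\<in>{mn<..mx}. if t \<in> G then 1 else 0) = card G"
        unfolding G_def by (simp add: sum.inter_filter[symmetric] card_eq_sum del: sum_constant)
      ultimately have "2 * R \<le> up + card G"
        by (simp add: sum.distrib sum_crossings R_def)
      then have cG: "real b / 2 \<le> card G" using up54 big' by linarith
      obtain t where t: "t \<in> G" "cost (\<lambda>i. t \<le> f i) \<le> (5 / 2 * k * b) / (real b / 2)"
      proof (rule exists_le_average[of G "real b / 2" "\<lambda>t. cost (\<lambda>i. t \<le> f i)" "5 / 2 * k * b"])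
        show "(\<Sum>t\<in>G. cost (\<lambda>i. t \<le> f i)) \<le> 5 / 2 * k * b" by (rule sumc) (auto simp: G_def)
        show "0 \<le> cost (\<lambda>i. t \<le> f i)" if "t \<in> G" for t
          using that sub by (intro cost_nonneg) (auto simp: G_def)
      qed (use b cG in \<open>auto simp: G_def\<close>)
      have "cost (\<lambda>i. t \<le> f i) \<le> 5 * k" using t(2) b by simp
      then show ?thesis
        using t(1) N by (intro good_threshold[of t]) (auto simp: G_def)
    next
      case False
      then have "5 * real (b + h) \<le> 4 * (k * h)" by linarith
      then have "5 * real (b + h) * N \<le> 4 * (k * h) * N" using N by (intro mult_right_mono) auto
      also have "\<dots> = 4 * k * (h * N)" by simp
      also have "\<dots> \<le> 4 * k * (real (b + h) * D)" using hN by (intro mult_left_mono) auto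
      finally have "real (b + h) * (5 * N) \<le> real (b + h) * (4 * (k * D))" by (simp add: algebra_simps)
      then have N45: "5 * N \<le> 4 * (k * D)" using b by (simp add: mult_le_cancel_left)
      \<comment> \<open>The part of \<open>0..b\<close> that the range of \<open>f\<close> misses. A
        constant pattern costs \<open>N + k * ln (5 / \<rho>)\<close> at most, and by
        \<open>N45\<close> the slack \<open>k * D - N\<close> is at least \<open>k * D / 5\<close>.
        If this is too little, \<open>\<rho> * D\<close> is bounded, and so is the excess per step
        of the average threshold over \<open>D\<close>.\<close>
      define \<rho> where "\<rho> = 1 - real R / b"
      have \<rho>: "0 \<le> \<rho>" "\<rho> \<le> 1 / 10" using Rb big' b by (auto simp: \<rho>_def field_simps)
      show ?thesis
      proof (cases "0 < \<rho> \<and> 10 * ln (2 / \<rho>) \<le> D")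
        case True
        have Rlt: "R < b" using True b by (simp add: \<rho>_def)
        have "5 * real b / real (b - R) = (5 / 2) * (2 / \<rho>)" using b Rlt by (simp add: \<rho>_def field_simps of_nat_diff)
        also have "ln \<dots> = ln (5 / 2) + ln (2 / \<rho>)" using True by (subst ln_mult) auto
        also have "\<dots> \<le> 3 / 2 + D / 10" using True ln_le_minus_one[of "5 / 2"] by simp
        finally have "N + k * ln (5 * real b / real (b - R)) \<le> 4 / 5 * (k * D) + k * (3 / 2 + D / 10)"
          using N45 by (intro add_mono mult_left_mono) auto
        also have "\<dots> = 9 / 10 * (k * D) + 3 / 2 * k" by (simp add: algebra_simps)
        also have "\<dots> \<le> k * D + 50 * k" using D0 by (intro add_mono) auto
        finally have "N + k * ln (5 * real b / real (b - R)) \<le> k * D + 50 * k" .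
        then show ?thesis
          using good_mono[OF good_constant[OF Rlt[unfolded R_def] ab]] unfolding R_def by blast
      next
        case F: False
        have \<rho>D: "\<rho> * D \<le> 20"
        proof (cases "\<rho> = 0")
          case False
          then have \<rho>0: "0 < \<rho>" using \<rho> by simp
          then have "D \<le> 10 * ln (2 / \<rho>)" using F by simp
          also have "\<dots> \<le> 10 * (2 / \<rho> - 1)" using \<rho>0 by (intro mult_left_mono ln_le_minus_one) auto
          finally have "\<rho> * D \<le> \<rho> * (10 * (2 / \<rho> - 1))" using \<rho>0 by (intro mult_left_mono) auto
          also have "\<dots> = 20 - 10 * \<rho>" using \<rho>0 by (simp add: field_simps)
          finally show ?thesis using \<rho> by simp
        qed simp
        have g0: "0 \<le> crossings k (\<lambda>i. t \<le> f i) * N + cost (\<lambda>i. t \<le> f i)" if "t \<in> {mn<..mx}" for t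
          using that sub N by (intro add_nonneg_nonneg mult_nonneg_nonneg cost_nonneg) auto
        have "(\<Sum>t\<in>{mn<..mx}. crossings k (\<lambda>i. t \<le> f i) * N + cost (\<lambda>i. t \<le> f i)) \<le> up * N + 5 / 2 * k * b"
          using sumc[OF order_refl]
          by (simp add: sum.distrib flip: sum_distrib_right of_nat_sum sum_crossings)
        then obtain t where t: "t \<in> {mn<..mx}"
          "crossings k (\<lambda>i. t \<le> f i) * N + cost (\<lambda>i. t \<le> f i) \<le> (up * N + 5 / 2 * k * b) / R"
          using R0 cardT g0 by (elim exists_le_average[rotated 4, of _ _ _ "real R"]) auto
        have hR: "0 < real (h + R)" using R0 by simp
        have "up * N * (h + R) = (real up * (h + R)) * N" by simp
        also have "\<dots> \<le> (h * R * k) * N" using upR N by (intro mult_right_mono) auto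
        also have "\<dots> = R * k * (h * N)" by simp
        also have "\<dots> \<le> R * k * (real (b + h) * D)" using hN by (intro mult_left_mono) auto
        finally have "up * N \<le> R * k * (real (b + h) * D) / (h + R)" using hR by (simp add: field_simps)
        then have "up * N / R \<le> k * (real (b + h) * D) / (h + R)" using R0 by (simp add: field_simps)
        also have "\<dots> = k * (D + real (b - R) * D / real (h + R))"
        proof -
          have "real (b + h) * D / real (h + R) = D + real (b - R) * D / real (h + R)"
            using hR Rb by (simp add: field_simps of_nat_diff)
          then show ?thesis by (simp only: times_divide_eq_right[symmetric])
        qed
        also have "\<dots> \<le> k * (D + 30)"
        proof -
          have rb: "real (b - R) = \<rho> * b" using b Rb by (simp add: \<rho>_def field_simps of_nat_diff)
          have "real (b - R) * D / real (h + R) \<le> real (b - R) * D / R"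
            using R0 D0 by (intro divide_left_mono) auto
          also have "\<dots> = (\<rho> * D) * (b / R)" unfolding rb by simp
          also have "\<dots> \<le> 20 * (10 / 9)" using \<rho>D \<rho> D0 big' R0 by (intro mult_mono) (auto simp: field_simps)
          also have "20 * (10 / 9) \<le> (30::real)" by simp
          finally have "real (b - R) * D / real (h + R) \<le> 30" .
          then show ?thesis by (intro mult_left_mono add_left_mono) auto
        qed
        finally have 1: "up * N / R \<le> k * (D + 30)" .
        have "real b / R \<le> 10 / 9" using big' R0 by (simp add: field_simps)
        then have "5 / 2 * k * (b / R) \<le> 5 / 2 * k * (10 / 9)" by (intro mult_left_mono) auto
        then have 2: "5 / 2 * k * b / R \<le> 3 * k" by simp
        have "(up * N + 5 / 2 * k * b) / R \<le> k * (D + 30) + 3 * k"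
          using 1 2 by (simp add: add_divide_distrib)
        also have "\<dots> \<le> k * D + 50 * k" by (simp add: algebra_simps)
        finally show ?thesis using t by (intro good_threshold[of t]) auto
      qed
    qed
  qed
qed

end

section \<open>From cheap patterns to the number of cycles\<close>

text \<open>The leading \<open>False\<close> stands for the free start. If the walk starts where a
  backward run begins, that run absorbs the start, and the omitted closing step is forward, so
  opening the cycle cuts no run. Without such a place the pattern is constant.\<close>

lemma back_runs_rotate:
  assumes k: "3 \<le> k"
  shows "\<exists>j<k. back_runs (False # map (\<lambda>i. P ((i + j) mod k)) [0..<k - 1]) \<le> max 1 (crossings k P)"
proof (cases "\<exists>i<k. P i \<and> \<not> P (Suc i mod k)")
  case True
  then obtain i where i: "i < k" "P i" "\<not> P (Suc i mod k)" by blast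
  define j where "j = Suc i mod k"
  define Q where "Q = (\<lambda>i. P ((i + j) mod k))"
  define l where "l = k - 1"
  have l: "k = Suc l" "0 < l" using k by (auto simp: l_def)
  have j: "j < k" using k by (simp add: j_def)
  have "(l + j) mod k = (l + Suc i) mod k" unfolding j_def by (simp add: mod_add_right_eq)
  also have "l + Suc i = i + k" using l by simp
  finally have "(l + j) mod k = i" using i by simp
  then have Ql: "Q l" using i by (simp add: Q_def)
  have Q0: "\<not> Q 0" using i j by (simp add: Q_def j_def)
  have "hd (map Q [0..<l]) = Q 0" using l by (simp add: hd_map)
  then have "back_runs (False # map Q [0..<l]) = back_runs (map Q [0..<l])" using Q0 l by simp
  also have "\<dots> = card {m \<in> {0..<l}. \<not> Q m \<and> (Suc m = l \<or> Q (Suc m))}"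
    using back_runs_map[of Q 0 l] by simp
  also have "\<dots> \<le> card {m. m < k \<and> \<not> P m \<and> P (Suc m mod k)}"
  proof (rule card_inj_on_le[where f = "\<lambda>m. (m + j) mod k"])
    show "inj_on (\<lambda>m. (m + j) mod k) {m \<in> {0..<l}. \<not> Q m \<and> (Suc m = l \<or> Q (Suc m))}"
      by (rule inj_on_subset[OF bij_betw_imp_inj_on[OF bij_rotate[of k j]]]) (use l in auto)
    show "(\<lambda>m. (m + j) mod k) ` {m \<in> {0..<l}. \<not> Q m \<and> (Suc m = l \<or> Q (Suc m))}
      \<subseteq> {m. m < k \<and> \<not> P m \<and> P (Suc m mod k)}"
    proof
      fix y assume "y \<in> (\<lambda>m. (m + j) mod k) ` {m \<in> {0..<l}. \<not> Q m \<and> (Suc m = l \<or> Q (Suc m))}"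
      then obtain m where m: "y = (m + j) mod k" "\<not> Q m" "Q (Suc m)" using Ql by auto
      have "P (Suc y mod k)" using m(3) unfolding m(1) Q_def by (simp add: mod_Suc_eq)
      then show "y \<in> {m. m < k \<and> \<not> P m \<and> P (Suc m mod k)}" using m k by (simp add: Q_def)
    qed
  qed simp
  also have "\<dots> \<le> max 1 (crossings k P)" by (simp add: crossings_def)
  finally show ?thesis using j unfolding Q_def l_def by blast
next
  case False
  have all: "P m" if "i < k" "P i" "m < k" for i m
  proof -
    have *: "P ((i + t) mod k)" for t
    proof (induction t)
      case (Suc t)
      have "(i + t) mod k < k" using k by simp
      then have "P (Suc ((i + t) mod k) mod k)" using Suc False by blast
      then show ?case by (simp add: mod_Suc_eq)
    qed (use that in simp)
    have "(i + (k - i + m)) mod k = m" using that by simp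
    then show ?thesis using *[of "k - i + m"] by simp
  qed
  define l where "l = k - 1"
  have l: "k = Suc l" "0 < l" using k by (auto simp: l_def)
  have m: "map (\<lambda>i. P ((i + 0) mod k)) [0..<l] = map P [0..<l]" using l by (intro map_cong) auto
  have hd: "hd (map P [0..<l]) = P 0" using l by (simp add: hd_map)
  have "back_runs (False # map P [0..<l]) \<le> 1"
  proof (cases "P 0")
    case True
    then have "P i" if "i < k" for i using all[of 0 i] that l by simp
    then have "{i \<in> {0..<l}. \<not> P i \<and> (Suc i = l \<or> P (Suc i))} = {}" using l by auto
    then show ?thesis using back_runs_map[of P 0 l] True hd l by simp
  next
    case F: False
    then have "\<not> P i" if "i < k" for i using all[of i 0] that l by auto
    then have "{i \<in> {0..<l}. \<not> P i \<and> (Suc i = l \<or> P (Suc i))} \<subseteq> {l - 1}" using l by auto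
    then have "card {i \<in> {0..<l}. \<not> P i \<and> (Suc i = l \<or> P (Suc i))} \<le> card {l - 1}" by (intro card_mono) auto
    then show ?thesis using back_runs_map[of P 0 l] F hd l by simp
  qed
  then have "back_runs (False # map (\<lambda>i. P ((i + 0) mod k)) [0..<l]) \<le> max 1 (crossings k P)"
    unfolding m by (rule order_trans) simp
  then show ?thesis using k unfolding l_def by (intro exI[of _ 0]) simp
qed

text \<open>There are \<open>k\<close> starting points and \<open>2 ^ (k - 1)\<close> patterns, and
  each pattern admits at most \<open>T\<close> walks of sufficient weight.\<close>

lemma card_embeddings_cycle_le:
  fixes T :: real
  assumes H: "simple_graph H" "verts H \<subseteq> {..<n}" and k: "3 \<le> k" and T: "0 < T"
    and w: "\<And>x y. 0 \<le> w x y" "\<And>x. x \<in> verts H \<Longrightarrow> (\<Sum>y\<in>verts H. w x y) \<le> 1"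
    and good: "\<And>x. x \<in> embeddings H (cycle_graph k) \<Longrightarrow> \<exists>P. real n ^ max 1 (crossings k P) \<le>
      T * (\<Prod>i<k. if P i then w (x i) (x (Suc i mod k)) else w (x (Suc i mod k)) (x i))"
  shows "real (card (embeddings H (cycle_graph k))) \<le> real k * 2 ^ (k - 1) * T"
proof (cases "n = 0")
  case True
  have "x 0 \<in> verts H" if "x \<in> embeddings H (cycle_graph k)" for x
    using that k by (auto simp: embeddings_cycle)
  then have "embeddings H (cycle_graph k) = {}" using H(2) True by auto
  then show ?thesis using T by simp
next
  case False
  then have n: "1 \<le> real n" by simp
  let ?F = "cycle_graph k" and ?V = "verts H"
  define l where "l = k - 1"
  have kl: "k = Suc l" using k by (simp add: l_def)
  have finV: "finite ?V" using H(1) by (simp add: simple_graph_def)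
  have cV: "card ?V \<le> n" using card_mono[OF _ H(2)] by simp
  have w1: "w x y \<le> 1" if "x \<in> ?V" "y \<in> ?V" for x y
    using member_le_sum[of y ?V "w x"] w finV that by (meson order_trans DiffD1)
  \<comment> \<open>The weight demanded is \<open>n ^ back_runs (False # p) / T\<close>, while all
    walks of pattern \<open>p\<close> weigh at most \<open>n ^ back_runs (False # p)\<close>
    together.\<close>
  define X where "X = (\<lambda>p. {(u, ys). u \<in> ?V \<and> set ys \<subseteq> ?V \<and> length ys = length p \<and>
    real n ^ back_runs (False # p) \<le> T * walk_weight w p u ys})"
  define Ps where "Ps = {p :: bool list. set p \<subseteq> UNIV \<and> length p = l}"
  have Ps: "finite Ps" "card Ps = 2 ^ l"
    unfolding Ps_def by (simp_all only: finite_lists_length_eq card_lists_length_eq finite card_UNIV_bool)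
  have XV: "X p \<subseteq> ?V \<times> {ys. set ys \<subseteq> ?V \<and> length ys = length p}" for p by (auto simp: X_def)
  have finX: "finite (X p)" for p
    by (rule finite_subset[OF XV]) (use finV in \<open>simp add: finite_lists_length_eq\<close>)
  have cX: "real (card (X p)) \<le> T" for p
  proof -
    let ?r = "back_runs (False # p)"
    have nr: "0 < real n ^ ?r" using n by (intro zero_less_power) simp
    have "card (X p) * (real n ^ ?r / T) \<le> real (card ?V) ^ ?r"
    proof (rule card_walks_le[OF finV w XV])
      fix u ys assume "(u, ys) \<in> X p"
      then show "real n ^ ?r / T \<le> walk_weight w p u ys"
        using T by (simp add: X_def pos_divide_le_eq mult.commute del: back_runs.simps)
    qed
    also have "\<dots> \<le> real n ^ ?r" using cV by (intro power_mono) auto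
    finally have "card (X p) * real n ^ ?r \<le> T * real n ^ ?r"
      using T by (simp add: field_simps del: back_runs.simps)
    then show ?thesis using nr by (rule mult_right_le_imp_le)
  qed
  define Y where "Y = \<Union>(X ` Ps)"
  have finY: "finite Y" using Ps finX by (simp add: Y_def)
  have "real (card Y) \<le> (\<Sum>p\<in>Ps. real (card (X p)))"
    unfolding Y_def using card_UN_le[OF Ps(1), of X] by (simp flip: of_nat_sum)
  also have "\<dots> \<le> (\<Sum>p\<in>Ps. T)" by (intro sum_mono cX)
  also have "\<dots> = 2 ^ l * T" by (simp add: Ps)
  finally have cY: "real (card Y) \<le> 2 ^ l * T" .
  \<comment> \<open>Undoes the rotation by \<open>j\<close>; the shift \<open>k - j\<close> replaces
    \<open>- j\<close> on natural numbers.\<close>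
  define g :: "nat \<times> nat \<times> nat list \<Rightarrow> nat \<Rightarrow> nat" where "g = (\<lambda>(j, u, ys). restrict (\<lambda>i. (u # ys) ! ((i + (k - j)) mod k)) {..<k})"
  have "embeddings H ?F \<subseteq> g ` ({..<k} \<times> Y)"
  proof
    fix x assume x: "x \<in> embeddings H ?F"
    obtain P where P: "real n ^ max 1 (crossings k P) \<le>
      T * (\<Prod>i<k. if P i then w (x i) (x (Suc i mod k)) else w (x (Suc i mod k)) (x i))"
      using good[OF x] by blast
    obtain j where j: "j < k" "back_runs (False # map (\<lambda>i. P ((i + j) mod k)) [0..<l]) \<le> max 1 (crossings k P)"
      using back_runs_rotate[OF k, of P] unfolding l_def by blast
    define Q where "Q = (\<lambda>i. P ((i + j) mod k))"
    define y where "y = (\<lambda>i. x ((i + j) mod k))"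
    have xV: "x i \<in> ?V" if "i < k" for i using x that by (auto simp: embeddings_cycle)
    have yV: "y i \<in> ?V" for i using xV k by (simp add: y_def)
    let ?f = "\<lambda>i. if Q i then w (y i) (y (Suc i)) else w (y (Suc i)) (y i)"
    have f01: "0 \<le> ?f i" "?f i \<le> 1" for i using w(1) w1 yV by auto
    have "(\<Prod>i<k. if P i then w (x i) (x (Suc i mod k)) else w (x (Suc i mod k)) (x i)) = (\<Prod>i<k. ?f i)"
    proof -
      have suc: "Suc ((i + j) mod k) mod k = (Suc i + j) mod k" for i by (simp add: mod_Suc_eq)
      have "0 < k" using k by simp
      from prod.reindex_bij_betw[OF bij_rotate[OF this, of j],
        of "\<lambda>i. if P i then w (x i) (x (Suc i mod k)) else w (x (Suc i mod k)) (x i)", symmetric]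
      show ?thesis unfolding Q_def y_def suc .
    qed
    also have "\<dots> = (\<Prod>i<l. ?f i) * ?f l" by (simp add: kl)
    \<comment> \<open>The open walk omits the closing step, whose weight is at most 1.\<close>
    also have "\<dots> \<le> (\<Prod>i<l. ?f i) * 1" using f01 by (intro mult_left_mono prod_nonneg) auto
    also have "\<dots> = walk_weight w (map Q [0..<l]) (y 0) (map y [1..<k])"
      using walk_weight_map[of w Q 0 l y] by (simp add: kl lessThan_atLeast0 del: upt_Suc)
    finally have W: "(\<Prod>i<k. if P i then w (x i) (x (Suc i mod k)) else w (x (Suc i mod k)) (x i)) \<le>
      walk_weight w (map Q [0..<l]) (y 0) (map y [1..<k])" .
    have "real n ^ back_runs (False # map Q [0..<l]) \<le> real n ^ max 1 (crossings k P)"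
      using j(2) n unfolding Q_def by (rule power_increasing)
    also have "\<dots> \<le> T * walk_weight w (map Q [0..<l]) (y 0) (map y [1..<k])"
      using P W T by (meson mult_left_mono order_trans less_imp_le)
    finally have "(y 0, map y [1..<k]) \<in> X (map Q [0..<l])"
      using yV by (auto simp: X_def kl simp del: back_runs.simps upt_Suc)
    then have inY: "(y 0, map y [1..<k]) \<in> Y"
      unfolding Y_def by (intro UN_I[of "map Q [0..<l]"]) (simp_all add: Ps_def)
    have "y 0 # map y [1..<k] = map y [0..<k]" using k by (simp add: upt_conv_Cons)
    then have nth: "(y 0 # map y [1..<k]) ! i = y i" if "i < k" for i using that by simp
    have "x = g (j, y 0, map y [1..<k])"
    proof (rule extensionalityI[of _ "{..<k}"])
      show "x \<in> extensional {..<k}" using x by (auto simp: embeddings_def PiE_def)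
      show "g (j, y 0, map y [1..<k]) \<in> extensional {..<k}" by (simp add: g_def)
      fix i assume i: "i \<in> {..<k}"
      have "y ((i + (k - j)) mod k) = x ((i + (k - j) + j) mod k)" by (simp add: y_def mod_add_left_eq)
      also have "i + (k - j) + j = i + k" using j by simp
      finally show "x i = g (j, y 0, map y [1..<k]) i" using i nth k by (simp add: g_def)
    qed
    then show "x \<in> g ` ({..<k} \<times> Y)" using inY j by blast
  qed
  then have "card (embeddings H ?F) \<le> card (g ` ({..<k} \<times> Y))" using finY by (intro card_mono) auto
  also have "\<dots> \<le> card ({..<k} \<times> Y)" using finY by (intro card_image_le) auto
  also have "\<dots> = k * card Y" by (simp add: card_cartesian_product)
  finally have "real (card (embeddings H ?F)) \<le> real k * real (card Y)" by (simp flip: of_nat_mult)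
  also have "\<dots> \<le> real k * (2 ^ l * T)" using cY by (intro mult_left_mono) auto
  finally show ?thesis by (simp add: l_def mult_ac)
qed

lemma (in cyclic_profile) good_weights:
  assumes "good (ln n) B" "0 < n"
  shows "\<exists>P. real n ^ max 1 (crossings k P) \<le>
    exp B * (\<Prod>i<k. if P i then real (f i) / real (b + h) else real (b - f i) / real (b + h))"
proof -
  obtain P where P: "\<forall>i<k. (P i \<longrightarrow> 0 < f i) \<and> (\<not> P i \<longrightarrow> f i < b)"
    "real (max 1 (crossings k P)) * ln n + cost P \<le> B"
    using assms(1) unfolding good_def by blast
  have "exp (- cost P) = (\<Prod>i<k. exp (- (if P i then ln (real (b + h) / real (f i)) else ln (real (b + h) / real (b - f i)))))"
    unfolding cost_def by (simp only: sum_negf[symmetric] exp_sum finite_lessThan)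
  also have "\<dots> = (\<Prod>i<k. if P i then real (f i) / real (b + h) else real (b - f i) / real (b + h))"
  proof (rule prod.cong[OF refl])
    fix i assume "i \<in> {..<k}"
    then have "(P i \<longrightarrow> 0 < f i) \<and> (\<not> P i \<longrightarrow> f i < b)" using P(1) by blast
    then show "exp (- (if P i then ln (real (b + h) / real (f i)) else ln (real (b + h) / real (b - f i)))) =
      (if P i then real (f i) / real (b + h) else real (b - f i) / real (b + h))"
      using b by (auto simp: exp_minus inverse_eq_divide)
  qed
  finally have c: "exp (- cost P) = (\<Prod>i<k. if P i then real (f i) / real (b + h) else real (b - f i) / real (b + h))" .
  have "real n ^ max 1 (crossings k P) = exp (real (max 1 (crossings k P)) * ln n)"
    using assms(2) by (simp only: exp_of_nat_mult) simp
  also have "\<dots> \<le> exp (B + - cost P)" using P(2) by simp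
  also have "\<dots> = exp B * exp (- cost P)" by (rule exp_add)
  finally show ?thesis unfolding c by blast
qed

lemma crossings_le_half:
  assumes "0 < k" shows "2 * crossings k P \<le> k"
proof -
  let ?A = "{i. i < k \<and> \<not> P i \<and> P (Suc i mod k)}" and ?B = "{i. i < k \<and> P i}"
  have "inj_on (\<lambda>i. (i + 1) mod k) ?A"
    by (rule inj_on_subset[OF bij_betw_imp_inj_on[OF bij_rotate[OF assms, of 1]]]) auto
  then have "card ?A \<le> card ?B" by (rule card_inj_on_le) (use assms in auto)
  moreover have "card ?A + card ?B = card (?A \<union> ?B)" by (subst card_Un_disjoint) auto
  moreover have "card (?A \<union> ?B) \<le> card {..<k}" by (intro card_mono) auto
  ultimately show ?thesis by (simp add: crossings_def)
qed

lemma (in cyclic_profile) good_half: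
  fixes N :: real
  assumes k3: "3 \<le> k" and N: "0 < N" "real (b + h) \<le> b * N"
  shows "good N (k * (3 / 5 * N + 19))"
  unfolding good_def
proof (intro exI[of _ "\<lambda>i. b \<le> 2 * f i"] conjI allI impI)
  let ?P = "\<lambda>i. b \<le> 2 * f i"
  have key: "ln (real (b + h) / real y) \<le> N / 10 + 19" if "b \<le> 2 * y" for y
  proof -
    have y: "0 < y" using that b by simp
    have "real (b + h) / real y \<le> 2 * N"
    proof -
      have "real b * N \<le> (2 * y) * N" using that N by (intro mult_right_mono) auto
      then show ?thesis using N(2) y by (simp add: field_simps)
    qed
    then have "ln (real (b + h) / real y) \<le> ln (2 * N)" using b y N by (subst ln_le_cancel_iff) auto
    also have "2 * N = 20 * (N / 10)" by simp
    also have "ln (20 * (N / 10)) = ln 20 + ln (N / 10)" using N by (subst ln_mult) auto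
    also have "\<dots> \<le> (20 - 1) + (N / 10 - 1)" using N by (intro add_mono ln_le_minus_one) auto
    finally show ?thesis by simp
  qed
  have "cost ?P \<le> (\<Sum>i<k. N / 10 + 19)"
    unfolding cost_def
  proof (rule sum_mono)
    fix i assume "i \<in> {..<k}"
    then have "b \<le> 2 * (b - f i)" if "\<not> b \<le> 2 * f i" using that fb[of i] by simp
    then show "(if b \<le> 2 * f i then ln (real (b + h) / real (f i)) else ln (real (b + h) / real (b - f i))) \<le> N / 10 + 19"
      using key[of "f i"] key[of "b - f i"] by auto
  qed
  moreover have "real (max 1 (crossings k ?P)) \<le> k / 2"
    using crossings_le_half[OF k, of ?P] k3 by auto
  then have "real (max 1 (crossings k ?P)) * N \<le> k / 2 * N" using N by (intro mult_right_mono) auto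
  ultimately show "real (max 1 (crossings k ?P)) * N + cost ?P \<le> k * (3 / 5 * N + 19)"
    by (simp add: algebra_simps)
qed (use b in auto)

text \<open>The cross-multiplied form keeps numerator and denominator of the maximal density as
  natural numbers, to serve as the slots per vertex and the tokens per edge.\<close>

lemma exists_densest:
  assumes "finite V" "V \<noteq> {}" "\<And>e. e \<in> E \<Longrightarrow> card e = 2"
  obtains W where "W \<subseteq> V" "W \<noteq> {}"
    "\<And>S. S \<subseteq> V \<Longrightarrow> card W * card {e \<in> E. e \<subseteq> S} \<le> card {e \<in> E. e \<subseteq> W} * card S"
proof -
  define A where "A = {S. S \<subseteq> V \<and> S \<noteq> {}}"
  define r where "r = (\<lambda>S. real (card {e \<in> E. e \<subseteq> S}) / card S)"
  have A: "finite (r ` A)" "r ` A \<noteq> {}" using assms by (auto simp: A_def)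
  obtain W where W: "W \<in> A" "r W = Max (r ` A)" using Max_in[OF A] by auto
  have pos: "0 < card S" if "S \<in> A" for S
    using that assms(1) by (auto simp: A_def card_gt_0_iff finite_subset)
  show thesis
  proof (rule that[of W])
    fix S assume S: "S \<subseteq> V"
    show "card W * card {e \<in> E. e \<subseteq> S} \<le> card {e \<in> E. e \<subseteq> W} * card S"
    proof (cases "S = {}")
      case True
      have "{e \<in> E. e \<subseteq> {}} = {}" using assms(3)[of "{}"] by auto
      then show ?thesis using True by simp
    next
      case False
      then have SA: "S \<in> A" using S by (simp add: A_def)
      then have "r S \<le> r W" using A(1) by (simp add: W(2))
      then have "real (card {e \<in> E. e \<subseteq> S}) * card W \<le> real (card {e \<in> E. e \<subseteq> W}) * card S"
        using pos[OF SA] pos[OF W(1)] by (simp add: r_def field_simps)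
      then have "card {e \<in> E. e \<subseteq> S} * card W \<le> card {e \<in> E. e \<subseteq> W} * card S"
        by (simp only: of_nat_mult[symmetric] of_nat_le_iff)
      then show ?thesis by (simp add: mult.commute)
    qed
  qed (use W in \<open>auto simp: A_def\<close>)
qed

text \<open>The weights are token counts divided by \<open>a\<close>. The exponential is the budget
  \<open>(n * q) ^ k\<close> times the loss \<open>exp 50 ^ k\<close>.\<close>

lemma cycle_embedding_weights:
  assumes sp: "q_sparse n q H" and H: "subgraph H (clique_graph n)" and q: "0 < q"
    and k: "3 \<le> k" "k \<le> n" and \<eta>: "1 < real n ^ (k - 1) * q ^ k" and q1: "ln q \<le> - 1"
    and ne: "embeddings H (cycle_graph k) \<noteq> {}"
  obtains w where "\<And>x y. 0 \<le> w x y" "\<And>x. x \<in> verts H \<Longrightarrow> (\<Sum>y\<in>verts H. w x y) \<le> 1"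
    "\<And>x. x \<in> embeddings H (cycle_graph k) \<Longrightarrow> \<exists>P. real n ^ max 1 (crossings k P) \<le>
      exp (real k * ln (real n * q) + 50 * real k) * (\<Prod>i<k. if P i then w (x i) (x (Suc i mod k)) else w (x (Suc i mod k)) (x i))"
proof -
  let ?V = "verts H" and ?E = "edges H" and ?F = "cycle_graph k"
  have sH: "simple_graph H" and finV: "finite ?V"
    using H by (simp_all add: subgraph_def simple_graph_def)
  have E2: "e \<subseteq> ?V \<and> card e = 2" if "e \<in> ?E" for e using sH that unfolding simple_graph_def by blast
  have n0: "0 < n" "1 < real n" using k by auto
  have k3: "3 \<le> k" by (rule k(1))
  define N where "N = ln (real n)"
  have N0: "0 < N" using n0 by (simp add: N_def)
  have D: "ln (n * q) = N + ln q" using n0 q by (simp add: ln_mult N_def)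
  have ND: "N \<le> k * (N + ln q)"
  proof -
    have "0 < ln (real n ^ (k - 1) * q ^ k)" using \<eta> by simp
    also have "\<dots> = real (k - 1) * N + k * ln q" using n0 q by (simp add: ln_mult ln_realpow N_def)
    also have "real (k - 1) = real k - 1" using k by (simp add: of_nat_diff)
    finally show ?thesis by (simp add: algebra_simps)
  qed
  obtain x0 where x0: "x0 \<in> embeddings H ?F" using ne by blast
  have x0V: "x0 ` {..<k} \<subseteq> ?V" and x0i: "inj_on x0 {..<k}" using x0 by (auto simp: embeddings_def)
  have "0 \<in> {..<k}" using k by simp
  then have V0: "?V \<noteq> {}" using x0V by blast
  obtain W where W: "W \<subseteq> ?V" "W \<noteq> {}"
    "\<And>S. S \<subseteq> ?V \<Longrightarrow> card W * card {e \<in> ?E. e \<subseteq> S} \<le> card {e \<in> ?E. e \<subseteq> W} * card S"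
    using exists_densest[OF finV V0, of ?E] E2 by blast
  define b where "b = card W"
  define a where "a = card {e \<in> ?E. e \<subseteq> W}"
  have b: "0 < b" using W(1,2) finV by (auto simp: b_def card_gt_0_iff finite_subset)
  have dens: "b * card {e \<in> ?E. e \<subseteq> S} \<le> a * card S" if "S \<subseteq> ?V" for S
    using W(3)[OF that] by (simp add: a_def b_def)
  \<comment> \<open>The cycle \<open>x0\<close> has density at least 1, so the densest set does too,
    and \<open>h = a - b\<close> is a genuine difference.\<close>
  have ba: "b \<le> a"
  proof -
    let ?S = "x0 ` {..<k}"
    have cS: "card ?S = k" using x0i by (simp add: card_image)
    have sub: "(\<lambda>e. x0 ` e) ` edges ?F \<subseteq> {e \<in> ?E. e \<subseteq> ?S}"
    proof
      fix e assume "e \<in> (\<lambda>e. x0 ` e) ` edges ?F"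
      then obtain e' where e': "e' \<in> edges ?F" "e = x0 ` e'" by blast
      have "e' \<subseteq> {..<k}" using e'(1) simple_graph_cycle[OF k(1)] unfolding simple_graph_def verts_cycle by blast
      then show "e \<in> {e \<in> ?E. e \<subseteq> ?S}" using e' x0 by (auto simp: embeddings_def)
    qed
    have "\<Union>(edges ?F) \<subseteq> {..<k}" using simple_graph_cycle[OF k(1)] unfolding simple_graph_def verts_cycle by blast
    then have "inj_on (\<lambda>e. x0 ` e) (edges ?F)" by (intro inj_on_image inj_on_subset[OF x0i])
    then have "k = card ((\<lambda>e. x0 ` e) ` edges ?F)" by (simp add: card_image card_edges_cycle[OF k(1)])
    also have "\<dots> \<le> card {e \<in> ?E. e \<subseteq> ?S}" using finite_edges[OF sH] by (intro card_mono sub) auto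
    finally have "b * k \<le> b * card {e \<in> ?E. e \<subseteq> ?S}" by (rule mult_le_mono2)
    also have "\<dots> \<le> a * k" using dens[OF x0V] cS by simp
    finally show ?thesis using k by simp
  qed
  define h where "h = a - b"
  have abh: "a = b + h" using ba by (simp add: h_def)
  have a0: "0 < a" using b ba by simp
  have nq: "0 \<le> b * N + a * ln q"
  proof -
    have "1 \<le> real n ^ b * q ^ a"
      unfolding a_def b_def by (rule q_sparse_induced[OF sp H q W(1)]) auto
    then have "0 \<le> ln (real n ^ b * q ^ a)" by simp
    also have "\<dots> = b * N + a * ln q" using n0 q by (simp add: ln_mult ln_realpow N_def)
    finally show ?thesis .
  qed
  obtain \<alpha> where \<alpha>: "\<And>u v. {u, v} \<in> ?E \<Longrightarrow> \<alpha> u v + \<alpha> v u = b"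
    "\<And>u. u \<in> ?V \<Longrightarrow> (\<Sum>v | {u, v} \<in> ?E. \<alpha> u v) \<le> a"
    using fractional_orientation[OF finV E2 dens] by blast
  have nb: "{v. {u, v} \<in> ?E} \<subseteq> ?V" for u using E2 by blast
  define w where "w = (\<lambda>u v. if {u, v} \<in> ?E then real (\<alpha> u v) / a else 0)"
  show thesis
  proof (rule that[of w])
    show "0 \<le> w x y" for x y by (simp add: w_def)
    fix x assume x: "x \<in> ?V"
    have "(\<Sum>y\<in>?V. w x y) = (\<Sum>y | {x, y} \<in> ?E. real (\<alpha> x y) / a)"
    proof -
      have "{y \<in> ?V. {x, y} \<in> ?E} = {y. {x, y} \<in> ?E}" using nb[of x] by blast
      then show ?thesis unfolding w_def using finV by (simp only: sum.inter_filter[symmetric])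
    qed
    also have "\<dots> = real (\<Sum>y | {x, y} \<in> ?E. \<alpha> x y) / a" by (simp add: sum_divide_distrib)
    also have "\<dots> \<le> 1" using of_nat_mono[OF \<alpha>(2)[OF x], where 'a = real] a0
      by (simp add: divide_le_eq_1 del: of_nat_sum)
    finally show "(\<Sum>y\<in>?V. w x y) \<le> 1" .
  next
    fix x assume x: "x \<in> embeddings H ?F"
    define f where "f = (\<lambda>i. \<alpha> (x i) (x (Suc i mod k)))"
    have nx: "Suc i mod k < k" for i using k by simp
    have xE: "{x i, x (Suc i mod k)} \<in> ?E" if "i < k" for i using x that by (simp add: embeddings_cycle)
    have xi: "inj_on x {..<k}" using x by (simp add: embeddings_def)
    have fr: "f i + \<alpha> (x (Suc i mod k)) (x i) = b" if "i < k" for i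
      unfolding f_def by (rule \<alpha>(1)[OF xE[OF that]])
    interpret cyclic_profile k b h f
    proof
      show "0 < k" "0 < b" using k b by auto
      show "f i \<le> b" if "i < k" for i using fr[OF that] by simp
      fix i assume i: "i < k"
      \<comment> \<open>The vertex \<open>x ?j\<close> holds \<open>f ?j\<close> tokens of the next
        edge and \<open>b - f i\<close> of the previous one. These edges differ as
        \<open>k >= 3\<close>, so both counts fit into \<open>a = b + h\<close>.\<close>
      let ?j = "Suc i mod k" and ?m = "Suc (Suc i mod k) mod k"
      have "?m \<noteq> i" using i k by (auto simp: Suc_mod_if split: if_splits)
      then have ne: "x ?m \<noteq> x i" using inj_onD[OF xi, of ?m i] i nx by auto
      have "f ?j + \<alpha> (x ?j) (x i) = (\<Sum>v\<in>{x ?m, x i}. \<alpha> (x ?j) v)" using ne by (simp add: f_def)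
      also have "\<dots> \<le> (\<Sum>v | {x ?j, v} \<in> ?E. \<alpha> (x ?j) v)"
        using xE[OF nx[of i]] xE[OF i, unfolded insert_commute[of "x i"]]
        by (intro sum_mono2[OF finite_subset[OF nb finV]]) auto
      also have "\<dots> \<le> a" by (rule \<alpha>(2)) (use E2[OF xE[OF i]] in blast)
      finally show "f ?j \<le> f i + h" using fr[OF i] abh by linarith
    qed
    have "good N (real k * (N + ln q) + 50 * real k)"
    \<comment> \<open>For small \<open>q\<close>, sparsity forces \<open>a / b <= 5 / 2\<close>, as
      \<open>good_exists\<close> requires. For larger \<open>q\<close> the budget
      \<open>k * (N + ln q)\<close> exceeds \<open>3 / 5 * k * N\<close>, which suits
      \<open>good_half\<close>.\<close>
    proof (cases "ln q \<le> - (2 / 5) * N")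
      case True
      have "real a * (2 / 5 * N) \<le> a * (- ln q)" using True by (intro mult_left_mono) auto
      also have "\<dots> \<le> b * N" using nq by simp
      finally have "N * (2 * real a) \<le> N * (5 * real b)" by (simp add: algebra_simps)
      then have "2 * real a \<le> 5 * real b" using N0 by (simp add: mult_le_cancel_left)
      then have "real (b + h) / real b \<le> 5 / 2" using b abh by (simp add: field_simps)
      moreover have "real h * N \<le> real (b + h) * (N + ln q)"
        using nq unfolding abh by (simp add: algebra_simps)
      ultimately have "good N (k * (N + ln q) + real (50 * k))" using N0 ND by (intro good_exists) auto
      then show ?thesis by simp
    next
      case False
      have "real (b + h) * 1 \<le> real a * (- ln q)" using q1 abh by (intro mult_mono) auto
      also have "\<dots> \<le> b * N" using nq by simp
      finally have "good N (k * (3 / 5 * N + 19))" using N0 k3 by (intro good_half) auto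
      moreover have "real k * (3 / 5 * N + 19) \<le> real k * ((N + ln q) + 50)"
        using False by (intro mult_left_mono) auto
      then have "real k * (3 / 5 * N + 19) \<le> real k * (N + ln q) + 50 * real k" by (simp add: algebra_simps)
      ultimately show ?thesis by (rule good_mono)
    qed
    from good_weights[OF this[unfolded N_def] n0(1)]
    obtain P where P: "real n ^ max 1 (crossings k P) \<le> exp (real k * (N + ln q) + 50 * real k) *
      (\<Prod>i<k. if P i then real (f i) / real (b + h) else real (b - f i) / real (b + h))"
      unfolding N_def by blast
    have "(\<Prod>i<k. if P i then real (f i) / real (b + h) else real (b - f i) / real (b + h)) =
      (\<Prod>i<k. if P i then w (x i) (x (Suc i mod k)) else w (x (Suc i mod k)) (x i))"
    proof (rule prod.cong[OF refl])
      fix i assume "i \<in> {..<k}"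
      then have i: "i < k" by simp
      have "b - f i = \<alpha> (x (Suc i mod k)) (x i)" using fr[OF i] by linarith
      then show "(if P i then real (f i) / real (b + h) else real (b - f i) / real (b + h)) =
        (if P i then w (x i) (x (Suc i mod k)) else w (x (Suc i mod k)) (x i))"
        using xE[OF i] by (simp only: w_def f_def abh insert_commute if_True)
    qed
    then show "\<exists>P. real n ^ max 1 (crossings k P) \<le> exp (real k * ln (real n * q) + 50 * real k) *
        (\<Prod>i<k. if P i then w (x i) (x (Suc i mod k)) else w (x (Suc i mod k)) (x i))"
      using P unfolding D by auto
  qed
qed

lemma cycle_copies_less_dense:
  assumes sp: "q_sparse n q H" and H: "subgraph H (clique_graph n)" and q: "0 < q"
    and k: "3 \<le> k" "k \<le> n" and \<eta>: "1 < real n ^ (k - 1) * q ^ k"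
    and L: "exp 60 \<le> L" and Lq: "L * q \<le> 1"
  shows "real (num_copies H (cycle_graph k)) < expected_copies n (L * q) (cycle_graph k)"
proof -
  let ?F = "cycle_graph k"
  have sH: "simple_graph H" and VH: "verts H \<subseteq> {..<n}" using H by (simp_all add: subgraph_def)
  have sF: "simple_graph ?F" by (rule simple_graph_cycle[OF k(1)])
  have n0: "0 < real n" using k by simp
  have L0: "0 < L" using L less_le_trans[OF exp_gt_zero] by blast
  have "60 \<le> ln L" using L L0 by (simp add: ln_ge_iff)
  moreover have "ln (L * q) \<le> 0" using Lq L0 q by (subst ln_le_zero_iff) auto
  ultimately have q1: "ln q \<le> - 1" using L0 q by (simp add: ln_mult)
  define T where "T = exp (real k * ln (real n * q) + 50 * real k)"
  have T: "T = (exp 50 * (n * q)) ^ k"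
  proof -
    have "T = exp (real k * (50 + ln (n * q)))" by (simp add: T_def algebra_simps)
    also have "\<dots> = exp (50 + ln (n * q)) ^ k" by (rule exp_of_nat_mult)
    also have "exp (50 + ln (n * q)) = exp 50 * (n * q)" using n0 q by (simp add: exp_add)
    finally show ?thesis .
  qed
  have emb: "real (card (embeddings H ?F)) \<le> real k * 2 ^ (k - 1) * T"
  proof (cases "embeddings H ?F = {}")
    case False
    obtain w where w: "\<And>x y. 0 \<le> w x y" "\<And>x. x \<in> verts H \<Longrightarrow> (\<Sum>y\<in>verts H. w x y) \<le> 1"
      "\<And>x. x \<in> embeddings H ?F \<Longrightarrow> \<exists>P. real n ^ max 1 (crossings k P) \<le>
        T * (\<Prod>i<k. if P i then w (x i) (x (Suc i mod k)) else w (x (Suc i mod k)) (x i))"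
      unfolding T_def by (rule cycle_embedding_weights[OF sp H q k \<eta> q1 False]) blast
    show ?thesis by (rule card_embeddings_cycle_le[OF sH VH k(1) _ w]) (simp_all add: T_def)
  qed (simp add: T_def)
  define A where "A = card (embeddings ?F ?F)"
  have A: "0 < A" unfolding A_def by (rule card_embeddings_self_pos[OF sF])
  define M where "M = num_copies (clique_graph n) ?F"
  have "real (num_copies H ?F) * A = card (embeddings H ?F)"
    by (simp add: card_embeddings[OF sH sF] A_def)
  also have "\<dots> \<le> real k * 2 ^ (k - 1) * T" by (rule emb)
  also have "\<dots> \<le> 2 ^ k * 2 ^ k * T"
  proof -
    have "real k < 2 ^ k" by (rule of_nat_less_two_power)
    moreover have "(2::real) ^ (k - 1) \<le> 2 ^ k" by (intro power_increasing) auto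
    ultimately show ?thesis by (intro mult_right_mono mult_mono) (auto simp: T_def)
  qed
  also have "\<dots> = (4 * exp 50 * (real n * q)) ^ k"
  proof -
    have "(4::real) ^ k = 2 ^ k * 2 ^ k" by (simp flip: power_mult_distrib)
    then show ?thesis by (simp only: T power_mult_distrib mult.assoc)
  qed
  also have "\<dots> < (L * q * (n / exp 1)) ^ k"
  proof (rule power_strict_mono)
    \<comment> \<open>The 4 bounds \<open>k * 2 ^ (k - 1)\<close> per vertex and
      \<open>exp 1\<close> comes from \<open>card_embeddings_complete_ge\<close>; this is where
      \<open>exp 60\<close> is used up.\<close>
    have "4 < exp (9::real)" using exp_ge_add_one_self[of "9::real"] by linarith
    then have "4 * exp 50 * exp 1 < exp 9 * exp 50 * exp (1::real)" by simp
    also have "\<dots> = exp 60" by (simp flip: exp_add)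
    also have "\<dots> \<le> L" by (rule L)
    finally have "4 * exp 50 < L / exp 1" by (simp add: field_simps)
    then have "4 * exp 50 * (n * q) < L / exp 1 * (n * q)" using n0 q by (intro mult_strict_right_mono) auto
    then show "4 * exp 50 * (n * q) < L * q * (n / exp 1)" by (simp add: mult_ac)
  qed (use k q in auto)
  also have "\<dots> = (L * q) ^ k * (real n / exp 1) ^ k" by (rule power_mult_distrib)
  also have "\<dots> \<le> (L * q) ^ k * card (embeddings (clique_graph n) ?F)"
    using card_embeddings_complete_ge[OF sF verts_cycle k(2)] L0 q by (intro mult_left_mono) auto
  also have "\<dots> = (M * (L * q) ^ k) * A"
    by (simp add: card_embeddings[OF simple_graph_clique sF] A_def M_def)
  finally have "real (num_copies H ?F) < M * (L * q) ^ k" using A by (simp add: mult_less_cancel_right)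
  then show ?thesis by (simp add: expected_copies_def M_def card_edges_cycle[OF k(1)])
qed

lemma cycle_copies_less:
  assumes sp: "q_sparse n q H" and H: "subgraph H (clique_graph n)" and q: "0 < q"
    and k: "3 \<le> k" "k \<le> n" and L: "exp 60 \<le> L"
  shows "real (num_copies H (cycle_graph k)) < expected_copies n (L * q) (cycle_graph k)"
proof -
  have "(1 + 60 / 2) ^ 2 \<le> exp (30::real) ^ 2"
    using exp_ge_add_one_self[of "30::real"] by (intro power_mono) auto
  also have "\<dots> = exp 60" by (simp flip: exp_of_nat_mult)
  finally have L100: "100 \<le> L" using L by simp
  consider "1 < L * q" | "L * q \<le> 1" "real n ^ (k - 1) * q ^ k \<le> 1"
    | "L * q \<le> 1" "1 < real n ^ (k - 1) * q ^ k" by linarith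
  then show ?thesis
  proof cases
    case 1
    have "edges (cycle_graph k) \<noteq> {}" using card_edges_cycle[OF k(1)] k(1) by auto
    then show ?thesis
      using k by (intro num_copies_less_trivial[OF H simple_graph_cycle[OF k(1)] verts_cycle k(2) _ _ 1]) auto
  next
    case 2
    then show ?thesis by (intro cycle_copies_less_sparse[OF sp H q k _ L100])
  next
    case 3
    then show ?thesis by (intro cycle_copies_less_dense[OF sp H q k _ L])
  qed
qed

text \<open>The ranges exclude cases in which the strict inequality can fail: \<open>q = 0\<close>
  or \<open>F\<close> larger than \<open>n\<close> gives \<open>0 < 0\<close>, and for
  \<open>K_0\<close> and \<open>K_1\<close> an edgeless \<open>H\<close> on all \<open>n\<close>
  vertices attains equality.\<close>

theorem theorem1p4:
  shows "\<exists>L :: real. \<forall>(n :: nat) (q :: real) (H :: nat ugraph) (F :: nat ugraph).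
    0 < q \<longrightarrow> q \<le> 1 \<longrightarrow> subgraph H (clique_graph n) \<longrightarrow> q_sparse n q H \<longrightarrow>
    ((\<exists>r. 2 \<le> r \<and> r \<le> n \<and> F = clique_graph r) \<or> (\<exists>k. 3 \<le> k \<and> k \<le> n \<and> F = cycle_graph k)) \<longrightarrow>
    real (num_copies H F) < expected_copies n (L * q) F"
proof (rule exI[of _ "exp 60"], intro allI impI)
  fix n q and H F :: "nat ugraph"
  assume *: "0 < q" "subgraph H (clique_graph n)" "q_sparse n q H"
    and "(\<exists>r. 2 \<le> r \<and> r \<le> n \<and> F = clique_graph r) \<or> (\<exists>k. 3 \<le> k \<and> k \<le> n \<and> F = cycle_graph k)"
  then consider r where "2 \<le> r" "r \<le> n" "F = clique_graph r" | k where "3 \<le> k" "k \<le> n" "F = cycle_graph k"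
    by blast
  then show "real (num_copies H F) < expected_copies n (exp 60 * q) F"
  proof cases
    case 1
    then show ?thesis using clique_copies_less[OF *(3,2,1)] by simp
  next
    case 2
    then show ?thesis using cycle_copies_less[OF *(3,2,1)] by simp
  qed
qed

end
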